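(* Let every machine have the same communication budget $B\ge\log_2 n$ ($m$ and $B$ may depend on $n$). Let $\hat f=\tilde f(\hat j)$ be the distributed estimator constructed in the context with the $L_\infty$-type selection rule $$\hat j=\min\big\{j\in\mathcal J:\ \|\tilde f(j)-\tilde f(l)\|_\infty\le\tau\sqrt{l2^l/n_l}\ \text{ for all } l>j,\ l\in\mathcal J\big\},$$ where $\tau>1$ is a sufficiently large constant. The construction does not use the smoothness $s$ of $f_0$. Then for every $L,s>0$ (and $n$ large enough) $\hat f\in\mathcal F_{dist}(B,\dots,B;B^s_{\infty,\infty}(L))$, and for all $s\in[s_{\min},s_{\max})$, $s>0$, $$\sup_{f_0\in B^s_{\infty,\infty}(L)}\mathbb E_{f_0,T}\|\hat f-f_0\|_\infty\ \lesssim\ \begin{cases}(n/\log_2 n)^{-s/(1+2s)}, & \text{if } B\ge t_n,\\[2mm] M_n\Big(\dfrac{n^{1/(1+2s)}}{B(\log_2 n)^{\frac{3+4s}{1+2s}}}\Big)^{\frac{s}{2+2s}}\Big(\dfrac{n}{\log_2 n}\Big)^{-\frac{s}{1+2s}}, & \text{if } B<t_n,\end{cases}$$ with $t_n=C_L(n/\log_2 n)^{\frac1{1+2s}}\log_2 n$, $C_L=12L^{2/(1+2s)}$ and $M_n=(\log_2 n)^{\frac{(5+8s)s}{(1+2s)(2+2s)}}$.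
   Context: Model. The total sample size is $n$ and there are $m=m_n$ local machines with $n/m\in\mathbb N$. Machine $i\in\{1,\dots,m\}$ observes pairs $(T^{(i)}_\ell,X^{(i)}_\ell)$, $\ell=1,\dots,n/m$, with $X^{(i)}_\ell=f_0(T^{(i)}_\ell)+\sigma\varepsilon^{(i)}_\ell$, where the $T^{(i)}_\ell$ are iid uniform on $(0,1)$, the $\varepsilon^{(i)}_\ell$ are iid $N(0,1)$, independent of the design, $\sigma>0$ is fixed and $f_0\in L_2[0,1]$ is unknown and common to all machines. $\mathbb E_{f_0,T}$ is expectation under the joint law of all data. Distributed estimators. Machine $i$ sends to a central machine a finite binary string $Y^{(i)}$ which is a measurable function of its local data; $l(Y)$ denotes the length of a string $Y$. For $\mathcal F\subset L_2[0,1]$, $\mathcal F_{dist}(B^{(1)},\dots,B^{(m)};\mathcal F)$ is the class of estimators $\hat f$ that are measurable functions of $(Y^{(1)},\dots,Y^{(m)})$ for such strings satisfying $\mathbb E_{f_0,T}[l(Y^{(i)})]\le B^{(i)}$ for all $f_0\in\mathcal F$ and all $i$. Wavelets and Besov balls. $\psi_{jk}$ ($j\ge 0$, $0\le k\le 2^j-1$) is a Cohen–Daubechies–Vial compactly supported orthonormal Daubechies wavelet basis of $L_2[0,1]$ of regularity $s_{\max}$ (which can be chosen arbitrarily large; coarsest-level scaling functions included in the indexing), $f_{jk}=\langle f,\psi_{jk}\rangle$, $\|f\|_{B^s_{\infty,\infty}}=\sup_{j,k}2^{j(s+1/2)}|f_{jk}|$ and $B^s_{\infty,\infty}(L)=\{f\in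 L_2[0,1]:\|f\|_{B^s_{\infty,\infty}}<L\}$. Local estimators: $\hat f^{(i)}_{jk}=\frac mn\sum_{\ell=1}^{n/m}X^{(i)}_\ell\psi_{jk}(T^{(i)}_\ell)$. TransApprox. For $x\in\mathbb R$ with binary expansion $|x|=\sum_{k=-\infty}^{\lfloor\log_2|x|\rfloor}b_k2^k$, $b_k\in\{0,1\}$, $\mathrm{TransApprox}(x)$ transmits the sign bit of $x$ and the digits $b_k$ with $-\frac12\log_2 n\le k\le\log_2|x|$; this encodes the number $y$ having the same sign as $x$ and $|y|=\sum_{-\frac12\log_2 n\le k\le\log_2|x|}b_k2^k$. Its length in bits is at most $1+(1\vee\log_2|x|)+\frac12\log_2 n$. $Y^{(i)}_{jk}=\mathrm{TransApprox}(\hat f^{(i)}_{jk})$ denotes both the bit string and the number it encodes. Smoothness range. $s_{\min}=\inf\{s>0:\ (n(\log_2 n)^2/m^{2+2s})^{1/(1+2s)}\le B\text{ for all sufficiently large }n\}$. Construction. Let $j_{B,n}=\lfloor\log_2\lfloor B/\log_2 n\rfloor\rfloor$, $j_{\max}=\lceil(2+2s_{\min})^{-1}\log_2(nB)\rceil\wedge\lceil(1+2s_{\min})^{-1}\log_2 n\rceil$, $\tilde\eta=j_{\max}-j_{B,n}$, $\mathcal J=\{0,\dots,j_{\max}\}$. Let $I$ be the set of the first $\lfloor m/2\rfloor$ machines. Split the remaining $\lceil m/2\rceil$ machines into $\tilde\eta$ groups $I_0,\dots,I_{\tilde\eta-1}$ of size $\lfloor\lceil m/2\rceil/\tilde\eta\rfloor$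 each (leftover machines discarded), and split each $I_t$ into $2^t$ subgroups $I_{t,1},\dots,I_{t,2^t}$ of size $\lfloor2^{-t}\lfloor\lceil m/2\rceil/\tilde\eta\rfloor\rfloor$ each, these sizes being taken to be at least $1$ (leftovers discarded). Machines $i\in I$ transmit $Y^{(i)}_{jk}$ for $0\le j\le j_{B,n}-1$, $0\le k\le2^j-1$. Machines $i\in I_{t,\ell}$ transmit $Y^{(i)}_{jk}$ for $j=j_{B,n}+t$ and $(\ell-1)2^{j_{B,n}}\le k<\ell2^{j_{B,n}}$. The central machine computes $\hat f_{jk}=|I|^{-1}\sum_{i\in I}Y^{(i)}_{jk}$ for $j<j_{B,n}$, and $\hat f_{jk}=|I_{t,\ell}|^{-1}\sum_{i\in I_{t,\ell}}Y^{(i)}_{jk}$ for $j=j_{B,n}+t$, $0\le t\le\tilde\eta-1$, $(\ell-1)2^{j_{B,n}}\le k<\ell2^{j_{B,n}}$. For $j\in\mathcal J$ put $\tilde f(j)=\sum_{l\le j-1}\sum_{k=0}^{2^l-1}\hat f_{lk}\psi_{lk}$. Let $n_j=|I|n/m$ for $j<j_{B,n}$ and $n_j=|I_{j-j_{B,n},1}|\,n/m=\lfloor2^{-(j-j_{B,n})}\lfloor\lceil m/2\rceil/\tilde\eta\rfloor\rfloor\,n/m$ for $j\ge j_{B,n}$ (so $n_j\asymp n$ for $j<j_{B,n}$ and $n_j\asymp nB/(2^j(\log_2 n)^2)$ for $j\ge j_{B,n}$). Notation. $a\wedge b=\min(a,b)$, $a\vee b=\max(a,b)$. For positive sequences, $a_n\lesssim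 b_n$ means $a_n\le Cb_n$ for all sufficiently large $n$ with a constant $C>0$ not depending on $n$ (it may depend on fixed quantities such as $s,L,\tau,\sigma$ and the wavelet basis); $a_n\asymp b_n$ means $a_n\lesssim b_n\lesssim a_n$. "Sufficiently large $\tau$" means larger than a threshold not depending on $n$ or on the smoothness $s$.
   Formalization: The risk bound (not the membership claim) is proved under the additional assumption s_min > 0; for s_min = 0 the stated bound fails, e.g. for m = n, B = log_2 n, f_0 = 0, where the selection rule picks j_max and the risk diverges. *)

theory Defs
  imports "HOL-Probability.Probability"
begin

section \<open>Square-integrable functions and the supremum norm on the unit interval\<close>

text \<open>Elements of the function space are represented by Borel functions on the real line of which
  only the restriction to the unit interval matters.\<close>

definition L2_01 :: "(real \<Rightarrow> real) set" where
  "L2_01 = {f. f \<in> borel_measurable borel \<and> set_integrable lborel {0..1} (\<lambda>x. (f x)\<^sup>2)}"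

definition inner_01 :: "(real \<Rightarrow> real) \<Rightarrow> (real \<Rightarrow> real) \<Rightarrow> real" where
  "inner_01 f g = (LINT x:{0..1}|lborel. f x * g x)"

definition sup_norm_01 :: "(real \<Rightarrow> real) \<Rightarrow> ennreal" where
  "sup_norm_01 f = esssup (restrict_space lborel {0..1}) (\<lambda>x. ennreal \<bar>f x\<bar>)"

definition dyadic_index :: "(nat \<times> nat) set" where
  "dyadic_index = {(j, k). k < 2 ^ j}"

definition orthonormal_basis_01 :: "(nat \<Rightarrow> nat \<Rightarrow> real \<Rightarrow> real) \<Rightarrow> bool" where
  "orthonormal_basis_01 \<psi> \<longleftrightarrow>
     (\<forall>(j, k)\<in>dyadic_index. \<psi> j k \<in> L2_01) \<and>
     (\<forall>(j, k)\<in>dyadic_index. \<forall>(j', k')\<in>dyadic_index.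
        inner_01 (\<psi> j k) (\<psi> j' k') = (if (j, k) = (j', k') then 1 else 0)) \<and>
     (\<forall>f\<in>L2_01. \<forall>\<epsilon>>0. \<exists>J c.
        (LINT x:{0..1}|lborel. (f x - (\<Sum>j<J. \<Sum>k<2 ^ j. c j k * \<psi> j k x))\<^sup>2) < \<epsilon>)"


section \<open>Cohen--Daubechies--Vial wavelets\<close>

text \<open>A Daubechies scaling function and mother wavelet with \<open>N\<close> vanishing moments, normalised so that
  the filter has the \<open>2 N\<close> taps \<open>1 - N, \<dots>, N\<close> and both functions are supported in \<open>[1 - N, N]\<close>.\<close>

definition daubechies_pair :: "nat \<Rightarrow> (real \<Rightarrow> real) \<Rightarrow> (real \<Rightarrow> real) \<Rightarrow> bool" where
  "daubechies_pair N \<phi> \<psi> \<longleftrightarrow>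
     0 < N \<and> \<phi> \<in> borel_measurable borel \<and>
     (\<forall>x. x \<notin> {1 - real N..real N} \<longrightarrow> \<phi> x = 0) \<and>
     (LINT x|lborel. \<phi> x) = 1 \<and>
     (\<forall>k::int. (LINT x|lborel. \<phi> x * \<phi> (x - of_int k)) = (if k = 0 then 1 else 0)) \<and>
     (\<exists>h :: int \<Rightarrow> real.
        (\<forall>x. \<phi> x = sqrt 2 * (\<Sum>k = 1 - int N..int N. h k * \<phi> (2 * x - of_int k))) \<and>
        (\<forall>x. \<psi> x = sqrt 2 * (\<Sum>k = 1 - int N..int N.
                                (-1) powi k * h (1 - k) * \<phi> (2 * x - of_int k)))) \<and>
     (\<forall>p<N. (LINT x|lborel. x ^ p * \<psi> x) = 0)"

text \<open>Hoelder regularity of order \<open>r\<close>: \<open>D i\<close> is the derivative of order \<open>i\<close>.\<close>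

definition hoelder_regular :: "real \<Rightarrow> (real \<Rightarrow> real) \<Rightarrow> bool" where
  "hoelder_regular r f \<longleftrightarrow>
     (\<exists>D :: nat \<Rightarrow> real \<Rightarrow> real. D 0 = f \<and>
        (\<forall>i < nat \<lfloor>r\<rfloor>. \<forall>x. (D i has_real_derivative D (Suc i) x) (at x)) \<and>
        continuous_on UNIV (D (nat \<lfloor>r\<rfloor>)) \<and>
        (\<exists>C. \<forall>x y. \<bar>D (nat \<lfloor>r\<rfloor>) x - D (nat \<lfloor>r\<rfloor>) y\<bar> \<le> C * \<bar>x - y\<bar> powr frac r))"

text \<open>The edge functions at the left endpoint, at unit scale.  The restrictions to the half line of
  the \<open>\<phi> (x - p)\<close> with \<open>p \<le> N - 1\<close> are combined so that polynomials of degree less than \<open>N\<close> are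
  reproduced; the resulting functions have the staggered supports \<open>[0, 2 N - 1 - k]\<close>, and
  Gram--Schmidt is run from \<open>k = N - 1\<close> downwards.\<close>

definition edge_scaling_pre :: "nat \<Rightarrow> (real \<Rightarrow> real) \<Rightarrow> nat \<Rightarrow> real \<Rightarrow> real" where
  "edge_scaling_pre N \<phi> k x =
     (if 0 \<le> x then \<Sum>p = k..2 * N - 2. real (p choose k) * \<phi> (x + real p - real N + 1) else 0)"

definition orthonormal_family :: "nat \<Rightarrow> (nat \<Rightarrow> real \<Rightarrow> real) \<Rightarrow> bool" where
  "orthonormal_family N e \<longleftrightarrow>
     (\<forall>k<N. \<forall>l<N. (LINT x|lborel. e k x * e l x) = (if k = l then 1 else 0))"

definition edge_scaling :: "nat \<Rightarrow> (real \<Rightarrow> real) \<Rightarrow> (nat \<Rightarrow> real \<Rightarrow> real) \<Rightarrow> bool" where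
  "edge_scaling N \<phi> e \<longleftrightarrow> orthonormal_family N e \<and>
     (\<forall>k<N. \<exists>c. \<forall>x. e k x = (\<Sum>i = k..<N. c i * edge_scaling_pre N \<phi> i x))"

text \<open>The edge wavelets are an orthonormalisation of the components of the edge scaling functions of
  the next finer scale that are orthogonal to the edge scaling functions of the current scale.\<close>

definition edge_wavelet_pre :: "nat \<Rightarrow> (nat \<Rightarrow> real \<Rightarrow> real) \<Rightarrow> nat \<Rightarrow> real \<Rightarrow> real" where
  "edge_wavelet_pre N e k x =
     sqrt 2 * e k (2 * x) - (\<Sum>i<N. (LINT y|lborel. sqrt 2 * e k (2 * y) * e i y) * e i x)"

definition edge_wavelet ::
  "nat \<Rightarrow> (nat \<Rightarrow> real \<Rightarrow> real) \<Rightarrow> (nat \<Rightarrow> real \<Rightarrow> real) \<Rightarrow> bool" where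
  "edge_wavelet N e w \<longleftrightarrow> orthonormal_family N w \<and>
     (\<forall>k<N. \<exists>c. \<forall>x. w k x = (\<Sum>i<N. c i * edge_wavelet_pre N e i x))"

text \<open>The \<open>2 ^ j\<close> functions of level \<open>j\<close> on the unit interval: \<open>N\<close> left edge functions, the interior
  translates, and \<open>N\<close> right edge functions given in the reflected coordinate \<open>1 - x\<close>.\<close>

definition interval_level ::
  "nat \<Rightarrow> (real \<Rightarrow> real) \<Rightarrow> (nat \<Rightarrow> real \<Rightarrow> real) \<Rightarrow> (nat \<Rightarrow> real \<Rightarrow> real)
     \<Rightarrow> nat \<Rightarrow> nat \<Rightarrow> real \<Rightarrow> real" where
  "interval_level N f left right j k x =
     2 powr (real j / 2) *
       (if k < N then left k (2 ^ j * x)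
        else if k < 2 ^ j - N then f (2 ^ j * x - real k)
        else right (2 ^ j - 1 - k) (2 ^ j * (1 - x)))"

text \<open>Cohen--Daubechies--Vial basis of regularity \<open>r\<close>, indexed by \<open>j \<ge> 0\<close> and \<open>k < 2 ^ j\<close>.  The system
  consists of \<open>2 ^ J\<^sub>0\<close> scaling functions at a coarsest level \<open>J\<^sub>0\<close> and of \<open>2 ^ l\<close> wavelets at each level
  \<open>l \<ge> J\<^sub>0\<close>.  There are only \<open>2 ^ J\<^sub>0 - 1\<close> index pairs with \<open>j < J\<^sub>0\<close>, so no bijection with the index
  pairs can keep all wavelets at their own level: \<open>\<pi>\<close> is any bijection that moves a wavelet up by at
  most one level and places the scaling functions at levels up to \<open>J\<^sub>0\<close>.\<close>

definition cdv_wavelet_basis :: "real \<Rightarrow> (nat \<Rightarrow> nat \<Rightarrow> real \<Rightarrow> real) \<Rightarrow> bool" where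
  "cdv_wavelet_basis r \<psi> \<longleftrightarrow> orthonormal_basis_01 \<psi> \<and>
     (\<exists>N J\<^sub>0 father mother sL sR wL wR (\<pi> :: nat \<times> nat \<Rightarrow> nat + nat \<times> nat).
        r \<le> real N \<and> 2 * N \<le> 2 ^ J\<^sub>0 \<and>
        daubechies_pair N father mother \<and> hoelder_regular r father \<and>
        edge_scaling N father sL \<and> edge_scaling N (\<lambda>x. father (1 - x)) sR \<and>
        edge_wavelet N sL wL \<and> edge_wavelet N sR wR \<and>
        bij_betw \<pi> dyadic_index
          (Inl ` {..<2 ^ J\<^sub>0} \<union> Inr ` {(l, k). J\<^sub>0 \<le> l \<and> k < 2 ^ l}) \<and>
        (\<forall>(j, k)\<in>dyadic_index.
           case \<pi> (j, k) of
             Inl k' \<Rightarrow> j \<le> J\<^sub>0 \<and> \<psi> j k = interval_level N father sL sR J\<^sub>0 k'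
           | Inr (l, k') \<Rightarrow> l \<le> j \<and> j \<le> l + 1 \<and> \<psi> j k = interval_level N mother wL wR l k'))"


section \<open>Besov balls\<close>

definition besov_norm :: "(nat \<Rightarrow> nat \<Rightarrow> real \<Rightarrow> real) \<Rightarrow> real \<Rightarrow> (real \<Rightarrow> real) \<Rightarrow> ennreal" where
  "besov_norm \<psi> s f =
     (SUP (j, k)\<in>dyadic_index. ennreal (2 powr (real j * (s + 1/2)) * \<bar>inner_01 f (\<psi> j k)\<bar>))"

definition besov_ball :: "(nat \<Rightarrow> nat \<Rightarrow> real \<Rightarrow> real) \<Rightarrow> real \<Rightarrow> real \<Rightarrow> (real \<Rightarrow> real) set" where
  "besov_ball \<psi> s L = {f \<in> L2_01. besov_norm \<psi> s f < ennreal L}"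


section \<open>The distributed regression model\<close>

text \<open>The data of one machine are a function \<open>x\<close> on \<open>{1..q}\<close> with \<open>x l = (T, X)\<close>; the data of all
  machines are a function \<open>d\<close> on \<open>{1..m}\<close> such that \<open>d i\<close> are the data of machine \<open>i\<close>.\<close>

definition obs_law :: "real \<Rightarrow> (real \<Rightarrow> real) \<Rightarrow> (real \<times> real) measure" where
  "obs_law \<sigma> f =
     distr (uniform_measure lborel {0<..<1} \<Otimes>\<^sub>M density lborel (\<lambda>e. ennreal (std_normal_density e)))
       (borel \<Otimes>\<^sub>M borel) (\<lambda>(t, e). (t, f t + \<sigma> * e))"

definition machine_space :: "nat \<Rightarrow> (nat \<Rightarrow> real \<times> real) measure" where
  "machine_space q = (\<Pi>\<^sub>M l\<in>{1..q}. borel \<Otimes>\<^sub>M borel)"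

definition data_law ::
  "real \<Rightarrow> nat \<Rightarrow> nat \<Rightarrow> (real \<Rightarrow> real) \<Rightarrow> (nat \<Rightarrow> nat \<Rightarrow> real \<times> real) measure" where
  "data_law \<sigma> m q f = (\<Pi>\<^sub>M i\<in>{1..m}. \<Pi>\<^sub>M l\<in>{1..q}. obs_law \<sigma> f)"

text \<open>No measurability of the decoder \<open>g\<close> is required: it is defined on the countable discrete space
  of \<open>m\<close>-tuples of binary strings.\<close>

definition F_dist ::
  "real \<Rightarrow> nat \<Rightarrow> nat \<Rightarrow> (nat \<Rightarrow> real) \<Rightarrow> (real \<Rightarrow> real) set
     \<Rightarrow> ((nat \<Rightarrow> nat \<Rightarrow> real \<times> real) \<Rightarrow> real \<Rightarrow> real) set" where
  "F_dist \<sigma> m q b \<F> =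
     {est. \<exists>(Y :: nat \<Rightarrow> (nat \<Rightarrow> real \<times> real) \<Rightarrow> bool list) (g :: (nat \<Rightarrow> bool list) \<Rightarrow> real \<Rightarrow> real).
        (\<forall>i\<in>{1..m}. Y i \<in> machine_space q \<rightarrow>\<^sub>M count_space UNIV) \<and>
        (\<forall>f\<in>\<F>. \<forall>i\<in>{1..m}.
           (\<integral>\<^sup>+ d. of_nat (length (Y i (d i))) \<partial>data_law \<sigma> m q f) \<le> ennreal (b i)) \<and>
        (\<forall>y. g y \<in> L2_01) \<and>
        (\<forall>d \<in> space (\<Pi>\<^sub>M i\<in>{1..m}. machine_space q). est d = g (\<lambda>i\<in>{1..m}. Y i (d i)))}"


section \<open>The estimator\<close>

text \<open>The number encoded by the transmitted bits; the digit \<open>b\<^sub>k\<close> of \<open>\<bar>x\<bar>\<close> is the parity of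
  \<open>\<lfloor>\<bar>x\<bar> / 2\<^sup>k\<rfloor>\<close>.\<close>

definition trans_approx :: "nat \<Rightarrow> real \<Rightarrow> real" where
  "trans_approx n x =
     sgn x * (\<Sum>k = \<lceil>- (log 2 (real n) / 2)\<rceil>..\<lfloor>log 2 \<bar>x\<bar>\<rfloor>.
                of_int (\<lfloor>\<bar>x\<bar> / 2 powi k\<rfloor> mod 2) * 2 powi k)"

definition local_coef ::
  "(nat \<Rightarrow> nat \<Rightarrow> real \<Rightarrow> real) \<Rightarrow> nat \<Rightarrow> nat \<Rightarrow> (nat \<Rightarrow> real \<times> real) \<Rightarrow> nat \<Rightarrow> nat \<Rightarrow> real" where
  "local_coef \<psi> n m x j k =
     real m / real n * (\<Sum>l = 1..n div m. snd (x l) * \<psi> j k (fst (x l)))"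

text \<open>Sample sizes range over a set \<open>A\<close>, because \<open>n / m\<^sub>n\<close> has to be an integer.  The infimum is
  \<open>\<infinity>\<close> if no \<open>s\<close> qualifies.\<close>

definition s_min :: "nat set \<Rightarrow> (nat \<Rightarrow> nat) \<Rightarrow> (nat \<Rightarrow> real) \<Rightarrow> ereal" where
  "s_min A m B = Inf (ereal ` {s. 0 < s \<and>
     (\<forall>\<^sub>F n in sequentially. n \<in> A \<longrightarrow>
        (real n * (log 2 (real n))\<^sup>2 / real (m n) powr (2 + 2 * s)) powr (1 / (1 + 2 * s)) \<le> B n)})"

text \<open>In the remaining definitions \<open>n\<close>, \<open>m\<close>, \<open>b\<close> are the sample size, the number of machines and the
  budget, and \<open>S\<close> is the lower end of the smoothness range.\<close>

definition j_B :: "nat \<Rightarrow> real \<Rightarrow> nat" where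
  "j_B n b = nat \<lfloor>log 2 (of_int \<lfloor>b / log 2 (real n)\<rfloor>)\<rfloor>"

definition j_max :: "ereal \<Rightarrow> nat \<Rightarrow> real \<Rightarrow> nat" where
  "j_max S n b = nat (min \<lceil>real_of_ereal (1 / (2 + 2 * S)) * log 2 (real n * b)\<rceil>
                          \<lceil>real_of_ereal (1 / (1 + 2 * S)) * log 2 (real n)\<rceil>)"

text \<open>Truncated subtraction: for \<open>j_max \<le> j_B\<close> there are no groups, all levels below \<open>j_max\<close> are
  estimated by the first half of the machines, and the group sizes below are \<open>0\<close>.\<close>

definition n_groups :: "ereal \<Rightarrow> nat \<Rightarrow> real \<Rightarrow> nat" where
  "n_groups S n b = j_max S n b - j_B n b"

definition group_size :: "ereal \<Rightarrow> nat \<Rightarrow> nat \<Rightarrow> real \<Rightarrow> nat" where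
  "group_size S n m b = ((m + 1) div 2) div n_groups S n b"

definition subgroup_size :: "ereal \<Rightarrow> nat \<Rightarrow> nat \<Rightarrow> real \<Rightarrow> nat \<Rightarrow> nat" where
  "subgroup_size S n m b t = group_size S n m b div 2 ^ t"

definition first_half :: "nat \<Rightarrow> nat set" where
  "first_half m = {1..m div 2}"

definition machine_subgroup :: "ereal \<Rightarrow> nat \<Rightarrow> nat \<Rightarrow> real \<Rightarrow> nat \<Rightarrow> nat \<Rightarrow> nat set" where
  "machine_subgroup S n m b t l =
     (let start = m div 2 + t * group_size S n m b + (l - 1) * subgroup_size S n m b t
      in {start + 1..start + subgroup_size S n m b t})"

text \<open>The machines that transmit the coefficient \<open>(j, k)\<close>; for \<open>j \<ge> j_B\<close> the subgroup index \<open>l\<close> is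
  determined by \<open>(l - 1) 2 ^ j_B \<le> k < l 2 ^ j_B\<close>.\<close>

definition senders :: "ereal \<Rightarrow> nat \<Rightarrow> nat \<Rightarrow> real \<Rightarrow> nat \<Rightarrow> nat \<Rightarrow> nat set" where
  "senders S n m b j k =
     (if j < j_B n b then first_half m
      else machine_subgroup S n m b (j - j_B n b) (k div 2 ^ j_B n b + 1))"

definition agg_coef ::
  "(nat \<Rightarrow> nat \<Rightarrow> real \<Rightarrow> real) \<Rightarrow> ereal \<Rightarrow> nat \<Rightarrow> nat \<Rightarrow> real
     \<Rightarrow> (nat \<Rightarrow> nat \<Rightarrow> real \<times> real) \<Rightarrow> nat \<Rightarrow> nat \<Rightarrow> real" where
  "agg_coef \<psi> S n m b d j k =
     (\<Sum>i\<in>senders S n m b j k. trans_approx n (local_coef \<psi> n m (d i) j k))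
       / real (card (senders S n m b j k))"

definition f_tilde ::
  "(nat \<Rightarrow> nat \<Rightarrow> real \<Rightarrow> real) \<Rightarrow> ereal \<Rightarrow> nat \<Rightarrow> nat \<Rightarrow> real
     \<Rightarrow> (nat \<Rightarrow> nat \<Rightarrow> real \<times> real) \<Rightarrow> nat \<Rightarrow> real \<Rightarrow> real" where
  "f_tilde \<psi> S n m b d j x = (\<Sum>l<j. \<Sum>k<2 ^ l. agg_coef \<psi> S n m b d l k * \<psi> l k x)"

definition n_eff :: "ereal \<Rightarrow> nat \<Rightarrow> nat \<Rightarrow> real \<Rightarrow> nat \<Rightarrow> real" where
  "n_eff S n m b j =
     (if j < j_B n b then real (card (first_half m)) * real n / real m
      else real (subgroup_size S n m b (j - j_B n b)) * real n / real m)"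

text \<open>The level \<open>j_max\<close> takes part in the selection although no machine transmits its coefficients;
  should \<open>n_eff\<close> vanish there, the threshold \<open>\<tau> \<surd>(l 2 ^ l / 0)\<close> is read as \<open>\<infinity>\<close>.\<close>

definition threshold :: "ereal \<Rightarrow> nat \<Rightarrow> nat \<Rightarrow> real \<Rightarrow> real \<Rightarrow> nat \<Rightarrow> ennreal" where
  "threshold S n m b \<tau> l =
     (if n_eff S n m b l = 0 then \<infinity>
      else ennreal (\<tau> * sqrt (real l * 2 ^ l / n_eff S n m b l)))"

definition j_hat ::
  "(nat \<Rightarrow> nat \<Rightarrow> real \<Rightarrow> real) \<Rightarrow> ereal \<Rightarrow> nat \<Rightarrow> nat \<Rightarrow> real \<Rightarrow> real
     \<Rightarrow> (nat \<Rightarrow> nat \<Rightarrow> real \<times> real) \<Rightarrow> nat" where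
  "j_hat \<psi> S n m b \<tau> d =
     Min {j \<in> {0..j_max S n b}. \<forall>l \<in> {0..j_max S n b}. j < l \<longrightarrow>
            sup_norm_01 (\<lambda>x. f_tilde \<psi> S n m b d j x - f_tilde \<psi> S n m b d l x)
              \<le> threshold S n m b \<tau> l}"

definition f_hat ::
  "(nat \<Rightarrow> nat \<Rightarrow> real \<Rightarrow> real) \<Rightarrow> ereal \<Rightarrow> nat \<Rightarrow> nat \<Rightarrow> real \<Rightarrow> real
     \<Rightarrow> (nat \<Rightarrow> nat \<Rightarrow> real \<times> real) \<Rightarrow> real \<Rightarrow> real" where
  "f_hat \<psi> S n m b \<tau> d = f_tilde \<psi> S n m b d (j_hat \<psi> S n m b \<tau> d)"


section \<open>Risk and rate\<close>

definition sup_risk ::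
  "real \<Rightarrow> nat \<Rightarrow> nat \<Rightarrow> (real \<Rightarrow> real) set
     \<Rightarrow> ((nat \<Rightarrow> nat \<Rightarrow> real \<times> real) \<Rightarrow> real \<Rightarrow> real) \<Rightarrow> ennreal" where
  "sup_risk \<sigma> m q \<F> est =
     (SUP f\<in>\<F>. \<integral>\<^sup>+ d. sup_norm_01 (\<lambda>x. est d x - f x) \<partial>data_law \<sigma> m q f)"

definition t_cutoff :: "real \<Rightarrow> real \<Rightarrow> nat \<Rightarrow> real" where
  "t_cutoff L s n = 12 * L powr (2 / (1 + 2 * s)) *
     (real n / log 2 (real n)) powr (1 / (1 + 2 * s)) * log 2 (real n)"

definition M_log :: "real \<Rightarrow> nat \<Rightarrow> real" where
  "M_log s n = log 2 (real n) powr ((5 + 8 * s) * s / ((1 + 2 * s) * (2 + 2 * s)))"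

definition rate :: "real \<Rightarrow> real \<Rightarrow> nat \<Rightarrow> real \<Rightarrow> real" where
  "rate L s n b =
     (if t_cutoff L s n \<le> b then (real n / log 2 (real n)) powr (- (s / (1 + 2 * s)))
      else M_log s n *
           (real n powr (1 / (1 + 2 * s)) /
              (b * log 2 (real n) powr ((3 + 4 * s) / (1 + 2 * s)))) powr (s / (2 + 2 * s)) *
           (real n / log 2 (real n)) powr (- (s / (1 + 2 * s))))"

end

theory Submission
  imports Defs "HOL-Real_Asymp.Real_Asymp"
begin

text \<open>Each machine sends prefix-free codes of its coefficients; since the local coefficients have
  bounded mean, a code has \<open>log 2 n / 2 + O(1)\<close> bits on average, and at most \<open>B / log 2 n\<close>
  coefficients are sent.

  For the risk, Bernstein-type bounds show that, outside an event of polynomially small probability,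
  all transmitted coefficients are within \<open>\<kappa> sqrt (log 2 n / n\<^sub>j)\<close> of the true ones, and there
  Lepski's argument is deterministic.  The oracle level is defined through the actual sample sizes
  \<open>n\<^sub>j\<close>: it is the predecessor of the first level \<open>l\<close> with \<open>n\<^sub>l \<le> log 2 n * 2 ^ (l (1 + 2 s))\<close>.
  At the predecessor the bias \<open>2 ^ (- j s)\<close> dominates the noise, so the risk is of the order of the
  bias there, even if \<open>n\<^sub>j\<close> drops by a logarithmic factor where the groups begin.\<close>

section \<open>Wavelet expansions\<close>

text \<open>The threshold \<tau> sqrt (l 2^l / n_l) carries the level number l, whereas the noise up
  to level l is controlled at the scale sqrt (log n * 2^l / n_l), since all coefficients have to be
  good simultaneously. The two scales agree only at levels of order log n, so the oracle level must
  be shown to grow like log n; the factor 1 / (4 + 4 s_max) is uniform over s < s_max. The bias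
  constant contains a geometric series with ratio 2^(-s) that blows up as s tends to 0, so it is
  taken at the lower end S > 0 of the smoothness range. These two choices make the requirement on
  \<tau> free of s and n. S > 0 also makes 2^j log n / n_j polynomially small, up to logarithms, on
  every transmitted level. This keeps the deviations in the sub-Gaussian range of the Bernstein
  bound although the wavelets of level j are as large as 2^(j/2). The loss is not shown to be
  measurable in the data; the risk is bounded through a measurable majorant.\<close>

lemma hoelder_regular_continuous:
  assumes "0 < r" "hoelder_regular r f"
  shows "continuous_on UNIV f"
proof -
  from assms obtain D :: "nat \<Rightarrow> real \<Rightarrow> real" where D: "D 0 = f"
     "\<forall>i < nat \<lfloor>r\<rfloor>. \<forall>x. (D i has_real_derivative D (Suc i) x) (at x)"
     "continuous_on UNIV (D (nat \<lfloor>r\<rfloor>))"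
    unfolding hoelder_regular_def by blast
  show ?thesis
  proof (cases "nat \<lfloor>r\<rfloor> = 0")
    case True
    with D show ?thesis by simp
  next
    case False
    then have "\<forall>x. (f has_real_derivative D (Suc 0) x) (at x)" using D by auto
    then show ?thesis
      by (meson DERIV_isCont continuous_at_imp_continuous_on)
  qed
qed

lemma continuous_compact_support_bounded:
  fixes f :: "real \<Rightarrow> real"
  assumes "continuous_on UNIV f" "\<And>x. x \<notin> {a..b} \<Longrightarrow> f x = 0"
  shows "\<exists>C\<ge>0. \<forall>x. \<bar>f x\<bar> \<le> C"
proof -
  have "compact (f ` {a..b})"
    by (intro compact_continuous_image) (auto intro: continuous_on_subset[OF assms(1)])
  then obtain C where C: "\<forall>y\<in>f ` {a..b}. norm y \<le> C"
    using compact_imp_bounded bounded_iff by metis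
  have "\<bar>f x\<bar> \<le> max C 0" for x
    using C assms(2)[of x] by (cases "x \<in> {a..b}") (auto simp: le_max_iff_disj)
  then show ?thesis by (intro exI[of _ "max C 0"]) auto
qed

text \<open>Edge functions and the mother wavelet are known only as finite combinations with unnamed
  coefficients; summing the bounds over the finite index set gives one constant for the whole
  family.\<close>

lemma linear_combinations_bounded:
  fixes e :: "'k \<Rightarrow> real \<Rightarrow> real" and g :: "'i \<Rightarrow> real \<Rightarrow> real"
  assumes K: "finite K" and e: "\<And>k. k \<in> K \<Longrightarrow> \<exists>c. \<forall>x. e k x = (\<Sum>i\<in>I k. c i * g i x)"
    and g: "\<And>k i x. k \<in> K \<Longrightarrow> i \<in> I k \<Longrightarrow> \<bar>g i x\<bar> \<le> b"
  shows "\<exists>C\<ge>0. \<forall>k\<in>K. \<forall>x. \<bar>e k x\<bar> \<le> C"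
proof -
  obtain c where c: "\<And>k x. k \<in> K \<Longrightarrow> e k x = (\<Sum>i\<in>I k. c k i * g i x)" using e by metis
  define B where "B k = (\<Sum>i\<in>I k. \<bar>c k i\<bar> * \<bar>b\<bar>)" for k
  have B0: "0 \<le> B k" for k unfolding B_def by (intro sum_nonneg) auto
  have "\<bar>e k x\<bar> \<le> sum B K" if k: "k \<in> K" for k x
  proof -
    have "\<bar>e k x\<bar> \<le> (\<Sum>i\<in>I k. \<bar>c k i * g i x\<bar>)" unfolding c[OF k] by (rule sum_abs)
    also have "\<dots> \<le> B k"
      unfolding B_def abs_mult by (intro sum_mono mult_left_mono order_trans[OF g[OF k]]) auto
    also have "\<dots> \<le> sum B K" using k K B0 by (intro member_le_sum) auto
    finally show ?thesis .
  qed
  then show ?thesis using B0 by (intro exI[of _ "sum B K"]) (auto intro: sum_nonneg)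
qed

lemma edge_scaling_bounded:
  assumes "edge_scaling N \<phi> e" "\<And>x. \<bar>\<phi> x\<bar> \<le> C"
  shows "\<exists>C'\<ge>0. \<forall>k\<in>{..<N}. \<forall>x. \<bar>e k x\<bar> \<le> C'"
proof -
  have C0: "0 \<le> C" using assms(2)[of 0] by linarith
  have "\<exists>c. \<forall>x. edge_scaling_pre N \<phi> k x
      = (\<Sum>p\<in>{k..2 * N - 2}. c p * (if 0 \<le> x then \<phi> (x + real p - real N + 1) else 0))" for k
    by (rule exI[of _ "\<lambda>p. real (p choose k)"]) (simp add: edge_scaling_pre_def)
  then have "\<exists>b\<ge>0. \<forall>k\<in>{..<N}. \<forall>x. \<bar>edge_scaling_pre N \<phi> k x\<bar> \<le> b"
    by (rule linear_combinations_bounded[OF finite_lessThan, where b = C]) (simp add: C0 assms(2))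
  then obtain b where b: "\<And>k x. k < N \<Longrightarrow> \<bar>edge_scaling_pre N \<phi> k x\<bar> \<le> b" by auto
  show ?thesis
  proof (rule linear_combinations_bounded[OF finite_lessThan])
    show "\<exists>c. \<forall>x. e k x = (\<Sum>i\<in>{k..<N}. c i * edge_scaling_pre N \<phi> i x)" if "k \<in> {..<N}" for k
      using assms(1) that unfolding edge_scaling_def by simp
  qed (use b in auto)
qed

lemma edge_wavelet_bounded:
  assumes "edge_wavelet N e w" "0 \<le> C" "\<And>k x. k < N \<Longrightarrow> \<bar>e k x\<bar> \<le> C"
  shows "\<exists>C'\<ge>0. \<forall>k\<in>{..<N}. \<forall>x. \<bar>w k x\<bar> \<le> C'"
proof -
  define I where "I k i = \<bar>LINT y|lborel. sqrt 2 * e k (2 * y) * e i y\<bar>" for k i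
  have pre: "\<bar>edge_wavelet_pre N e k x\<bar> \<le> sqrt 2 * C + (\<Sum>i<N. I k i * C)" if "k < N" for k x
  proof -
    have "\<bar>edge_wavelet_pre N e k x\<bar> \<le> \<bar>sqrt 2 * e k (2 * x)\<bar>
       + \<bar>\<Sum>i<N. (LINT y|lborel. sqrt 2 * e k (2 * y) * e i y) * e i x\<bar>"
      unfolding edge_wavelet_pre_def by (rule abs_triangle_ineq4)
    also have "\<bar>\<Sum>i<N. (LINT y|lborel. sqrt 2 * e k (2 * y) * e i y) * e i x\<bar>
       \<le> (\<Sum>i<N. \<bar>(LINT y|lborel. sqrt 2 * e k (2 * y) * e i y) * e i x\<bar>)"
      by (rule sum_abs)
    also have "\<dots> \<le> (\<Sum>i<N. I k i * C)"
      unfolding I_def by (intro sum_mono) (simp add: abs_mult mult_left_mono assms del: integral_mult_right_zero)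
    also have "\<bar>sqrt 2 * e k (2 * x)\<bar> \<le> sqrt 2 * C"
      using assms that by (simp add: abs_mult)
    finally show ?thesis by simp
  qed
  show ?thesis
  proof (rule linear_combinations_bounded[OF finite_lessThan])
    show "\<exists>c. \<forall>x. w k x = (\<Sum>i\<in>{..<N}. c i * edge_wavelet_pre N e i x)" if "k \<in> {..<N}" for k
      using assms(1) that unfolding edge_wavelet_def by simp
    show "\<bar>edge_wavelet_pre N e i x\<bar> \<le> (\<Sum>k<N. sqrt 2 * C + (\<Sum>i<N. I k i * C))" if "i \<in> {..<N}" for i x
    proof -
      have "0 \<le> sqrt 2 * C + (\<Sum>i<N. I k i * C)" for k
        using assms(2) by (intro add_nonneg_nonneg sum_nonneg mult_nonneg_nonneg) (auto simp: I_def)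
      then have "sqrt 2 * C + (\<Sum>j<N. I i j * C) \<le> (\<Sum>k<N. sqrt 2 * C + (\<Sum>i<N. I k i * C))"
        using that by (intro member_le_sum) auto
      then show ?thesis using pre[of i x] that by simp
    qed
  qed
qed

text \<open>Counts the interior translates whose support, of length \<open>2 * N - 1\<close>,
  contains a given point.\<close>

lemma card_nat_in_interval:
  assumes "1 \<le> N"
  shows "finite {k::nat. y - real N \<le> real k \<and> real k \<le> y + real N - 1}"
    and "card {k::nat. y - real N \<le> real k \<and> real k \<le> y + real N - 1} \<le> 2 * N"
proof -
  let ?K = "{k::nat. y - real N \<le> real k \<and> real k \<le> y + real N - 1}"
  have sub: "int ` ?K \<subseteq> {\<lceil>y\<rceil> - int N..\<lfloor>y\<rfloor> + int N - 1}"
  proof (rule image_subsetI)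
    fix k assume "k \<in> ?K"
    then have k: "y \<le> real_of_int (int k + int N)" "real_of_int (int k - int N + 1) \<le> y" by auto
    have "\<lceil>y\<rceil> \<le> int k + int N" using k(1) by (simp only: ceiling_le_iff)
    moreover have "int k - int N + 1 \<le> \<lfloor>y\<rfloor>" using k(2) by (simp only: le_floor_iff)
    ultimately show "int k \<in> {\<lceil>y\<rceil> - int N..\<lfloor>y\<rfloor> + int N - 1}" by simp
  qed
  then have fin: "finite (int ` ?K)" by (rule finite_subset) simp
  then show "finite ?K" by (rule finite_imageD) (simp add: inj_on_def)
  have "card ?K = card (int ` ?K)" by (simp add: card_image inj_on_def)
  also have "\<dots> \<le> card {\<lceil>y\<rceil> - int N..\<lfloor>y\<rfloor> + int N - 1}"
    using sub by (intro card_mono) auto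
  also have "\<dots> = nat (\<lfloor>y\<rfloor> + int N - 1 + 1 - (\<lceil>y\<rceil> - int N))" by simp
  also have "\<dots> \<le> 2 * N"
    using floor_le_ceiling[of y] by linarith
  finally show "card ?K \<le> 2 * N" .
qed

text \<open>At a fixed point at most \<open>2 * N\<close> interior translates are nonzero, and there
  are only \<open>2 * N\<close> edge functions. The bound therefore does not contain the number
  \<open>2 ^ l\<close> of functions, only the normalisation \<open>2 powr (l / 2)\<close>.\<close>

lemma interval_level_sum_bound:
  assumes "1 \<le> N"
    and supp: "\<And>x. x \<notin> {1 - real N..real N} \<Longrightarrow> f x = 0"
    and bf: "0 \<le> C" "\<And>x. \<bar>f x\<bar> \<le> C"
    and bl: "\<And>k x. k < N \<Longrightarrow> \<bar>lft k x\<bar> \<le> C" and br: "\<And>k x. k < N \<Longrightarrow> \<bar>rgt k x\<bar> \<le> C"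
  shows "(\<Sum>k<2 ^ l. \<bar>interval_level N f lft rgt l k x\<bar>) \<le> 4 * real N * C * 2 powr (real l / 2)"
proof -
  define K where "K = {k::nat. 2 ^ l * x - real N \<le> real k \<and> real k \<le> 2 ^ l * x + real N - 1}"
  have K: "finite K" "card K \<le> 2 * N"
    unfolding K_def using card_nat_in_interval[OF assms(1)] by auto
  define U where "U = {..<N} \<union> {2 ^ l - N..<2 ^ l} \<union> K"
  define P where "P = C * 2 powr (real l / 2)"
  have "card U \<le> card ({..<N} \<union> {2 ^ l - N..<2 ^ l}) + card K" unfolding U_def by (rule card_Un_le)
  also have "card ({..<N} \<union> {2 ^ l - N..<2 ^ l}) \<le> card {..<N} + card {2 ^ l - N..<2 ^ l}" by (rule card_Un_le)
  finally have cU: "card U \<le> 4 * N" and fU: "finite U" using K by (auto simp: U_def)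
  have le: "\<bar>interval_level N f lft rgt l k x\<bar> \<le> P" if "k < 2 ^ l" for k
    using that bl bf br by (auto simp: interval_level_def P_def abs_mult mult.commute intro!: mult_left_mono)
  have zero: "interval_level N f lft rgt l k x = 0" if "k < 2 ^ l" "k \<notin> U" for k
  proof -
    have "f (2 ^ l * x - real k) = 0" using that by (intro supp) (auto simp: U_def K_def)
    then show ?thesis using that by (auto simp: interval_level_def U_def)
  qed
  have "(\<Sum>k<2 ^ l. \<bar>interval_level N f lft rgt l k x\<bar>) = (\<Sum>k\<in>{..<2 ^ l} \<inter> U. \<bar>interval_level N f lft rgt l k x\<bar>)"
    using zero by (intro sum.mono_neutral_right) auto
  also have "\<dots> \<le> real (card ({..<2 ^ l} \<inter> U)) * P"
    using le by (intro sum_bounded_above) auto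
  also have "\<dots> \<le> real (4 * N) * P"
  proof (intro mult_right_mono of_nat_mono)
    show "card ({..<2 ^ l} \<inter> U) \<le> 4 * N" using cU card_mono[OF fU, of "{..<2 ^ l} \<inter> U"] by simp
  qed (use bf(1) in \<open>simp add: P_def\<close>)
  finally show ?thesis by (simp add: P_def mult.assoc)
qed

text \<open>The filter taps range over the same interval as the support of the father function, so
  \<open>2 * x - k\<close> lies outside the support whenever \<open>x\<close> does.\<close>

lemma daubechies_mother:
  assumes d: "daubechies_pair N \<phi> \<psi>" and b: "\<And>x. \<bar>\<phi> x\<bar> \<le> C"
  shows "\<exists>C'\<ge>0. \<forall>x. \<bar>\<psi> x\<bar> \<le> C'" and "x \<notin> {1 - real N..real N} \<Longrightarrow> \<psi> x = 0"
proof -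
  obtain h :: "int \<Rightarrow> real" where h: "\<And>x. \<psi> x = sqrt 2 * (\<Sum>k = 1 - int N..int N.
                                (-1) powi k * h (1 - k) * \<phi> (2 * x - of_int k))"
    using d unfolding daubechies_pair_def by blast
  have supp: "\<And>x. x \<notin> {1 - real N..real N} \<Longrightarrow> \<phi> x = 0"
    using d unfolding daubechies_pair_def by blast
  have "\<exists>C'\<ge>0. \<forall>k\<in>{0::nat}. \<forall>x. \<bar>\<psi> x\<bar> \<le> C'"
  proof (rule linear_combinations_bounded)
    show "\<exists>c. \<forall>x. \<psi> x = (\<Sum>k\<in>{1 - int N..int N}. c k * \<phi> (2 * x - of_int k))"
      by (rule exI[of _ "\<lambda>k. sqrt 2 * ((-1) powi k * h (1 - k))"]) (simp add: h sum_distrib_left mult.assoc)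
  qed (auto intro: b)
  then show "\<exists>C'\<ge>0. \<forall>x. \<bar>\<psi> x\<bar> \<le> C'" by simp
  assume x: "x \<notin> {1 - real N..real N}"
  have "\<phi> (2 * x - of_int k) = 0" if "k \<in> {1 - int N..int N}" for k
  proof (rule supp)
    have k: "1 - real N \<le> of_int k" "of_int k \<le> real N" using that by auto
    have "x < 1 - real N \<or> real N < x" using x by auto
    then show "2 * x - of_int k \<notin> {1 - real N..real N}"
    proof
      assume "x < 1 - real N" then have "2 * x - of_int k < 1 - real N" using k by linarith
      then show ?thesis by simp
    next
      assume "real N < x" then have "2 * x - of_int k > real N" using k by linarith
      then show ?thesis by simp
    qed
  qed
  then show "\<psi> x = 0" unfolding h by (simp add: sum.neutral)
qed

text \<open>Besides being an orthonormal basis, this is all that is used about the wavelets. The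
  reindexing \<pi> moves a wavelet up by at most one level, so level j consists of wavelets of
  levels j - 1 and j and of scaling functions at the fixed level \<open>J\<^sub>0\<close>, which
  contribute a constant.\<close>

lemma cdv_level_sum_bound:
  assumes "0 < r" "cdv_wavelet_basis r \<psi>"
  shows "\<exists>C\<ge>1. \<forall>j x. (\<Sum>k<2 ^ j. \<bar>\<psi> j k x\<bar>) \<le> C * 2 powr (real j / 2)"
proof -
  obtain N J\<^sub>0 father mother sL sR wL wR and \<pi> :: "nat \<times> nat \<Rightarrow> nat + nat \<times> nat" where
        d: "daubechies_pair N father mother" and hr: "hoelder_regular r father" and
        e: "edge_scaling N father sL" "edge_scaling N (\<lambda>x. father (1 - x)) sR"
        "edge_wavelet N sL wL" "edge_wavelet N sR wR" and
        bij: "bij_betw \<pi> dyadic_index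
          (Inl ` {..<2 ^ J\<^sub>0} \<union> Inr ` {(l, k). J\<^sub>0 \<le> l \<and> k < 2 ^ l})" and
        \<pi>: "\<forall>(j, k)\<in>dyadic_index.
           case \<pi> (j, k) of
             Inl k' \<Rightarrow> j \<le> J\<^sub>0 \<and> \<psi> j k = interval_level N father sL sR J\<^sub>0 k'
           | Inr (l, k') \<Rightarrow> l \<le> j \<and> j \<le> l + 1 \<and> \<psi> j k = interval_level N mother wL wR l k'"
    using assms(2) unfolding cdv_wavelet_basis_def by blast
  have N: "1 \<le> N" and supp: "\<And>x. x \<notin> {1 - real N..real N} \<Longrightarrow> father x = 0"
    using d unfolding daubechies_pair_def by auto
  obtain C1 where C1: "0 \<le> C1" "\<And>x. \<bar>father x\<bar> \<le> C1"
    using continuous_compact_support_bounded[OF hoelder_regular_continuous[OF assms(1) hr] supp] by blast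
  obtain C2 where C2: "0 \<le> C2" "\<And>x. \<bar>mother x\<bar> \<le> C2"
    using daubechies_mother(1)[OF d C1(2)] by blast
  obtain C3 where C3: "0 \<le> C3" "\<And>k x. k < N \<Longrightarrow> \<bar>sL k x\<bar> \<le> C3"
    using edge_scaling_bounded[OF e(1) C1(2)] by auto
  obtain C4 where C4: "0 \<le> C4" "\<And>k x. k < N \<Longrightarrow> \<bar>sR k x\<bar> \<le> C4"
    using edge_scaling_bounded[OF e(2) C1(2)] by auto
  obtain C5 where C5: "0 \<le> C5" "\<And>k x. k < N \<Longrightarrow> \<bar>wL k x\<bar> \<le> C5"
    using edge_wavelet_bounded[OF e(3) C3] by auto
  obtain C6 where C6: "0 \<le> C6" "\<And>k x. k < N \<Longrightarrow> \<bar>wR k x\<bar> \<le> C6"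
    using edge_wavelet_bounded[OF e(4) C4] by auto
  define C where "C = C1 + C2 + C3 + C4 + C5 + C6"
  have Cs: "0 \<le> C" "C1 \<le> C" "C2 \<le> C" "C3 \<le> C" "C4 \<le> C" "C5 \<le> C" "C6 \<le> C"
    unfolding C_def using C1(1) C2(1) C3(1) C4(1) C5(1) C6(1) by linarith+
  have S: "(\<Sum>k<2 ^ l. \<bar>interval_level N father sL sR l k x\<bar>) \<le> 4 * real N * C * 2 powr (real l / 2)" for l x
    by (rule interval_level_sum_bound[OF N supp Cs(1) order_trans[OF C1(2) Cs(2)]
       order_trans[OF C3(2) Cs(4)] order_trans[OF C4(2) Cs(5)]])
  have W: "(\<Sum>k<2 ^ l. \<bar>interval_level N mother wL wR l k x\<bar>) \<le> 4 * real N * C * 2 powr (real l / 2)" for l x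
    by (rule interval_level_sum_bound[OF N daubechies_mother(2)[OF d C1(2)] Cs(1)
       order_trans[OF C2(2) Cs(3)] order_trans[OF C5(2) Cs(6)] order_trans[OF C6(2) Cs(7)]])
  define \<Phi> where "\<Phi> p = (case p of Inl k' \<Rightarrow> interval_level N father sL sR J\<^sub>0 k'
           | Inr (l, k') \<Rightarrow> interval_level N mother wL wR l k')" for p :: "nat + nat \<times> nat"
  define D where "D = 4 * real N * C"
  have D0: "0 \<le> D" unfolding D_def using Cs by simp
  have "(\<Sum>k<2 ^ j. \<bar>\<psi> j k x\<bar>) \<le> (D * 2 powr (real J\<^sub>0 / 2) + 2 * D) * 2 powr (real j / 2)" for j x
  proof -
    \<comment> \<open>All indices that \<pi> can assign to level j. As \<pi> is injective, the sum
      over k runs over distinct elements of \<open>T\<close> and can be enlarged to all of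
      \<open>T\<close>. For j = 0 the range \<open>{j - 1..j}\<close> is just
      \<open>{0}\<close>.\<close>
    define T :: "(nat + nat \<times> nat) set"
      where "T = Inl ` {..<2 ^ J\<^sub>0} \<union> Inr ` (SIGMA l:{j - 1..j}. {..<2 ^ l})"
    have idx: "(j, k) \<in> dyadic_index" if "k < 2 ^ j" for k using that by (simp add: dyadic_index_def)
    have \<psi>\<Phi>: "\<psi> j k = \<Phi> (\<pi> (j, k)) \<and> \<pi> (j, k) \<in> T" if "k < 2 ^ j" for k
    proof -
      have img: "\<pi> (j, k) \<in> Inl ` {..<2 ^ J\<^sub>0} \<union> Inr ` {(l, k). J\<^sub>0 \<le> l \<and> k < 2 ^ l}"
        using bij idx[OF that] by (auto simp: bij_betw_def)
      have "case \<pi> (j, k) of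
             Inl k' \<Rightarrow> j \<le> J\<^sub>0 \<and> \<psi> j k = interval_level N father sL sR J\<^sub>0 k'
           | Inr (l, k') \<Rightarrow> l \<le> j \<and> j \<le> l + 1 \<and> \<psi> j k = interval_level N mother wL wR l k'"
        using \<pi> idx[OF that] by blast
      then show ?thesis using img unfolding \<Phi>_def T_def
        by (auto split: sum.splits prod.splits)
    qed
    have inj: "inj_on (\<lambda>k. \<pi> (j, k)) {..<2 ^ j}"
      using bij idx unfolding bij_betw_def inj_on_def by blast
    have "(\<Sum>k<2 ^ j. \<bar>\<psi> j k x\<bar>) = (\<Sum>p\<in>(\<lambda>k. \<pi> (j, k)) ` {..<2 ^ j}. \<bar>\<Phi> p x\<bar>)"
      using \<psi>\<Phi> by (subst sum.reindex[OF inj]) auto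
    also have "\<dots> \<le> (\<Sum>p\<in>T. \<bar>\<Phi> p x\<bar>)"
      using \<psi>\<Phi> by (intro sum_mono2) (auto simp: T_def)
    also have "\<dots> = (\<Sum>k<2 ^ J\<^sub>0. \<bar>\<Phi> (Inl k) x\<bar>) + (\<Sum>p\<in>(SIGMA l:{j - 1..j}. {..<2 ^ l}). \<bar>\<Phi> (Inr p) x\<bar>)"
      unfolding T_def by (subst sum.union_disjoint) (auto simp: sum.reindex)
    also have "(\<Sum>k<2 ^ J\<^sub>0. \<bar>\<Phi> (Inl k) x\<bar>) \<le> D * 2 powr (real J\<^sub>0 / 2)"
      using S[of J\<^sub>0 x] by (simp add: \<Phi>_def D_def)
    also have "(\<Sum>p\<in>(SIGMA l:{j - 1..j}. {..<2 ^ l}). \<bar>\<Phi> (Inr p) x\<bar>)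
       = (\<Sum>l\<in>{j - 1..j}. \<Sum>k<2 ^ l. \<bar>interval_level N mother wL wR l k x\<bar>)"
      by (subst sum.Sigma) (auto simp: \<Phi>_def split: prod.splits intro!: sum.cong)
    also have "\<dots> \<le> (\<Sum>l\<in>{j - 1..j}. D * 2 powr (real l / 2))"
      using W by (intro sum_mono) (simp add: D_def)
    also have "\<dots> \<le> (\<Sum>l\<in>{j - 1..j}. D * 2 powr (real j / 2))"
      using D0 by (intro sum_mono mult_left_mono powr_mono) auto
    also have "\<dots> = real (card {j - 1..j}) * (D * 2 powr (real j / 2))" by simp
    also have "\<dots> \<le> 2 * (D * 2 powr (real j / 2))"
    proof -
      have "card {j - 1..j} \<le> 2" by simp
      then show ?thesis using D0 by (intro mult_right_mono) auto
    qed
    also have "D * 2 powr (real J\<^sub>0 / 2) \<le> D * 2 powr (real J\<^sub>0 / 2) * 2 powr (real j / 2)"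
    proof -
      have "1 \<le> (2::real) powr (real j / 2)" by (simp add: ge_one_powr_ge_zero)
      moreover have "0 \<le> D * 2 powr (real J\<^sub>0 / 2)" using D0 by simp
      ultimately show ?thesis by (metis mult_le_cancel_left1 less_le_not_le)
    qed
    finally show ?thesis by (simp add: algebra_simps)
  qed
  note b = this
  show ?thesis
  proof (intro exI[of _ "D * 2 powr (real J\<^sub>0 / 2) + 2 * D + 1"] conjI allI)
    show "1 \<le> D * 2 powr (real J\<^sub>0 / 2) + 2 * D + 1" using D0 by simp
    fix j x
    show "(\<Sum>k<2 ^ j. \<bar>\<psi> j k x\<bar>) \<le> (D * 2 powr (real J\<^sub>0 / 2) + 2 * D + 1) * 2 powr (real j / 2)"
      using b[of j x] by (simp add: distrib_right) (smt (verit) powr_ge_zero)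
  qed
qed

lemma level_sum_imp_single:
  fixes k :: nat
  assumes "(\<Sum>k<2 ^ j. \<bar>\<psi> j k x\<bar>) \<le> (c :: real)" "k < 2 ^ j"
  shows "\<bar>\<psi> j k x\<bar> \<le> c"
proof -
  have "\<bar>\<psi> j k x\<bar> \<le> (\<Sum>k<2 ^ j. \<bar>\<psi> j k x\<bar>)" using assms(2) by (intro member_le_sum) auto
  then show ?thesis using assms(1) by linarith
qed

section \<open>Square-integrable functions on the unit interval\<close>

lemma LINT_01_eq:
  fixes f :: "real \<Rightarrow> real"
  shows "(LINT x:{0..1}|lborel. f x) = (LINT x|restrict_space lborel {0..1::real}. f x)"
  unfolding set_lebesgue_integral_def by (simp add: integral_restrict_space)

lemma L2_01_iff:
  "f \<in> L2_01 \<longleftrightarrow> f \<in> borel_measurable borel \<and> integrable (restrict_space lborel {0..1}) (\<lambda>x. (f x)\<^sup>2)"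
  unfolding L2_01_def set_integrable_def by (simp add: integrable_restrict_space)

lemma measurable_restrict_01:
  "f \<in> borel_measurable borel \<Longrightarrow> f \<in> borel_measurable (restrict_space lborel {0..1::real})"
  by (intro measurable_restrict_space1) simp

lemma L2_01_product_integrable:
  assumes "f \<in> L2_01" "g \<in> L2_01"
  shows "integrable (restrict_space lborel {0..1}) (\<lambda>x. f x * g x)"
proof (rule Bochner_Integration.integrable_bound)
  show "integrable (restrict_space lborel {0..1}) (\<lambda>x. (f x)\<^sup>2 + (g x)\<^sup>2)"
    using assms by (auto simp: L2_01_iff)
  show "(\<lambda>x. f x * g x) \<in> borel_measurable (restrict_space lborel {0..1})"
    using assms by (intro borel_measurable_times measurable_restrict_01) (auto simp: L2_01_iff)
  have "\<bar>a * b\<bar> \<le> a\<^sup>2 + b\<^sup>2" for a b :: real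
  proof -
    have "2 * (\<bar>a\<bar> * \<bar>b\<bar>) \<le> \<bar>a\<bar>\<^sup>2 + \<bar>b\<bar>\<^sup>2"
      using sum_squares_bound[of "\<bar>a\<bar>" "\<bar>b\<bar>"] by simp
    moreover have "0 \<le> \<bar>a\<bar> * \<bar>b\<bar>" by simp
    ultimately show ?thesis unfolding abs_mult power2_abs by linarith
  qed
  then show "AE x in restrict_space lborel {0..1}. norm (f x * g x) \<le> norm ((f x)\<^sup>2 + (g x)\<^sup>2)"
    by simp
qed

lemma L2_01_add:
  assumes "f \<in> L2_01" "g \<in> L2_01" shows "(\<lambda>x. f x + g x) \<in> L2_01"
proof -
  have "integrable (restrict_space lborel {0..1}) (\<lambda>x. (f x)\<^sup>2 + (g x)\<^sup>2 + 2 * (f x * g x))"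
    using assms L2_01_product_integrable[OF assms] by (auto simp: L2_01_iff)
  then show ?thesis using assms by (auto simp: L2_01_iff power2_sum mult.assoc)
qed

lemma L2_01_cmult: "f \<in> L2_01 \<Longrightarrow> (\<lambda>x. c * f x) \<in> L2_01"
  by (auto simp: L2_01_iff power_mult_distrib)

lemma L2_01_sum:
  assumes "\<And>i. i \<in> I \<Longrightarrow> f i \<in> L2_01" shows "(\<lambda>x. \<Sum>i\<in>I. f i x) \<in> L2_01"
  using assms
  by (induction I rule: infinite_finite_induct) (auto intro: L2_01_add simp: L2_01_iff[of "\<lambda>x. 0"])

lemma L2_01_minus: "f \<in> L2_01 \<Longrightarrow> g \<in> L2_01 \<Longrightarrow> (\<lambda>x. f x - g x) \<in> L2_01"
  using L2_01_add[of f "\<lambda>x. (-1) * g x"] L2_01_cmult[of g "-1"] by simp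

lemma inner_01_sum:
  assumes "f \<in> L2_01" "\<And>i. i \<in> I \<Longrightarrow> g i \<in> L2_01"
  shows "inner_01 f (\<lambda>x. \<Sum>i\<in>I. c i * g i x) = (\<Sum>i\<in>I. c i * inner_01 f (g i))"
proof -
  have "inner_01 f (\<lambda>x. \<Sum>i\<in>I. c i * g i x)
      = (LINT x|restrict_space lborel {0..1}. (\<Sum>i\<in>I. c i * (f x * g i x)))"
    unfolding inner_01_def LINT_01_eq by (simp add: sum_distrib_left mult_ac)
  also have "\<dots> = (\<Sum>i\<in>I. c i * inner_01 f (g i))"
    unfolding inner_01_def LINT_01_eq
    by (subst Bochner_Integration.integral_sum)
       (auto intro!: integrable_mult_right L2_01_product_integrable assms)
  finally show ?thesis .
qed

lemma inner_01_commute: "inner_01 f g = inner_01 g f"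
  by (simp add: inner_01_def mult.commute)

lemma inner_01_minus_left:
  "f \<in> L2_01 \<Longrightarrow> g \<in> L2_01 \<Longrightarrow> h \<in> L2_01 \<Longrightarrow> inner_01 (\<lambda>x. f x - g x) h = inner_01 f h - inner_01 g h"
  unfolding inner_01_def LINT_01_eq left_diff_distrib
  by (intro Bochner_Integration.integral_diff L2_01_product_integrable)

section \<open>Partial wavelet sums and convergence of the expansion\<close>

definition wavelet_sum :: "(nat \<Rightarrow> nat \<Rightarrow> real \<Rightarrow> real) \<Rightarrow> (nat \<Rightarrow> nat \<Rightarrow> real) \<Rightarrow> nat set \<Rightarrow> real \<Rightarrow> real" where
  "wavelet_sum \<psi> c I x = (\<Sum>l\<in>I. \<Sum>k<2 ^ l. c l k * \<psi> l k x)"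

context
  fixes \<psi> :: "nat \<Rightarrow> nat \<Rightarrow> real \<Rightarrow> real"
  assumes basis: "orthonormal_basis_01 \<psi>"
begin

lemma basis_L2: "k < 2 ^ j \<Longrightarrow> \<psi> j k \<in> L2_01"
  using basis unfolding orthonormal_basis_01_def dyadic_index_def by auto

lemma basis_orth:
  "k < 2 ^ j \<Longrightarrow> k' < 2 ^ j' \<Longrightarrow> inner_01 (\<psi> j k) (\<psi> j' k') = (if j = j' \<and> k = k' then 1 else 0)"
  using basis unfolding orthonormal_basis_01_def dyadic_index_def by auto

lemma wavelet_sum_L2: "wavelet_sum \<psi> c I \<in> L2_01"
  unfolding wavelet_sum_def[abs_def] by (intro L2_01_sum L2_01_cmult basis_L2) auto

lemma inner_wavelet_sum:
  assumes "f \<in> L2_01"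
  shows "inner_01 f (wavelet_sum \<psi> c I) = (\<Sum>l\<in>I. \<Sum>k<2 ^ l. c l k * inner_01 f (\<psi> l k))"
proof -
  have "inner_01 f (wavelet_sum \<psi> c I) = inner_01 f (\<lambda>x. \<Sum>l\<in>I. 1 * (\<Sum>k<2 ^ l. c l k * \<psi> l k x))"
    by (simp add: wavelet_sum_def[abs_def])
  also have "\<dots> = (\<Sum>l\<in>I. 1 * inner_01 f (\<lambda>x. \<Sum>k<2 ^ l. c l k * \<psi> l k x))"
    by (rule inner_01_sum[OF assms]) (intro L2_01_sum L2_01_cmult basis_L2, auto)
  also have "\<dots> = (\<Sum>l\<in>I. \<Sum>k<2 ^ l. c l k * inner_01 f (\<psi> l k))"
    by (simp, intro sum.cong refl inner_01_sum[OF assms] basis_L2) auto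
  finally show ?thesis .
qed

lemma wavelet_sum_coef:
  assumes "finite I" "j \<in> I" "k < 2 ^ j"
  shows "inner_01 (wavelet_sum \<psi> c I) (\<psi> j k) = c j k"
proof -
  have "inner_01 (wavelet_sum \<psi> c I) (\<psi> j k) = (\<Sum>l\<in>I. \<Sum>i<2 ^ l. c l i * inner_01 (\<psi> j k) (\<psi> l i))"
    by (subst inner_01_commute) (rule inner_wavelet_sum[OF basis_L2[OF assms(3)]])
  also have "\<dots> = (\<Sum>l\<in>I. \<Sum>i<2 ^ l. if l = j \<and> i = k then c j k else 0)"
    using assms by (intro sum.cong refl) (auto simp: basis_orth)
  also have "\<dots> = (\<Sum>l\<in>I. if l = j then c j k else 0)"
  proof (intro sum.cong refl)
    fix l
    show "(\<Sum>i<2 ^ l. if l = j \<and> i = k then c j k else 0) = (if l = j then c j k else 0)"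
      using assms(3) by (cases "l = j") (auto simp: sum.delta)
  qed
  also have "\<dots> = c j k" using assms by simp
  finally show ?thesis .
qed

text \<open>Pythagoras: the residual \<open>R\<close> of the projection is orthogonal to the
  difference \<open>Q\<close> of the two partial sums.\<close>

lemma partial_expansion_best:
  assumes f: "f \<in> L2_01"
  shows "(LINT x:{0..1}|lborel. (f x - wavelet_sum \<psi> (\<lambda>l k. inner_01 f (\<psi> l k)) {..<J} x)\<^sup>2)
     \<le> (LINT x:{0..1}|lborel. (f x - wavelet_sum \<psi> c {..<J} x)\<^sup>2)"
proof -
  let ?a = "\<lambda>l k. inner_01 f (\<psi> l k)"
  let ?M = "restrict_space lborel {0..1::real}"
  define P where "P = wavelet_sum \<psi> ?a {..<J}"
  define Q where "Q = wavelet_sum \<psi> (\<lambda>l k. ?a l k - c l k) {..<J}"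
  have PL: "P \<in> L2_01" and QL: "Q \<in> L2_01" unfolding P_def Q_def by (rule wavelet_sum_L2)+
  define R where "R = (\<lambda>x. f x - P x)"
  have RL: "R \<in> L2_01" unfolding R_def by (intro L2_01_minus f PL)
  have "inner_01 R (\<psi> l k) = 0" if "l \<in> {..<J}" "k < 2 ^ l" for l k
    unfolding R_def using that
    by (subst inner_01_minus_left[OF f PL basis_L2]) (auto simp: P_def wavelet_sum_coef)
  then have RQ: "inner_01 R Q = 0" unfolding Q_def by (simp add: inner_wavelet_sum[OF RL])
  have eq: "f x - wavelet_sum \<psi> c {..<J} x = R x + Q x" for x
    unfolding R_def P_def Q_def wavelet_sum_def by (simp add: left_diff_distrib sum_subtractf)
  have i1: "integrable ?M (\<lambda>x. (R x)\<^sup>2)" "integrable ?M (\<lambda>x. (Q x)\<^sup>2)" using RL QL by (auto simp: L2_01_iff)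
  have i2: "integrable ?M (\<lambda>x. R x * Q x)" by (rule L2_01_product_integrable[OF RL QL])
  have "(LINT x|?M. (R x + Q x)\<^sup>2) = (LINT x|?M. (R x)\<^sup>2 + (Q x)\<^sup>2 + 2 * (R x * Q x))"
    by (simp add: power2_sum mult.assoc)
  also have "\<dots> = (LINT x|?M. (R x)\<^sup>2) + (LINT x|?M. (Q x)\<^sup>2) + 2 * (LINT x|?M. R x * Q x)"
    using i1 i2 by simp
  also have "(LINT x|?M. R x * Q x) = 0" using RQ unfolding inner_01_def LINT_01_eq .
  finally have "(LINT x|?M. (R x)\<^sup>2) \<le> (LINT x|?M. (R x + Q x)\<^sup>2)" by simp
  then show ?thesis unfolding LINT_01_eq eq R_def P_def .
qed

text \<open>The basis property supplies some approximating coefficients; padding them with zeros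
  reaches any prescribed number of levels, and the true coefficients approximate at least as
  well.\<close>

lemma partial_expansion_converges:
  assumes f: "f \<in> L2_01" and "0 < \<epsilon>"
  shows "\<exists>J\<ge>J\<^sub>0. (LINT x:{0..1}|lborel. (f x - wavelet_sum \<psi> (\<lambda>l k. inner_01 f (\<psi> l k)) {..<J} x)\<^sup>2) < \<epsilon>"
proof -
  obtain J c where J: "(LINT x:{0..1}|lborel. (f x - (\<Sum>j<J. \<Sum>k<2 ^ j. c j k * \<psi> j k x))\<^sup>2) < \<epsilon>"
    using basis f \<open>0 < \<epsilon>\<close> unfolding orthonormal_basis_01_def by blast
  define K where "K = max J J\<^sub>0"
  define c' where "c' j k = (if j < J then c j k else 0)" for j k
  have "wavelet_sum \<psi> c' {..<K} x = (\<Sum>j<J. \<Sum>k<2 ^ j. c j k * \<psi> j k x)" for x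
  proof -
    have "wavelet_sum \<psi> c' {..<K} x = (\<Sum>j<J. \<Sum>k<2 ^ j. c' j k * \<psi> j k x)"
      unfolding wavelet_sum_def K_def by (rule sum.mono_neutral_right) (auto simp: c'_def)
    also have "\<dots> = (\<Sum>j<J. \<Sum>k<2 ^ j. c j k * \<psi> j k x)"
      by (intro sum.cong refl) (auto simp: c'_def)
    finally show ?thesis .
  qed
  then have "(LINT x:{0..1}|lborel. (f x - wavelet_sum \<psi> c' {..<K} x)\<^sup>2) < \<epsilon>" using J by simp
  then show ?thesis
    using partial_expansion_best[OF f, of K c'] by (intro exI[of _ K]) (auto simp: K_def)
qed

text \<open>The uniform bound passes to the limit because the excess of the error over it has vanishing
  \<open>L\<^sub>2\<close> norm.\<close>

lemma partial_expansion_error: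
  assumes f: "f \<in> L2_01"
    and b: "\<And>K x. J \<le> K \<Longrightarrow> \<bar>wavelet_sum \<psi> (\<lambda>l k. inner_01 f (\<psi> l k)) {J..<K} x\<bar> \<le> b"
  shows "AE x in restrict_space lborel {0..1}.
     \<bar>f x - wavelet_sum \<psi> (\<lambda>l k. inner_01 f (\<psi> l k)) {..<J} x\<bar> \<le> b"
proof -
  let ?a = "\<lambda>l k. inner_01 f (\<psi> l k)"
  let ?M = "restrict_space lborel {0..1::real}"
  define P where "P K = wavelet_sum \<psi> ?a {..<K}" for K
  define h where "h x = (max 0 (\<bar>f x - P J x\<bar> - b))\<^sup>2" for x
  have PL: "P K \<in> L2_01" for K unfolding P_def by (rule wavelet_sum_L2)
  have DL: "(\<lambda>x. f x - P K x) \<in> L2_01" for K by (intro L2_01_minus f PL)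
  have b0: "0 \<le> b" using b[of J 0] by (simp add: wavelet_sum_def)
  have split: "P K x = P J x + wavelet_sum \<psi> ?a {J..<K} x" if "J \<le> K" for K x
  proof -
    have "{..<K} = {..<J} \<union> {J..<K}" "{..<J} \<inter> {J..<K} = {}" using that by auto
    then show ?thesis unfolding P_def wavelet_sum_def by (simp add: sum.union_disjoint)
  qed
  have hb: "h x \<le> (f x - P K x)\<^sup>2" if "J \<le> K" for x K
  proof -
    have "max 0 (\<bar>f x - P J x\<bar> - b) \<le> \<bar>f x - P K x\<bar>"
      using split[OF that, of x] b[OF that, of x] by auto
    then have "h x \<le> \<bar>f x - P K x\<bar>\<^sup>2" unfolding h_def by (intro power_mono) auto
    then show ?thesis by simp
  qed
  have h0: "0 \<le> h x" for x by (simp add: h_def)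
  have [measurable]: "(\<lambda>x. f x - P J x) \<in> borel_measurable ?M"
    using DL[of J] by (intro measurable_restrict_01) (simp add: L2_01_iff)
  have hm[measurable]: "h \<in> borel_measurable ?M" unfolding h_def by measurable
  have hi: "integrable ?M h"
  proof (rule Bochner_Integration.integrable_bound)
    show "integrable ?M (\<lambda>x. (f x - P J x)\<^sup>2)" using DL[of J] by (simp add: L2_01_iff)
    show "AE x in ?M. norm (h x) \<le> norm ((f x - P J x)\<^sup>2)"
    proof (rule AE_I2)
      fix x show "norm (h x) \<le> norm ((f x - P J x)\<^sup>2)"
        unfolding real_norm_def abs_of_nonneg[OF h0] by (rule order_trans[OF hb[OF order_refl] abs_ge_self])
    qed
  qed (rule hm)
  have "integral\<^sup>L ?M h \<le> \<epsilon>" if "0 < \<epsilon>" for \<epsilon>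
  proof -
    have "\<exists>K\<ge>J. (LINT x:{0..1}|lborel. (f x - P K x)\<^sup>2) < \<epsilon>"
      unfolding P_def by (rule partial_expansion_converges[OF f that])
    then obtain K where K: "J \<le> K" "(LINT x:{0..1}|lborel. (f x - P K x)\<^sup>2) < \<epsilon>" by metis
    have "integral\<^sup>L ?M h \<le> (LINT x|?M. (f x - P K x)\<^sup>2)"
      by (rule integral_mono[OF hi _ hb[OF K(1)]]) (use DL[of K] in \<open>simp add: L2_01_iff\<close>)
    also have "\<dots> < \<epsilon>" using K(2) unfolding LINT_01_eq .
    finally show ?thesis by simp
  qed
  then have "integral\<^sup>L ?M h \<le> 0" by (metis add_0 field_le_epsilon)
  moreover have "0 \<le> integral\<^sup>L ?M h" by (rule Bochner_Integration.integral_nonneg[OF h0])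
  ultimately have "integral\<^sup>L ?M h = 0" by linarith
  then have "AE x in ?M. h x = 0"
    using integral_nonneg_eq_0_iff_AE[OF hi AE_I2[OF h0]] by blast
  then show ?thesis
  proof eventually_elim
    case (elim x)
    then have "max 0 (\<bar>f x - P J x\<bar> - b) = 0" unfolding h_def by (rule power_eq_0_iff[THEN iffD1, THEN conjunct1])
    then show ?case unfolding P_def by linarith
  qed
qed

end

section \<open>Besov balls: coefficients, tails and approximation in supremum norm\<close>

lemma wavelet_sum_bound:
  assumes \<psi>: "\<And>j x. (\<Sum>k<2 ^ j. \<bar>\<psi> j k x\<bar>) \<le> C * 2 powr (real j / 2)"
    and a: "\<And>l k. l \<in> I \<Longrightarrow> k < 2 ^ l \<Longrightarrow> \<bar>a l k\<bar> \<le> b l"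
  shows "\<bar>wavelet_sum \<psi> a I x\<bar> \<le> (\<Sum>l\<in>I. C * 2 powr (real l / 2) * b l)"
proof -
  have "\<bar>wavelet_sum \<psi> a I x\<bar> \<le> (\<Sum>l\<in>I. \<Sum>k<2 ^ l. \<bar>a l k * \<psi> l k x\<bar>)"
    unfolding wavelet_sum_def by (rule order_trans[OF sum_abs sum_mono[OF sum_abs]])
  also have "\<dots> \<le> (\<Sum>l\<in>I. C * 2 powr (real l / 2) * b l)"
  proof (rule sum_mono)
    fix l assume l: "l \<in> I"
    have b0: "0 \<le> b l" using a[OF l, of 0] by simp
    have "(\<Sum>k<2 ^ l. \<bar>a l k * \<psi> l k x\<bar>) \<le> (\<Sum>k<2 ^ l. b l * \<bar>\<psi> l k x\<bar>)"
      using a[OF l] by (intro sum_mono) (auto simp: abs_mult intro!: mult_right_mono)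
    also have "\<dots> = b l * (\<Sum>k<2 ^ l. \<bar>\<psi> l k x\<bar>)" by (simp add: sum_distrib_left)
    also have "\<dots> \<le> b l * (C * 2 powr (real l / 2))" by (intro mult_left_mono \<psi> b0)
    finally show "(\<Sum>k<2 ^ l. \<bar>a l k * \<psi> l k x\<bar>) \<le> C * 2 powr (real l / 2) * b l" by (simp add: mult_ac)
  qed
  finally show ?thesis .
qed

lemma besov_ball_coef:
  assumes "f \<in> besov_ball \<psi> s L" "k < 2 ^ j"
  shows "\<bar>inner_01 f (\<psi> j k)\<bar> \<le> L * 2 powr (- (real j * (s + 1/2)))"
proof -
  have "ennreal (2 powr (real j * (s + 1/2)) * \<bar>inner_01 f (\<psi> j k)\<bar>) \<le> besov_norm \<psi> s f"
    unfolding besov_norm_def using assms(2)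
    by (intro SUP_upper2[of "(j, k)"]) (auto simp: dyadic_index_def)
  also have "\<dots> < ennreal L" using assms(1) by (simp add: besov_ball_def)
  finally have "2 powr (real j * (s + 1/2)) * \<bar>inner_01 f (\<psi> j k)\<bar> \<le> L"
    by (simp add: ennreal_less_iff)
  then have "2 powr (- (real j * (s + 1/2))) * (2 powr (real j * (s + 1/2)) * \<bar>inner_01 f (\<psi> j k)\<bar>)
     \<le> 2 powr (- (real j * (s + 1/2))) * L" by (intro mult_left_mono) auto
  then show ?thesis
    by (simp add: mult.assoc[symmetric] powr_add[symmetric]) (simp add: mult.commute)
qed

lemma geometric_tail_bound:
  fixes q :: real
  assumes "0 \<le> q" "q < 1"
  shows "(\<Sum>l\<in>{J..<K}. q ^ l) \<le> q ^ J / (1 - q)"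
proof (cases "J \<le> K")
  case True
  then have "(\<Sum>l\<in>{J..<K}. q ^ l) = (q ^ J - q ^ K) / (1 - q)"
  proof (induction K rule: dec_induct)
    case (step n)
    have "(q ^ J - q ^ n) / (1 - q) + q ^ n = (q ^ J - q ^ n + q ^ n * (1 - q)) / (1 - q)"
      using assms by (simp add: field_simps)
    moreover have "q ^ J - q ^ n + q ^ n * (1 - q) = q ^ J - q ^ Suc n" by (simp add: algebra_simps)
    moreover have "(\<Sum>l\<in>{J..<Suc n}. q ^ l) = (\<Sum>l\<in>{J..<n}. q ^ l) + q ^ n" using step(1) by simp
    ultimately show ?case using step(3) by metis
  qed simp
  also have "\<dots> \<le> q ^ J / (1 - q)" using assms by (intro divide_right_mono) auto
  finally show ?thesis .
qed (use assms in auto)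

text \<open>\<open>C * L\<close> times the sum of the geometric series with ratio
  \<open>2 powr (- s)\<close>. It is unbounded as s tends to 0.\<close>

definition tail_const :: "real \<Rightarrow> real \<Rightarrow> real \<Rightarrow> real" where
  "tail_const C L s = C * L / (1 - 2 powr (- s))"

lemma tail_const_nonneg: "0 < s \<Longrightarrow> 1 \<le> C \<Longrightarrow> 0 < L \<Longrightarrow> 0 \<le> tail_const C L s"
  using powr_less_one[of 2 "- s"] by (simp add: tail_const_def)

text \<open>Allows the constants of all s above r to be replaced by the one at r, so that the
  requirement on \<tau> is uniform in s.\<close>

lemma tail_const_antimono:
  assumes "0 < r" "r \<le> s" "1 \<le> C" "0 < L"
  shows "tail_const C L s \<le> tail_const C L r"
proof -
  have "0 < 1 - (2::real) powr (- s)" "0 < 1 - (2::real) powr (- r)"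
    using assms powr_less_one[of 2 "- r"] powr_less_one[of 2 "- s"] by auto
  then show ?thesis
    unfolding tail_const_def using assms by (intro divide_left_mono mult_pos_pos) auto
qed

text \<open>The factor \<open>2 powr (l / 2)\<close> of a level sum cancels the 1/2 in the Besov
  exponent; what remains is geometric in \<open>2 powr (- s)\<close>.\<close>

lemma besov_tail_sum:
  assumes \<psi>: "\<And>j x. (\<Sum>k<2 ^ j. \<bar>\<psi> j k x\<bar>) \<le> C * 2 powr (real j / 2)" and "1 \<le> C"
    and f: "f \<in> besov_ball \<psi> s L" and s: "0 < s" and "0 < L"
  shows "\<bar>wavelet_sum \<psi> (\<lambda>l k. inner_01 f (\<psi> l k)) {J..<K} x\<bar> \<le> tail_const C L s * 2 powr (- (real J * s))"
proof -
  have "\<bar>wavelet_sum \<psi> (\<lambda>l k. inner_01 f (\<psi> l k)) {J..<K} x\<bar>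
      \<le> (\<Sum>l\<in>{J..<K}. C * 2 powr (real l / 2) * (L * 2 powr (- (real l * (s + 1/2)))))"
    by (intro wavelet_sum_bound \<psi> besov_ball_coef[OF f])
  also have "\<dots> = (\<Sum>l\<in>{J..<K}. C * L * (2 powr (- s)) ^ l)"
  proof (intro sum.cong refl)
    fix l
    have "(2::real) powr (real l / 2) * 2 powr (- (real l * (s + 1/2))) = (2 powr (- s)) ^ l"
      by (simp add: powr_realpow[symmetric] powr_powr powr_add[symmetric] algebra_simps)
    then show "C * 2 powr (real l / 2) * (L * 2 powr (- (real l * (s + 1/2)))) = C * L * (2 powr (- s)) ^ l"
      by (metis mult.assoc mult.left_commute)
  qed
  also have "\<dots> = C * L * (\<Sum>l\<in>{J..<K}. (2 powr (- s)) ^ l)" by (simp add: sum_distrib_left)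
  also have "\<dots> \<le> C * L * ((2 powr (- s)) ^ J / (1 - 2 powr (- s)))"
  proof -
    have "(2::real) powr (- s) < 1" using s by (simp add: powr_less_one)
    then show ?thesis using assms by (intro mult_left_mono geometric_tail_bound) auto
  qed
  also have "(2 powr (- s)) ^ J = (2::real) powr (- (real J * s))"
    by (simp add: powr_realpow[symmetric] powr_powr mult.commute)
  finally show ?thesis by (simp add: tail_const_def)
qed

lemma besov_approximation:
  assumes "orthonormal_basis_01 \<psi>"
    and "\<And>j x. (\<Sum>k<2 ^ j. \<bar>\<psi> j k x\<bar>) \<le> C * 2 powr (real j / 2)" "1 \<le> C"
    and f: "f \<in> besov_ball \<psi> s L" "0 < s" "0 < L"
  shows "AE x in restrict_space lborel {0..1}.
     \<bar>f x - wavelet_sum \<psi> (\<lambda>l k. inner_01 f (\<psi> l k)) {..<J} x\<bar> \<le> tail_const C L s * 2 powr (- (real J * s))"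
  using assms by (intro partial_expansion_error besov_tail_sum) (auto simp: besov_ball_def)

text \<open>The approximation bound with no levels at all. Essential boundedness of the regression
  function is what the exponential moments need.\<close>

lemma besov_ball_bounded:
  assumes "orthonormal_basis_01 \<psi>"
    and "\<And>j x. (\<Sum>k<2 ^ j. \<bar>\<psi> j k x\<bar>) \<le> C * 2 powr (real j / 2)" "1 \<le> C"
    and "f \<in> besov_ball \<psi> s L" "0 < s" "0 < L"
  shows "AE x in restrict_space lborel {0..1}. \<bar>f x\<bar> \<le> tail_const C L s"
  using besov_approximation[OF assms, of 0] by (simp add: wavelet_sum_def)

section \<open>Concentration of the local coefficients\<close>

lemma prob_space_std_normal: "prob_space std_normal_distribution"
  using prob_space_normal_density[of 1 0] by simp

text \<open>Completing the square turns the integrand into a multiple of the normal density with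
  mean \<open>c\<close>.\<close>

lemma nn_integral_std_normal_exp:
  "(\<integral>\<^sup>+ e. ennreal (exp (a + c * e)) \<partial>std_normal_distribution)
     = ennreal (exp (a + c\<^sup>2 / 2))"
proof -
  have eq: "std_normal_density e * exp (a + c * e) = exp (a + c\<^sup>2 / 2) * normal_density c 1 e" for e
  proof -
    have "- e\<^sup>2 / 2 + (a + c * e) = (a + c\<^sup>2 / 2) + - (e - c)\<^sup>2 / 2"
      by (simp add: power2_diff field_simps)
    then show ?thesis unfolding normal_density_def by (simp add: exp_add[symmetric])
  qed
  have "(\<integral>\<^sup>+ e. ennreal (exp (a + c * e)) \<partial>std_normal_distribution)
     = (\<integral>\<^sup>+ e. ennreal (exp (a + c\<^sup>2 / 2)) * ennreal (normal_density c 1 e) \<partial>lborel)"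
    by (subst nn_integral_density) (auto simp: ennreal_mult[symmetric] eq)
  also have "\<dots> = ennreal (exp (a + c\<^sup>2 / 2)) * (\<integral>\<^sup>+ e. ennreal (normal_density c 1 e) \<partial>lborel)"
    by (rule nn_integral_cmult) simp
  also have "(\<integral>\<^sup>+ e. ennreal (normal_density c 1 e) \<partial>lborel) = 1"
    by (subst nn_integral_eq_integral) auto
  finally show ?thesis by simp
qed

lemma nn_integral_std_normal_square:
  "(\<integral>\<^sup>+ e. ennreal (e\<^sup>2) \<partial>std_normal_distribution) = 1"
proof -
  have "(\<integral>\<^sup>+ e. ennreal (e\<^sup>2) \<partial>std_normal_distribution)
     = (\<integral>\<^sup>+ e. ennreal (std_normal_density e * e ^ (2 * 1)) \<partial>lborel)"
    by (subst nn_integral_density) (auto simp: ennreal_mult)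
  also have "\<dots> = ennreal (fact (2 * 1) / (2 ^ 1 * fact 1))"
    using std_normal_moment_even[of 1]
    by (intro nn_integral_eq_integral[THEN trans]) (auto simp: has_bochner_integral_iff)
  finally show ?thesis by simp
qed

lemma prob_space_uniform_01: "prob_space (uniform_measure lborel {0<..<1::real})"
  by (intro prob_space_uniform_measure) auto

lemma measurable_observation:
  assumes [measurable]: "f \<in> borel_measurable borel"
  shows "(\<lambda>(t, e). (t, f t + \<sigma> * e)) \<in>
    uniform_measure lborel {0<..<1} \<Otimes>\<^sub>M std_normal_distribution \<rightarrow>\<^sub>M borel \<Otimes>\<^sub>M borel"
  by measurable

lemma sets_obs_law [simp, measurable_cong]: "sets (obs_law \<sigma> f) = sets (borel \<Otimes>\<^sub>M borel)"
  by (simp add: obs_law_def)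

lemma prob_space_obs_law:
  assumes "f \<in> borel_measurable borel"
  shows "prob_space (obs_law \<sigma> f)"
proof -
  interpret U: prob_space "uniform_measure lborel {0<..<1::real}" by (rule prob_space_uniform_01)
  interpret N: prob_space "std_normal_distribution" by (rule prob_space_std_normal)
  interpret UN: pair_prob_space "uniform_measure lborel {0<..<1::real}"
    "std_normal_distribution" ..
  show ?thesis unfolding obs_law_def by (intro UN.prob_space_distr measurable_observation assms)
qed

text \<open>The design lives on the open interval and the norms on the closed one; the endpoints are
  null.\<close>

lemma nn_integral_uniform_01:
  assumes [measurable]: "g \<in> borel_measurable borel"
  shows "(\<integral>\<^sup>+ t. g t \<partial>uniform_measure lborel {0<..<1::real}) = (\<integral>\<^sup>+ t. g t \<partial>restrict_space lborel {0..1})"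
proof -
  have "(\<integral>\<^sup>+ t. g t \<partial>uniform_measure lborel {0<..<1::real}) = (\<integral>\<^sup>+ t. g t * indicator {0<..<1} t \<partial>lborel)"
    by (subst nn_integral_uniform_measure) (auto simp: divide_ennreal_def)
  also have "\<dots> = (\<integral>\<^sup>+ t. g t * indicator {0..1} t \<partial>lborel)"
    by (rule nn_integral_cong_AE)
       (use AE_lborel_singleton[of "0::real"] AE_lborel_singleton[of "1::real"] in
        \<open>eventually_elim, auto split: split_indicator\<close>)
  finally show ?thesis by (simp add: nn_integral_restrict_space)
qed

lemma nn_integral_obs_law:
  assumes [measurable]: "f \<in> borel_measurable borel" "g \<in> borel_measurable (borel \<Otimes>\<^sub>M borel)"
  shows "(\<integral>\<^sup>+ z. g z \<partial>obs_law \<sigma> f) =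
     (\<integral>\<^sup>+ t. \<integral>\<^sup>+ e. g (t, f t + \<sigma> * e) \<partial>std_normal_distribution \<partial>restrict_space lborel {0..1})"
proof -
  let ?N = "std_normal_distribution"
  interpret N: prob_space ?N by (rule prob_space_std_normal)
  have "(\<lambda>(t, e). (t, f t + \<sigma> * e)) \<in> borel \<Otimes>\<^sub>M ?N \<rightarrow>\<^sub>M borel \<Otimes>\<^sub>M borel" by measurable
  note gm0 = measurable_compose[OF this assms(2)]
  have gm: "(\<lambda>t. \<integral>\<^sup>+ e. g (t, f t + \<sigma> * e) \<partial>?N) \<in> borel_measurable borel"
    using N.borel_measurable_nn_integral_fst[OF gm0] by simp
  have m: "(\<lambda>p. g (case p of (t, e) \<Rightarrow> (t, f t + \<sigma> * e))) \<in>
      borel_measurable (uniform_measure lborel {0<..<1} \<Otimes>\<^sub>M ?N)"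
    by (rule measurable_compose[OF measurable_observation[OF assms(1), of \<sigma>] assms(2)])
  have "(\<integral>\<^sup>+ z. g z \<partial>obs_law \<sigma> f)
      = (\<integral>\<^sup>+ p. g (case p of (t, e) \<Rightarrow> (t, f t + \<sigma> * e)) \<partial>(uniform_measure lborel {0<..<1} \<Otimes>\<^sub>M ?N))"
    unfolding obs_law_def by (rule nn_integral_distr[OF measurable_observation[OF assms(1), of \<sigma>]]) (simp add: assms(2))
  also have "\<dots> = (\<integral>\<^sup>+ t. \<integral>\<^sup>+ e. g (t, f t + \<sigma> * e) \<partial>?N \<partial>uniform_measure lborel {0<..<1})"
    using N.nn_integral_fst[OF m] by simp
  also have "\<dots> = (\<integral>\<^sup>+ t. \<integral>\<^sup>+ e. g (t, f t + \<sigma> * e) \<partial>?N \<partial>restrict_space lborel {0..1})"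
    by (rule nn_integral_uniform_01[OF gm])
  finally show ?thesis .
qed

text \<open>Taylor formula of order two with Lagrange remainder, whose factor 1/2 is
  dropped.\<close>

lemma exp_le_quadratic: "exp x \<le> 1 + x + x\<^sup>2 * exp \<bar>x\<bar>" for x :: real
proof -
  obtain t where t: "\<bar>t\<bar> \<le> \<bar>x\<bar>" "exp x = (\<Sum>m<2. (x ^ m) / fact m) + (exp t / fact 2) * x ^ 2"
    using Maclaurin_exp_le[of x 2] by blast
  have "exp t / 2 * x\<^sup>2 \<le> x\<^sup>2 * exp \<bar>x\<bar>"
  proof -
    have "exp t \<le> exp \<bar>x\<bar>" using t(1) by simp
    then have "exp t / 2 \<le> exp \<bar>x\<bar>" using exp_gt_zero[of t] by linarith
    then have "exp t / 2 * x\<^sup>2 \<le> exp \<bar>x\<bar> * x\<^sup>2" by (rule mult_right_mono) simp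
    then show ?thesis by (simp only: mult.commute)
  qed
  then show ?thesis using t(2) by (simp add: numeral_2_eq_2)
qed

text \<open>Cumulant constant of one observation: after integrating out the noise the exponent is
  \<open>u f(t) + u\<^sup>2 \<sigma>\<^sup>2 / 2\<close> with \<open>u = \<theta> \<psi>(t)\<close>, which is bounded for \<open>\<bar>u\<bar> \<le> 1\<close>.\<close>

definition mgf_const :: "real \<Rightarrow> real \<Rightarrow> real" where
  "mgf_const \<sigma> F = \<sigma>\<^sup>2 + (F + \<sigma>\<^sup>2)\<^sup>2 * exp (F + \<sigma>\<^sup>2) + 1"

text \<open>The linear term \<open>u * a\<close> is kept exactly because its integral has to cancel
  the mean. The remaining terms are of order \<open>u\<^sup>2\<close>, as the whole exponent is at
  most \<open>\<bar>u\<bar> * (F + \<sigma>\<^sup>2)\<close> in modulus.\<close>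

lemma exp_le_quadratic_mgf:
  assumes "\<bar>u\<bar> \<le> 1" "\<bar>a\<bar> \<le> F"
  shows "exp (u * a + (u * \<sigma>)\<^sup>2 / 2) \<le> 1 + u * a + mgf_const \<sigma> F * u\<^sup>2"
proof -
  define x where "x = u * a + (u * \<sigma>)\<^sup>2 / 2"
  have "\<bar>x\<bar> \<le> \<bar>u * a\<bar> + \<bar>(u * \<sigma>)\<^sup>2 / 2\<bar>" unfolding x_def by (rule abs_triangle_ineq)
  also have "\<dots> = \<bar>u\<bar> * (\<bar>a\<bar> + \<bar>u\<bar> * (\<sigma>\<^sup>2 / 2))"
    by (simp add: abs_mult power_mult_distrib power2_eq_square algebra_simps)
  also have "\<dots> \<le> \<bar>u\<bar> * (F + 1 * \<sigma>\<^sup>2)"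
    using assms by (intro mult_left_mono add_mono mult_mono) auto
  finally have x: "\<bar>x\<bar> \<le> \<bar>u\<bar> * (F + \<sigma>\<^sup>2)" by simp
  have G: "0 \<le> F + \<sigma>\<^sup>2" using assms(2) zero_le_power2[of \<sigma>] by linarith
  have "\<bar>u\<bar> * (F + \<sigma>\<^sup>2) \<le> F + \<sigma>\<^sup>2" using assms(1) G by (simp add: mult_left_le_one_le)
  then have e: "exp \<bar>x\<bar> \<le> exp (F + \<sigma>\<^sup>2)" using x by simp
  have "x\<^sup>2 \<le> (\<bar>u\<bar> * (F + \<sigma>\<^sup>2))\<^sup>2"
    using x by (metis abs_ge_zero power2_abs power_mono)
  then have x2: "x\<^sup>2 \<le> u\<^sup>2 * (F + \<sigma>\<^sup>2)\<^sup>2" by (simp add: power_mult_distrib)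
  have "exp x \<le> 1 + x + x\<^sup>2 * exp \<bar>x\<bar>" by (rule exp_le_quadratic)
  also have "x\<^sup>2 * exp \<bar>x\<bar> \<le> (u\<^sup>2 * (F + \<sigma>\<^sup>2)\<^sup>2) * exp (F + \<sigma>\<^sup>2)"
    using x2 e by (intro mult_mono) auto
  also have "1 + x + (u\<^sup>2 * (F + \<sigma>\<^sup>2)\<^sup>2) * exp (F + \<sigma>\<^sup>2)
      = 1 + u * a + u\<^sup>2 * (\<sigma>\<^sup>2 / 2 + (F + \<sigma>\<^sup>2)\<^sup>2 * exp (F + \<sigma>\<^sup>2))"
    unfolding x_def power_mult_distrib by argo
  also have "\<dots> \<le> 1 + u * a + u\<^sup>2 * mgf_const \<sigma> F"
    by (intro add_left_mono mult_left_mono) (auto simp: mgf_const_def)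
  finally show ?thesis unfolding x_def by (simp only: mult.commute[of "u\<^sup>2" "mgf_const \<sigma> F"])
qed

lemma prob_space_01: "prob_space (restrict_space lborel {0..1::real})"
  by (rule prob_spaceI) (simp add: space_restrict_space emeasure_restrict_space)

text \<open>A Bernstein-type estimate: since the wavelet has unit norm, the quadratic term
  integrates to a constant times \<open>\<theta>\<^sup>2\<close>. The supremum of the wavelet, which
  grows with the level, enters only through the admissible range of \<theta>.\<close>

lemma obs_law_mgf:
  assumes f: "f \<in> L2_01" "AE t in restrict_space lborel {0..1}. \<bar>f t\<bar> \<le> F"
    and \<psi>: "\<psi> \<in> L2_01" "inner_01 \<psi> \<psi> = 1" "\<And>t. \<bar>\<theta> * \<psi> t\<bar> \<le> 1"
  shows "(\<integral>\<^sup>+ z. ennreal (exp (\<theta> * (snd z * \<psi> (fst z) - inner_01 f \<psi>))) \<partial>obs_law \<sigma> f)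
     \<le> ennreal (exp (mgf_const \<sigma> F * \<theta>\<^sup>2))"
proof -
  let ?N = "std_normal_distribution"
  let ?M = "restrict_space lborel {0..1::real}"
  define \<mu> where "\<mu> = inner_01 f \<psi>"
  define V where "V = mgf_const \<sigma> F"
  interpret M: prob_space ?M by (rule prob_space_01)
  have [measurable]: "f \<in> borel_measurable borel" "\<psi> \<in> borel_measurable borel"
    using f \<psi> by (auto simp: L2_01_iff)
  have V0: "0 \<le> V" unfolding V_def mgf_const_def by simp
  have "(\<integral>\<^sup>+ z. ennreal (exp (\<theta> * (snd z * \<psi> (fst z) - \<mu>))) \<partial>obs_law \<sigma> f)
     = (\<integral>\<^sup>+ t. \<integral>\<^sup>+ e. ennreal (exp ((\<theta> * \<psi> t * f t - \<theta> * \<mu>) + (\<theta> * \<psi> t * \<sigma>) * e)) \<partial>?N \<partial>?M)"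
    by (subst nn_integral_obs_law) (auto simp: algebra_simps)
  also have "\<dots> = (\<integral>\<^sup>+ t. ennreal (exp (- (\<theta> * \<mu>))) * ennreal (exp (\<theta> * \<psi> t * f t + (\<theta> * \<psi> t * \<sigma>)\<^sup>2 / 2)) \<partial>?M)"
    unfolding nn_integral_std_normal_exp
    by (intro nn_integral_cong) (auto simp: ennreal_mult[symmetric] exp_add[symmetric] algebra_simps)
  also have "\<dots> \<le> (\<integral>\<^sup>+ t. ennreal (exp (- (\<theta> * \<mu>))) * ennreal (1 + \<theta> * \<psi> t * f t + V * (\<theta> * \<psi> t)\<^sup>2) \<partial>?M)"
  proof (rule nn_integral_mono_AE, use f(2) in eventually_elim)
    case (elim t)
    then show ?case
      unfolding V_def by (intro mult_left_mono ennreal_leI exp_le_quadratic_mgf \<psi>(3)) auto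
  qed
  also have "\<dots> = ennreal (exp (- (\<theta> * \<mu>))) * (\<integral>\<^sup>+ t. ennreal (1 + \<theta> * \<psi> t * f t + V * (\<theta> * \<psi> t)\<^sup>2) \<partial>?M)"
    by (intro nn_integral_cmult measurable_compose[OF _ measurable_ennreal] measurable_restrict_01) measurable
  also have "(\<integral>\<^sup>+ t. ennreal (1 + \<theta> * \<psi> t * f t + V * (\<theta> * \<psi> t)\<^sup>2) \<partial>?M) = ennreal (1 + \<theta> * \<mu> + V * \<theta>\<^sup>2)"
  proof -
    have i: "integrable ?M (\<lambda>t. f t * \<psi> t)" "integrable ?M (\<lambda>t. \<psi> t * \<psi> t)"
      by (intro L2_01_product_integrable f \<psi>)+
    have eq: "1 + \<theta> * \<psi> t * f t + V * (\<theta> * \<psi> t)\<^sup>2 = 1 + \<theta> * (f t * \<psi> t) + V * \<theta>\<^sup>2 * (\<psi> t * \<psi> t)" for t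
      by (simp add: power2_eq_square algebra_simps)
    have int: "integrable ?M (\<lambda>t. 1 + \<theta> * (f t * \<psi> t) + V * \<theta>\<^sup>2 * (\<psi> t * \<psi> t))"
      using i by (intro Bochner_Integration.integrable_add integrable_mult_right) auto
    \<comment> \<open>Conversion to a Lebesgue integral requires a nonnegative integrand; it is one
      because it dominates an exponential.\<close>
    have nonneg: "AE t in ?M. 0 \<le> 1 + \<theta> * (f t * \<psi> t) + V * \<theta>\<^sup>2 * (\<psi> t * \<psi> t)"
      using f(2)
    proof eventually_elim
      case (elim t)
      have "0 \<le> exp (\<theta> * \<psi> t * f t + (\<theta> * \<psi> t * \<sigma>)\<^sup>2 / 2)" by simp
      also have "\<dots> \<le> 1 + \<theta> * \<psi> t * f t + V * (\<theta> * \<psi> t)\<^sup>2"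
        using elim \<psi>(3) unfolding V_def by (intro exp_le_quadratic_mgf)
      finally show ?case unfolding eq .
    qed
    have "(\<integral>\<^sup>+ t. ennreal (1 + \<theta> * (f t * \<psi> t) + V * \<theta>\<^sup>2 * (\<psi> t * \<psi> t)) \<partial>?M)
        = ennreal (LINT t|?M. 1 + \<theta> * (f t * \<psi> t) + V * \<theta>\<^sup>2 * (\<psi> t * \<psi> t))"
      by (rule nn_integral_eq_integral[OF int nonneg])
    also have "(LINT t|?M. 1 + \<theta> * (f t * \<psi> t) + V * \<theta>\<^sup>2 * (\<psi> t * \<psi> t))
       = 1 + \<theta> * (LINT t|?M. f t * \<psi> t) + V * \<theta>\<^sup>2 * (LINT t|?M. \<psi> t * \<psi> t)"
      using i by (simp add: M.prob_space[simplified])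
    finally show ?thesis unfolding eq using \<psi>(2) by (simp add: \<mu>_def inner_01_def LINT_01_eq)
  qed
  also have "ennreal (exp (- (\<theta> * \<mu>))) * ennreal (1 + \<theta> * \<mu> + V * \<theta>\<^sup>2)
      \<le> ennreal (exp (- (\<theta> * \<mu>))) * ennreal (exp (\<theta> * \<mu> + V * \<theta>\<^sup>2))"
    by (intro mult_left_mono ennreal_leI) (use exp_ge_add_one_self[of "\<theta> * \<mu> + V * \<theta>\<^sup>2"] in \<open>auto simp: algebra_simps\<close>)
  also have "\<dots> = ennreal (exp (V * \<theta>\<^sup>2))"
    by (simp add: ennreal_mult[symmetric] exp_add[symmetric])
  finally show ?thesis unfolding \<mu>_def V_def .
qed

lemma obs_law_second_moment:
  assumes f: "f \<in> L2_01" "AE t in restrict_space lborel {0..1}. \<bar>f t\<bar> \<le> F"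
  shows "(\<integral>\<^sup>+ z. ennreal ((snd z)\<^sup>2) \<partial>obs_law \<sigma> f) \<le> ennreal (2 * F\<^sup>2 + 2 * \<sigma>\<^sup>2)"
proof -
  let ?N = "std_normal_distribution"
  let ?M = "restrict_space lborel {0..1::real}"
  interpret M: prob_space ?M by (rule prob_space_01)
  interpret N: prob_space ?N by (rule prob_space_std_normal)
  have [measurable]: "f \<in> borel_measurable borel" using f by (auto simp: L2_01_iff)
  have "(\<integral>\<^sup>+ z. ennreal ((snd z)\<^sup>2) \<partial>obs_law \<sigma> f) = (\<integral>\<^sup>+ t. \<integral>\<^sup>+ e. ennreal ((f t + \<sigma> * e)\<^sup>2) \<partial>?N \<partial>?M)"
    by (subst nn_integral_obs_law) auto
  also have "\<dots> \<le> (\<integral>\<^sup>+ t. ennreal (2 * F\<^sup>2 + 2 * \<sigma>\<^sup>2) \<partial>?M)"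
  proof (rule nn_integral_mono_AE, use f(2) in eventually_elim)
    case (elim t)
    have "(\<integral>\<^sup>+ e. ennreal ((f t + \<sigma> * e)\<^sup>2) \<partial>?N) \<le> (\<integral>\<^sup>+ e. ennreal (2 * F\<^sup>2) + ennreal (2 * \<sigma>\<^sup>2) * ennreal (e\<^sup>2) \<partial>?N)"
    proof (rule nn_integral_mono)
      fix e
      have "(f t + \<sigma> * e)\<^sup>2 \<le> 2 * (f t)\<^sup>2 + 2 * (\<sigma> * e)\<^sup>2"
        using sum_squares_bound[of "f t" "\<sigma> * e"] by (simp add: power2_sum)
      also have "(f t)\<^sup>2 \<le> F\<^sup>2" using elim by (metis abs_ge_zero power2_abs power_mono)
      finally show "ennreal ((f t + \<sigma> * e)\<^sup>2) \<le> ennreal (2 * F\<^sup>2) + ennreal (2 * \<sigma>\<^sup>2) * ennreal (e\<^sup>2)"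
        by (simp add: ennreal_mult[symmetric] ennreal_plus[symmetric] power_mult_distrib ennreal_leI del: ennreal_plus)
    qed
    also have "\<dots> = ennreal (2 * F\<^sup>2) + ennreal (2 * \<sigma>\<^sup>2)"
      by (simp add: nn_integral_add nn_integral_cmult nn_integral_std_normal_square N.emeasure_space_1[simplified])
    finally show ?case by simp
  qed
  also have "\<dots> = ennreal (2 * F\<^sup>2 + 2 * \<sigma>\<^sup>2)" using M.emeasure_space_1 by simp
  finally show ?thesis .
qed

text \<open>By the inequality 2 |x y| \<le> x^2 + y^2 and the unit norm of the wavelet the bound
  does not depend on the level. This is what keeps the unary part of the codes short on
  average.\<close>

lemma obs_law_first_moment:
  assumes f: "f \<in> L2_01" "AE t in restrict_space lborel {0..1}. \<bar>f t\<bar> \<le> F"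
    and \<psi>: "\<psi> \<in> L2_01" "inner_01 \<psi> \<psi> = 1"
  shows "(\<integral>\<^sup>+ z. ennreal \<bar>snd z * \<psi> (fst z)\<bar> \<partial>obs_law \<sigma> f) \<le> ennreal (F\<^sup>2 + \<sigma>\<^sup>2 + 1 / 2)"
proof -
  let ?M = "restrict_space lborel {0..1::real}"
  interpret N: prob_space "std_normal_distribution" by (rule prob_space_std_normal)
  have [measurable]: "f \<in> borel_measurable borel" "\<psi> \<in> borel_measurable borel"
    using f \<psi> by (auto simp: L2_01_iff)
  have m: "(\<lambda>z. ennreal (1 / 2) * ennreal ((snd z)\<^sup>2)) \<in> borel_measurable (obs_law \<sigma> f)"
    "(\<lambda>z. ennreal (1 / 2) * ennreal ((\<psi> (fst z))\<^sup>2)) \<in> borel_measurable (obs_law \<sigma> f)"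
    "(\<lambda>z. ennreal ((snd z)\<^sup>2)) \<in> borel_measurable (obs_law \<sigma> f)"
    "(\<lambda>z. ennreal ((\<psi> (fst z))\<^sup>2)) \<in> borel_measurable (obs_law \<sigma> f)" by measurable
  have "(\<integral>\<^sup>+ z. ennreal ((\<psi> (fst z))\<^sup>2) \<partial>obs_law \<sigma> f) = (\<integral>\<^sup>+ t. ennreal ((\<psi> t)\<^sup>2) \<partial>?M)"
    by (subst nn_integral_obs_law) (auto simp: N.emeasure_space_1[simplified])
  also have "\<dots> = ennreal (LINT t|?M. (\<psi> t)\<^sup>2)"
    using \<psi>(1) by (intro nn_integral_eq_integral) (auto simp: L2_01_iff)
  also have "\<dots> = 1" using \<psi>(2) by (simp add: inner_01_def LINT_01_eq power2_eq_square)
  finally have \<psi>1: "(\<integral>\<^sup>+ z. ennreal ((\<psi> (fst z))\<^sup>2) \<partial>obs_law \<sigma> f) = 1" .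
  have "(\<integral>\<^sup>+ z. ennreal \<bar>snd z * \<psi> (fst z)\<bar> \<partial>obs_law \<sigma> f)
      \<le> (\<integral>\<^sup>+ z. ennreal (1 / 2) * ennreal ((snd z)\<^sup>2) + ennreal (1 / 2) * ennreal ((\<psi> (fst z))\<^sup>2) \<partial>obs_law \<sigma> f)"
  proof (rule nn_integral_mono)
    fix z :: "real \<times> real"
    have "\<bar>snd z * \<psi> (fst z)\<bar> \<le> 1 / 2 * (snd z)\<^sup>2 + 1 / 2 * (\<psi> (fst z))\<^sup>2"
      using sum_squares_bound[of "\<bar>snd z\<bar>" "\<bar>\<psi> (fst z)\<bar>"] by (simp add: abs_mult)
    from ennreal_leI[OF this] show "ennreal \<bar>snd z * \<psi> (fst z)\<bar>
        \<le> ennreal (1 / 2) * ennreal ((snd z)\<^sup>2) + ennreal (1 / 2) * ennreal ((\<psi> (fst z))\<^sup>2)"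
      by (simp only: ennreal_plus ennreal_mult mult_nonneg_nonneg zero_le_power2 zero_le_divide_1_iff
          zero_le_numeral)
  qed
  also have "\<dots> = ennreal (1 / 2) * (\<integral>\<^sup>+ z. ennreal ((snd z)\<^sup>2) \<partial>obs_law \<sigma> f) + ennreal (1 / 2)"
    by (simp only: nn_integral_add[OF m(1,2)] nn_integral_cmult[OF m(3)] nn_integral_cmult[OF m(4)] \<psi>1 mult_1_right)
  also have "\<dots> \<le> ennreal (1 / 2) * ennreal (2 * F\<^sup>2 + 2 * \<sigma>\<^sup>2) + ennreal (1 / 2)"
    by (intro add_right_mono mult_left_mono obs_law_second_moment f) simp
  also have "\<dots> = ennreal (1 / 2 * (2 * F\<^sup>2 + 2 * \<sigma>\<^sup>2) + 1 / 2)"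
    by (simp only: ennreal_mult[symmetric] ennreal_plus[symmetric] zero_le_power2 mult_nonneg_nonneg
        add_nonneg_nonneg zero_le_numeral zero_le_divide_1_iff)
  also have "1 / 2 * (2 * F\<^sup>2 + 2 * \<sigma>\<^sup>2) + 1 / 2 = F\<^sup>2 + \<sigma>\<^sup>2 + 1 / 2" by (simp add: field_simps)
  finally show ?thesis .
qed

section \<open>Product laws: independence over observations and machines\<close>

lemma sets_machine_law [measurable_cong]: "sets (\<Pi>\<^sub>M l\<in>{1..q}. obs_law \<sigma> f) = sets (machine_space q)"
  unfolding machine_space_def by (intro sets_PiM_cong) auto

lemma sets_data_law [measurable_cong]:
  "sets (data_law \<sigma> m q f) = sets (\<Pi>\<^sub>M i\<in>{1..m}. machine_space q)"
  unfolding data_law_def by (intro sets_PiM_cong sets_machine_law) auto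

lemma prob_space_machine_law:
  "f \<in> borel_measurable borel \<Longrightarrow> prob_space (\<Pi>\<^sub>M l\<in>{1..q}. obs_law \<sigma> f)"
  by (intro prob_space_PiM prob_space_obs_law)

lemma prob_space_data_law: "f \<in> borel_measurable borel \<Longrightarrow> prob_space (data_law \<sigma> m q f)"
  unfolding data_law_def by (intro prob_space_PiM prob_space_obs_law)

lemma measurable_machine_coord:
  "l \<in> {1..q} \<Longrightarrow> (\<lambda>x. x l) \<in> machine_space q \<rightarrow>\<^sub>M borel \<Otimes>\<^sub>M borel"
  unfolding machine_space_def by (rule measurable_component_singleton)

lemma measurable_data_machine:
  "i \<in> {1..m} \<Longrightarrow> (\<lambda>d. d i) \<in> data_law \<sigma> m q f \<rightarrow>\<^sub>M machine_space q"
  by (subst measurable_cong_sets[OF sets_data_law refl]) (rule measurable_component_singleton)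

lemma measurable_data_coord:
  "i \<in> {1..m} \<Longrightarrow> l \<in> {1..q} \<Longrightarrow> (\<lambda>d. d i l) \<in> data_law \<sigma> m q f \<rightarrow>\<^sub>M borel \<Otimes>\<^sub>M borel"
  by (rule measurable_compose[OF measurable_data_machine measurable_machine_coord])

lemma nn_integral_PiM_component:
  assumes "\<And>i. i \<in> I \<Longrightarrow> prob_space (M i)" "i \<in> I" "g \<in> borel_measurable (M i)"
  shows "(\<integral>\<^sup>+ x. g (x i) \<partial>Pi\<^sub>M I M) = (\<integral>\<^sup>+ y. g y \<partial>M i)"
proof -
  have "(\<integral>\<^sup>+ y. g y \<partial>M i) = (\<integral>\<^sup>+ y. g y \<partial>distr (Pi\<^sub>M I M) (M i) (\<lambda>x. x i))"
    by (subst distr_PiM_component) (use assms in auto)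
  also have "\<dots> = (\<integral>\<^sup>+ x. g (x i) \<partial>Pi\<^sub>M I M)"
    using assms(2,3) by (intro nn_integral_distr) auto
  finally show ?thesis by simp
qed

lemma nn_integral_machine_law_coord:
  assumes "f \<in> borel_measurable borel" "l \<in> {1..q}" "g \<in> borel_measurable (borel \<Otimes>\<^sub>M borel)"
  shows "(\<integral>\<^sup>+ x. g (x l) \<partial>(\<Pi>\<^sub>M l\<in>{1..q}. obs_law \<sigma> f)) = (\<integral>\<^sup>+ z. g z \<partial>obs_law \<sigma> f)"
  using assms by (intro nn_integral_PiM_component prob_space_obs_law) auto

lemma nn_integral_data_law_machine:
  assumes "f \<in> borel_measurable borel" "i \<in> {1..m}" "g \<in> borel_measurable (machine_space q)"
  shows "(\<integral>\<^sup>+ d. g (d i) \<partial>data_law \<sigma> m q f) = (\<integral>\<^sup>+ x. g x \<partial>(\<Pi>\<^sub>M l\<in>{1..q}. obs_law \<sigma> f))"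
  unfolding data_law_def
proof (rule nn_integral_PiM_component)
  show "g \<in> borel_measurable (\<Pi>\<^sub>M l\<in>{1..q}. obs_law \<sigma> f)"
    using assms(3) by (simp only: measurable_cong_sets[OF sets_machine_law refl])
qed (rule prob_space_machine_law[OF assms(1)], rule assms(2))

lemma nn_integral_data_law_coord:
  assumes "f \<in> borel_measurable borel" "i \<in> {1..m}" "l \<in> {1..q}" "g \<in> borel_measurable (borel \<Otimes>\<^sub>M borel)"
  shows "(\<integral>\<^sup>+ d. g (d i l) \<partial>data_law \<sigma> m q f) = (\<integral>\<^sup>+ z. g z \<partial>obs_law \<sigma> f)"
proof -
  have "(\<integral>\<^sup>+ d. g (d i l) \<partial>data_law \<sigma> m q f) = (\<integral>\<^sup>+ x. g (x l) \<partial>(\<Pi>\<^sub>M l\<in>{1..q}. obs_law \<sigma> f))"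
    using assms measurable_compose[OF measurable_machine_coord[OF assms(3)] assms(4)]
    by (intro nn_integral_data_law_machine[where g = "\<lambda>x. g (x l)"]) auto
  then show ?thesis using nn_integral_machine_law_coord[OF assms(1,3,4)] by simp
qed

lemma nn_integral_data_law_prod:
  assumes f: "f \<in> borel_measurable borel" and I: "I \<subseteq> {1..m}" and g: "g \<in> borel_measurable (borel \<Otimes>\<^sub>M borel)"
  shows "(\<integral>\<^sup>+ d. (\<Prod>i\<in>I. \<Prod>l\<in>{1..q}. g (d i l)) \<partial>data_law \<sigma> m q f)
     = (\<integral>\<^sup>+ z. g z \<partial>obs_law \<sigma> f) ^ (card I * q)"
proof -
  let ?O = "obs_law \<sigma> f" and ?P = "\<Pi>\<^sub>M l\<in>{1..q}. obs_law \<sigma> f"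
  interpret O: prob_space ?O by (rule prob_space_obs_law[OF f])
  interpret P: prob_space ?P by (rule prob_space_machine_law[OF f])
  interpret OO: product_sigma_finite "\<lambda>_::nat. ?O" by standard
  interpret PP: product_sigma_finite "\<lambda>_::nat. ?P" by standard
  have gm[measurable]: "g \<in> borel_measurable ?O" using g by (simp add: measurable_cong_sets[OF sets_obs_law refl])
  \<comment> \<open>Machines outside \<open>I\<close> get the factor 1, so that the product extends
    over all coordinates of the product measure.\<close>
  define h where "h i x = (if i \<in> I then \<Prod>l\<in>{1..q}. g (x l) else 1)" for i :: nat and x :: "nat \<Rightarrow> real \<times> real"
  have hm: "h i \<in> borel_measurable ?P" for i unfolding h_def by measurable
  have "(\<Prod>i\<in>I. \<Prod>l\<in>{1..q}. g (d i l)) = (\<Prod>i\<in>{1..m}. h i (d i))" for d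
    using I by (simp add: h_def prod.If_cases Int_absorb1)
  then have "(\<integral>\<^sup>+ d. (\<Prod>i\<in>I. \<Prod>l\<in>{1..q}. g (d i l)) \<partial>data_law \<sigma> m q f)
     = (\<integral>\<^sup>+ d. (\<Prod>i\<in>{1..m}. h i (d i)) \<partial>(\<Pi>\<^sub>M i\<in>{1..m}. ?P))"
    unfolding data_law_def by simp
  also have "\<dots> = (\<Prod>i\<in>{1..m}. \<integral>\<^sup>+ x. h i x \<partial>?P)"
    by (rule PP.product_nn_integral_prod[OF finite_atLeastAtMost hm])
  also have "\<dots> = (\<Prod>i\<in>{1..m}. if i \<in> I then (\<integral>\<^sup>+ z. g z \<partial>?O) ^ q else 1)"
  proof (rule prod.cong[OF refl])
    fix i
    have "(\<integral>\<^sup>+ x. (\<Prod>l\<in>{1..q}. g (x l)) \<partial>?P) = (\<Prod>l\<in>{1..q}. \<integral>\<^sup>+ z. g z \<partial>?O)"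
      by (rule OO.product_nn_integral_prod[OF finite_atLeastAtMost gm])
    then show "(\<integral>\<^sup>+ x. h i x \<partial>?P) = (if i \<in> I then (\<integral>\<^sup>+ z. g z \<partial>?O) ^ q else 1)"
      using P.emeasure_space_1 by (simp add: h_def)
  qed
  also have "\<dots> = (\<integral>\<^sup>+ z. g z \<partial>?O) ^ (card I * q)"
    using I by (simp add: prod.If_cases Int_absorb1 power_mult[symmetric] mult.commute)
  finally show ?thesis .
qed

text \<open>The bound on \<open>x\<close> keeps the optimal Chernoff parameter \<open>x / (2 V)\<close> in the range where the
  quadratic bound on the cumulant generating function holds.\<close>

lemma data_law_average_tail:
  fixes \<psi> :: "real \<Rightarrow> real"
  assumes f: "f \<in> L2_01" "AE t in restrict_space lborel {0..1}. \<bar>f t\<bar> \<le> F"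
    and \<psi>: "\<psi> \<in> L2_01" "inner_01 \<psi> \<psi> = 1" "\<And>t. \<bar>\<psi> t\<bar> \<le> c"
    and x: "0 < x" "x * c \<le> 2 * mgf_const \<sigma> F" and I: "I \<subseteq> {1..m}"
  shows "emeasure (data_law \<sigma> m q f)
       {d \<in> space (data_law \<sigma> m q f). real (card I * q) * x
          \<le> \<bar>\<Sum>i\<in>I. \<Sum>l\<in>{1..q}. snd (d i l) * \<psi> (fst (d i l)) - inner_01 f \<psi>\<bar>}
     \<le> ennreal (2 * exp (- (real (card I * q) * x\<^sup>2 / (4 * mgf_const \<sigma> F))))"
proof -
  let ?D = "data_law \<sigma> m q f"
  define V where "V = mgf_const \<sigma> F"
  define N where "N = card I * q"
  define \<mu> where "\<mu> = inner_01 f \<psi>"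
  have V: "1 \<le> V" unfolding V_def mgf_const_def by simp
  have fm: "f \<in> borel_measurable borel" and [measurable]: "\<psi> \<in> borel_measurable borel"
    using f \<psi> by (auto simp: L2_01_iff)
  define Z where "Z d = (\<Sum>i\<in>I. \<Sum>l\<in>{1..q}. snd (d i l) * \<psi> (fst (d i l)) - \<mu>)"
    for d :: "nat \<Rightarrow> nat \<Rightarrow> real \<times> real"
  have Zm: "Z \<in> borel_measurable ?D"
  proof -
    have "(\<lambda>d. snd (d i l) * \<psi> (fst (d i l)) - \<mu>) \<in> borel_measurable ?D" if "i \<in> I" "l \<in> {1..q}" for i l
    proof -
      have "(\<lambda>z. snd z * \<psi> (fst z) - \<mu>) \<in> borel_measurable (borel \<Otimes>\<^sub>M borel)" by measurable
      from measurable_compose[OF measurable_data_coord this] show ?thesis using that I by blast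
    qed
    then show ?thesis unfolding Z_def by (intro borel_measurable_sum) auto
  qed
  have mgf: "(\<integral>\<^sup>+ d. ennreal (exp (\<theta> * Z d)) \<partial>?D) \<le> ennreal (exp (V * \<theta>\<^sup>2 * N))"
    if \<theta>: "\<bar>\<theta>\<bar> * c \<le> 1" for \<theta>
  proof -
    define g where "g z = ennreal (exp (\<theta> * (snd z * \<psi> (fst z) - \<mu>)))" for z :: "real \<times> real"
    have gm: "g \<in> borel_measurable (borel \<Otimes>\<^sub>M borel)" unfolding g_def by measurable
    have fin: "finite I" using I finite_subset by blast
    have "ennreal (exp (\<theta> * Z d)) = (\<Prod>i\<in>I. \<Prod>l\<in>{1..q}. g (d i l))" for d
      unfolding Z_def g_def sum_distrib_left
      by (simp add: exp_sum fin prod_ennreal prod_nonneg)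
    then have "(\<integral>\<^sup>+ d. ennreal (exp (\<theta> * Z d)) \<partial>?D) = (\<integral>\<^sup>+ z. g z \<partial>obs_law \<sigma> f) ^ N"
      by (simp only: nn_integral_data_law_prod[OF fm I gm] N_def)
    also have "(\<integral>\<^sup>+ z. g z \<partial>obs_law \<sigma> f) \<le> ennreal (exp (V * \<theta>\<^sup>2))"
      unfolding g_def V_def \<mu>_def
    proof (rule obs_law_mgf[OF f \<psi>(1,2)])
      fix t
      have "\<bar>\<theta>\<bar> * \<bar>\<psi> t\<bar> \<le> \<bar>\<theta>\<bar> * c" using \<psi>(3) by (intro mult_left_mono) auto
      then show "\<bar>\<theta> * \<psi> t\<bar> \<le> 1" using \<theta> by (simp add: abs_mult)
    qed
    finally show ?thesis
      by (simp add: power_mono ennreal_power exp_of_nat_mult[symmetric] mult.commute)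
  qed
  define \<theta> where "\<theta> = x / (2 * V)"
  have \<theta>0: "0 < \<theta>" using x V by (simp add: \<theta>_def)
  have \<theta>c: "\<bar>\<theta>\<bar> * c \<le> 1" using x V \<theta>0 by (simp add: \<theta>_def V_def divide_simps)
  have expo: "exp (- (\<theta> * (real N * x))) * exp (V * \<theta>\<^sup>2 * N) = exp (- (real N * x\<^sup>2 / (4 * V)))"
  proof -
    have "- (\<theta> * (real N * x)) + V * \<theta>\<^sup>2 * N = - (real N * x\<^sup>2 / (4 * V))"
      using V by (simp add: \<theta>_def field_simps power2_eq_square)
    then show ?thesis by (simp add: exp_add[symmetric])
  qed
  have one_sided: "emeasure ?D {d \<in> space ?D. real N * x \<le> W d} \<le> ennreal (exp (- (real N * x\<^sup>2 / (4 * V))))"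
    if W: "W \<in> borel_measurable ?D" "(\<integral>\<^sup>+ d. ennreal (exp (\<theta> * W d)) \<partial>?D) \<le> ennreal (exp (V * \<theta>\<^sup>2 * N))" for W
  proof -
    have "emeasure ?D {d \<in> space ?D. real N * x \<le> W d}
        \<le> ennreal (exp (- \<theta> * (real N * x))) * (\<integral>\<^sup>+ d. ennreal (exp (\<theta> * W d)) * indicator (space ?D) d \<partial>?D)"
      using W(1) by (intro Chernoff_ineq_nn_integral_ge \<theta>0) auto
    also have "(\<integral>\<^sup>+ d. ennreal (exp (\<theta> * W d)) * indicator (space ?D) d \<partial>?D) = (\<integral>\<^sup>+ d. ennreal (exp (\<theta> * W d)) \<partial>?D)"
      by (intro nn_integral_cong) auto
    also have "ennreal (exp (- \<theta> * (real N * x))) * \<dots> \<le> ennreal (exp (- \<theta> * (real N * x))) * ennreal (exp (V * \<theta>\<^sup>2 * N))"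
      by (intro mult_left_mono W(2)) auto
    also have "\<dots> = ennreal (exp (- (real N * x\<^sup>2 / (4 * V))))"
      unfolding expo[symmetric] by (simp add: ennreal_mult)
    finally show ?thesis .
  qed
  have "{d \<in> space ?D. real N * x \<le> \<bar>Z d\<bar>} = {d \<in> space ?D. real N * x \<le> Z d} \<union> {d \<in> space ?D. real N * x \<le> - Z d}"
    by (auto simp: abs_real_def split: if_splits)
  note eq = this
  have "emeasure ?D {d \<in> space ?D. real N * x \<le> \<bar>Z d\<bar>}
      \<le> emeasure ?D {d \<in> space ?D. real N * x \<le> Z d} + emeasure ?D {d \<in> space ?D. real N * x \<le> - Z d}"
    unfolding eq
  proof (rule emeasure_subadditive)
    show "{d \<in> space ?D. real N * x \<le> Z d} \<in> sets ?D"
      by (rule borel_measurable_le[OF borel_measurable_const Zm])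
    show "{d \<in> space ?D. real N * x \<le> - Z d} \<in> sets ?D"
      by (rule borel_measurable_le[OF borel_measurable_const borel_measurable_uminus[OF Zm]])
  qed
  also have "\<dots> \<le> ennreal (exp (- (real N * x\<^sup>2 / (4 * V)))) + ennreal (exp (- (real N * x\<^sup>2 / (4 * V))))"
  proof (intro add_mono one_sided)
    show "Z \<in> borel_measurable ?D" by (rule Zm)
    show "(\<lambda>d. - Z d) \<in> borel_measurable ?D" using Zm by simp
    show "(\<integral>\<^sup>+ d. ennreal (exp (\<theta> * Z d)) \<partial>?D) \<le> ennreal (exp (V * \<theta>\<^sup>2 * N))" by (rule mgf[OF \<theta>c])
    show "(\<integral>\<^sup>+ d. ennreal (exp (\<theta> * - Z d)) \<partial>?D) \<le> ennreal (exp (V * \<theta>\<^sup>2 * N))" using mgf[of "- \<theta>"] \<theta>c by simp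
  qed
  also have "\<dots> = ennreal (2 * exp (- (real N * x\<^sup>2 / (4 * V))))"
    by (simp add: ennreal_plus[symmetric] del: ennreal_plus)
  finally show ?thesis unfolding Z_def N_def V_def \<mu>_def .
qed

text \<open>Cauchy-Schwarz over all m q observations. Needed for the loss on the exceptional event,
  where the estimator is only bounded by the total of the observations.\<close>

lemma data_law_total_second_moment:
  assumes f: "f \<in> L2_01" "AE t in restrict_space lborel {0..1}. \<bar>f t\<bar> \<le> F"
  shows "(\<integral>\<^sup>+ d. ennreal ((\<Sum>i\<in>{1..m}. \<Sum>l\<in>{1..q}. \<bar>snd (d i l)\<bar>)\<^sup>2) \<partial>data_law \<sigma> m q f)
     \<le> ennreal ((real (m * q))\<^sup>2 * (2 * F\<^sup>2 + 2 * \<sigma>\<^sup>2))"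
proof -
  let ?D = "data_law \<sigma> m q f"
  define G where "G = 2 * F\<^sup>2 + 2 * \<sigma>\<^sup>2"
  have G0: "0 \<le> G" unfolding G_def by simp
  have fm: "f \<in> borel_measurable borel" using f by (auto simp: L2_01_iff)
  have sm: "(\<lambda>z. ennreal ((snd z)\<^sup>2)) \<in> borel_measurable (borel \<Otimes>\<^sub>M (borel :: real measure))" by measurable
  have "(\<Sum>i\<in>{1..m}. \<Sum>l\<in>{1..q}. \<bar>snd (d i l)\<bar>)\<^sup>2 \<le> real (m * q) * (\<Sum>i\<in>{1..m}. \<Sum>l\<in>{1..q}. (snd (d i l))\<^sup>2)"
    for d :: "nat \<Rightarrow> nat \<Rightarrow> real \<times> real"
  proof -
    have "(\<Sum>p\<in>{1..m} \<times> {1..q}. 1 * \<bar>snd (d (fst p) (snd p))\<bar>)\<^sup>2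
        \<le> (\<Sum>p\<in>{1..m} \<times> {1..q}. 1\<^sup>2) * (\<Sum>p\<in>{1..m} \<times> {1..q}. \<bar>snd (d (fst p) (snd p))\<bar>\<^sup>2)"
      by (rule Cauchy_Schwarz_ineq_sum)
    then show ?thesis by (simp add: sum.cartesian_product case_prod_beta)
  qed
  then have "(\<integral>\<^sup>+ d. ennreal ((\<Sum>i\<in>{1..m}. \<Sum>l\<in>{1..q}. \<bar>snd (d i l)\<bar>)\<^sup>2) \<partial>?D)
     \<le> (\<integral>\<^sup>+ d. ennreal (real (m * q)) * (\<Sum>i\<in>{1..m}. \<Sum>l\<in>{1..q}. ennreal ((snd (d i l))\<^sup>2)) \<partial>?D)"
    by (intro nn_integral_mono) (auto simp: sum_ennreal ennreal_mult[symmetric] sum_nonneg intro!: ennreal_leI)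
  also have "\<dots> = ennreal (real (m * q)) * (\<Sum>i\<in>{1..m}. \<Sum>l\<in>{1..q}. \<integral>\<^sup>+ d. ennreal ((snd (d i l))\<^sup>2) \<partial>?D)"
  proof -
    have me: "(\<lambda>d. ennreal ((snd (d i l))\<^sup>2)) \<in> borel_measurable ?D" if "i \<in> {1..m}" "l \<in> {1..q}" for i l
      by (rule measurable_compose[OF measurable_data_coord[OF that] sm])
    show ?thesis
      by (subst nn_integral_cmult, intro borel_measurable_sum me, assumption+)
         (subst nn_integral_sum, intro borel_measurable_sum me, assumption+,
          intro arg_cong2[where f = times] refl sum.cong nn_integral_sum me)
  qed
  also have "\<dots> \<le> ennreal (real (m * q)) * (\<Sum>i\<in>{1..m}. \<Sum>l\<in>{1..q}. ennreal G)"
    using obs_law_second_moment[OF f, of \<sigma>, folded G_def]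
    by (intro mult_left_mono sum_mono) (auto simp: nn_integral_data_law_coord[OF fm _ _ sm])
  also have "\<dots> = ennreal ((real (m * q))\<^sup>2 * G)"
    using G0 by (simp add: ennreal_of_nat_eq_real_of_nat ennreal_mult[symmetric] power2_eq_square mult_ac)
  finally show ?thesis unfolding G_def .
qed

section \<open>Encoding and allocation of the coefficients\<close>

text \<open>The number of transmitted digits after the binary point: the lowest admissible exponent
  \<open>\<lceil>- (log 2 n / 2)\<rceil>\<close> equals \<open>- digits n\<close>.\<close>

definition digits :: "nat \<Rightarrow> nat" where
  "digits n = nat \<lfloor>log 2 (real n) / 2\<rfloor>"

lemma sum_telescope_int:
  fixes F :: "int \<Rightarrow> real"
  assumes "a \<le> b + 1"
  shows "(\<Sum>k = a..b. F k - F (k + 1)) = F a - F (b + 1)"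
proof -
  have "a - 1 \<le> b" using assms by simp
  then show ?thesis
  proof (induction b rule: int_ge_induct)
    case (step i)
    have "{a..i + 1} = insert (i + 1) {a..i}" using step.hyps by auto
    then show ?case using step.IH by simp
  qed simp
qed

text \<open>Truncation to multiples of \<open>2 powi k\<close> is \<open>F k\<close>, and one binary
  digit is the difference \<open>F k - F (k + 1)\<close>. The digit sum telescopes, so the
  transmitted number is x rounded towards zero on a fixed grid.\<close>

lemma trans_approx_eq:
  assumes "1 \<le> n"
  shows "trans_approx n x = sgn x * (of_int \<lfloor>\<bar>x\<bar> * 2 ^ digits n\<rfloor> / 2 ^ digits n)"
proof (cases "x = 0")
  case False
  define K where "K = int (digits n)"
  define y where "y = \<bar>x\<bar>"
  define M where "M = \<lfloor>log 2 y\<rfloor>"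
  define F where "F k = of_int \<lfloor>y / 2 powi k\<rfloor> * (2::real) powi k" for k :: int
  have y: "0 < y" using False by (simp add: y_def)
  have K: "\<lceil>- (log 2 (real n) / 2)\<rceil> = - K"
    using assms unfolding K_def digits_def by (simp add: ceiling_def)
  have dig: "of_int (\<lfloor>y / 2 powi k\<rfloor> mod 2) * 2 powi k = F k - F (k + 1)" for k
  proof -
    have "\<lfloor>y / 2 powi (k + 1)\<rfloor> = \<lfloor>(y / 2 powi k) / of_int 2\<rfloor>"
      by (simp add: power_int_add mult.commute)
    also have "\<dots> = \<lfloor>y / 2 powi k\<rfloor> div 2"
      by (rule floor_divide_real_eq_div) simp
    finally have e: "\<lfloor>y / 2 powi (k + 1)\<rfloor> = \<lfloor>y / 2 powi k\<rfloor> div 2" .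
    have "(of_int (\<lfloor>y / 2 powi k\<rfloor> mod 2) :: real) = of_int \<lfloor>y / 2 powi k\<rfloor> - 2 * of_int (\<lfloor>y / 2 powi k\<rfloor> div 2)"
      by (simp flip: of_int_mult of_int_diff add: minus_mult_div_eq_mod[symmetric] del: of_int_mult of_int_diff)
    note m = this
    show ?thesis unfolding F_def e m by (simp add: power_int_add algebra_simps)
  qed
  \<comment> \<open>Above the leading digit nothing is left. This removes the upper end of the
    telescope, and it also covers numbers so small that the range of digits is empty.\<close>
  have vanish: "F k = 0" if "M < k" for k
  proof -
    have "log 2 y < of_int k" using that unfolding M_def by linarith
    then have "y < 2 powr of_int k" using y by (simp add: log_less_iff)
    then have "y < 2 powi k" by (simp add: powr_real_of_int')
    then have "\<lfloor>y / 2 powi k\<rfloor> = 0" using y by (simp add: floor_eq_iff divide_simps)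
    then show ?thesis by (simp add: F_def)
  qed
  have "(\<Sum>k = - K..M. of_int (\<lfloor>y / 2 powi k\<rfloor> mod 2) * 2 powi k) = F (- K)"
  proof (cases "- K \<le> M + 1")
    case True
    then show ?thesis unfolding dig by (simp add: sum_telescope_int vanish)
  next
    case False
    then show ?thesis by (simp add: vanish)
  qed
  also have "F (- K) = of_int \<lfloor>y * 2 ^ digits n\<rfloor> / 2 ^ digits n"
    by (simp add: F_def K_def power_int_minus divide_inverse)
  finally show ?thesis unfolding trans_approx_def K y_def[symmetric] M_def[symmetric] by simp
qed (simp add: trans_approx_def)

lemma abs_trans_approx_le:
  assumes "1 \<le> n"
  shows "\<bar>trans_approx n x\<bar> \<le> \<bar>x\<bar>"
proof -
  have "of_int \<lfloor>\<bar>x\<bar> * 2 ^ digits n\<rfloor> / (2::real) ^ digits n \<le> \<bar>x\<bar>"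
    by (simp add: divide_le_eq)
  then have "\<bar>sgn x\<bar> * \<bar>of_int \<lfloor>\<bar>x\<bar> * 2 ^ digits n\<rfloor> / (2::real) ^ digits n\<bar> \<le> 1 * \<bar>x\<bar>"
    by (intro mult_mono) (auto simp: abs_sgn_eq)
  then show ?thesis by (simp only: trans_approx_eq[OF assms] abs_mult mult_1)
qed

text \<open>The error is at most the grid width. Rounding \<open>log 2 n / 2\<close> down to an
  integer costs the factor 2 over \<open>1 / sqrt n\<close>.\<close>

lemma trans_approx_error:
  assumes "1 \<le> n"
  shows "\<bar>trans_approx n x - x\<bar> \<le> 2 / sqrt (real n)"
proof -
  define P where "P = (2::real) ^ digits n"
  have P: "0 < P" by (simp add: P_def)
  define r where "r = \<bar>x\<bar> * P - of_int \<lfloor>\<bar>x\<bar> * P\<rfloor>"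
  have r: "0 \<le> r" "r \<le> 1" unfolding r_def by linarith+
  have "trans_approx n x - x = sgn x * ((\<bar>x\<bar> * P - r) / P) - sgn x * \<bar>x\<bar>"
    unfolding trans_approx_eq[OF assms] r_def P_def[symmetric] by (simp add: sgn_mult_abs)
  also have "\<dots> = - (sgn x * (r / P))" using P by (simp add: field_simps)
  finally have "\<bar>trans_approx n x - x\<bar> = \<bar>sgn x\<bar> * (r / P)" using r P by (simp add: abs_mult)
  also have "\<dots> \<le> 1 * (1 / P)"
    using r P by (intro mult_mono divide_right_mono) (auto simp: abs_sgn_eq)
  also have "1 / P \<le> 2 / sqrt (real n)"
  proof -
    have "log 2 (real n) / 2 \<le> real (digits n) + 1" unfolding digits_def by linarith
    then have "log 2 (real n) \<le> 2 * real (digits n) + 2" by simp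
    then have "real n \<le> 2 powr (2 * real (digits n) + 2)"
      using assms by (simp add: log_le_iff)
    also have "\<dots> = (2 * P)\<^sup>2"
      by (simp add: P_def powr_add powr_realpow[symmetric] powr_powr power_mult_distrib mult_ac power2_eq_square)
         (simp add: powr_add[symmetric] mult.commute)
    finally have "sqrt (real n) \<le> 2 * P" using P by (simp add: real_le_lsqrt)
    then show ?thesis using P assms by (simp add: field_simps)
  qed
  finally show ?thesis by simp
qed

text \<open>A prefix-free code for \<open>trans_approx\<close>: sign, integer part in unary, and fractional digits.  The
  unary part costs only \<open>O(1)\<close> bits on average because local coefficients have bounded mean.\<close>

definition approx_code :: "nat \<Rightarrow> real \<Rightarrow> bool list" where
  "approx_code K x = (x < 0) # replicate (nat \<lfloor>\<bar>x\<bar> * 2 ^ K\<rfloor> div 2 ^ K) True @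
     False # map (bit (nat \<lfloor>\<bar>x\<bar> * 2 ^ K\<rfloor>)) [0..<K]"

lemma length_approx_code: "real (length (approx_code K x)) \<le> 2 + real K + \<bar>x\<bar>"
proof -
  define N where "N = nat \<lfloor>\<bar>x\<bar> * 2 ^ K\<rfloor>"
  have "real (N div 2 ^ K * 2 ^ K) \<le> real N" by (simp only: of_nat_le_iff div_times_less_eq_dividend)
  also have "\<dots> \<le> \<bar>x\<bar> * 2 ^ K" by (simp add: N_def)
  finally have "real (N div 2 ^ K) \<le> \<bar>x\<bar>" by simp
  then show ?thesis by (simp add: approx_code_def N_def)
qed

lemma replicate_False_prefix:
  "replicate a True @ False # u = replicate b True @ False # v \<Longrightarrow> a = b \<and> u = v"
proof (induction a arbitrary: b)
  case 0 then show ?case by (cases b) auto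
next
  case (Suc a) then show ?case by (cases b) auto
qed

text \<open>The unary block ends at its first \<open>False\<close>, and exactly
  \<open>digits n\<close> bits follow it, so the end of a code word is recognisable. The integer
  part and the low bits then determine the rounded number, though not x itself.\<close>

lemma approx_code_prefix_free:
  assumes n: "1 \<le> n" and eq: "approx_code (digits n) x @ u = approx_code (digits n) y @ v"
  shows "trans_approx n x = trans_approx n y" "u = v"
proof -
  define K where "K = digits n"
  define a b where "a = nat \<lfloor>\<bar>x\<bar> * 2 ^ K\<rfloor>" and "b = nat \<lfloor>\<bar>y\<bar> * 2 ^ K\<rfloor>"
  have s: "(x < 0) = (y < 0)" and
    "replicate (a div 2 ^ K) True @ False # (map (bit a) [0..<K] @ u)
     = replicate (b div 2 ^ K) True @ False # (map (bit b) [0..<K] @ v)"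
    using eq unfolding approx_code_def a_def b_def K_def by auto
  from replicate_False_prefix[OF this(2)]
  have hi: "a div 2 ^ K = b div 2 ^ K" and lo: "map (bit a) [0..<K] @ u = map (bit b) [0..<K] @ v" by auto
  from lo have bits: "map (bit a) [0..<K] = map (bit b) [0..<K]" and "u = v" by auto
  then show "u = v" by simp
  from arg_cong[OF bits, of "horner_sum of_bool (2::nat)"]
  have "a mod 2 ^ K = b mod 2 ^ K" by (simp only: horner_sum_bit_eq_take_bit take_bit_eq_mod)
  then have "a = b" using hi by (metis div_mult_mod_eq)
  then have ab: "\<lfloor>\<bar>x\<bar> * 2 ^ K\<rfloor> = \<lfloor>\<bar>y\<bar> * 2 ^ K\<rfloor>" unfolding a_def b_def
    by (simp add: eq_nat_nat_iff)
  \<comment> \<open>The sign bit does not distinguish zero from positive numbers; this is harmless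
    because zero is truncated to zero.\<close>
  have z: "trans_approx n w = (if w < 0 then -1 else 1) * (of_int \<lfloor>\<bar>w\<bar> * 2 ^ K\<rfloor> / 2 ^ K)" for w
    unfolding trans_approx_eq[OF n] K_def by (auto simp: sgn_real_def)
  show "trans_approx n x = trans_approx n y" unfolding z ab s ..
qed

lemma approx_code_measurable: "approx_code K \<in> borel \<rightarrow>\<^sub>M count_space UNIV"
proof -
  have "(\<lambda>x::real. (\<lambda>p::bool \<times> int. fst p # replicate (nat (snd p) div 2 ^ K) True @
      False # map (bit (nat (snd p))) [0..<K]) (x < 0, \<lfloor>\<bar>x\<bar> * 2 ^ K\<rfloor>)) \<in> borel \<rightarrow>\<^sub>M count_space UNIV"
    by (rule measurable_compose[where N = "count_space UNIV"]) measurable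
  then show ?thesis by (simp add: approx_code_def[abs_def])
qed

text \<open>Both lists encode the same coefficients in the same order, so prefix-freeness allows
  peeling off one code word at a time.\<close>

lemma concat_codes_eq:
  assumes n: "1 \<le> n"
    and "concat (map (\<lambda>p. approx_code (digits n) (F p)) xs) = concat (map (\<lambda>p. approx_code (digits n) (G p)) xs)"
    and "p \<in> set xs"
  shows "trans_approx n (F p) = trans_approx n (G p)"
  using assms(2,3)
proof (induction xs)
  case (Cons a xs)
  have "approx_code (digits n) (F a) @ concat (map (\<lambda>p. approx_code (digits n) (F p)) xs)
      = approx_code (digits n) (G a) @ concat (map (\<lambda>p. approx_code (digits n) (G p)) xs)"
    using Cons.prems by simp
  from approx_code_prefix_free[OF n this] Cons show ?case by auto
qed simp

lemma concat_measurable: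
  assumes "\<And>p. p \<in> set xs \<Longrightarrow> (\<lambda>x. c p x) \<in> M \<rightarrow>\<^sub>M count_space (UNIV :: bool list set)"
  shows "(\<lambda>x. concat (map (\<lambda>p. c p x) xs)) \<in> M \<rightarrow>\<^sub>M count_space UNIV"
  using assms
proof (induction xs)
  case (Cons a xs)
  have ca: "c a \<in> M \<rightarrow>\<^sub>M count_space UNIV" using Cons.prems[of a] by simp
  have "(\<lambda>x. u @ concat (map (\<lambda>p. c p x) xs)) \<in> M \<rightarrow>\<^sub>M count_space UNIV" for u
    by (rule measurable_compose[OF Cons.IH]) (use Cons.prems in auto)
  from measurable_compose_countable[OF this ca] show ?case by simp
qed simp

section \<open>Allocation of coefficients to machines\<close>

lemma subgroup_size_bound: "subgroup_size S n m b t * 2 ^ t \<le> group_size S n m b"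
  unfolding subgroup_size_def by simp

lemma group_size_bound: "group_size S n m b * n_groups S n b \<le> (m + 1) div 2"
  unfolding group_size_def by simp

lemma level_offset_less:
  fixes k :: nat
  assumes "k < 2 ^ j" "j_B n b \<le> j"
  shows "k div 2 ^ j_B n b < 2 ^ (j - j_B n b)"
  using assms by (intro less_mult_imp_div_less) (simp flip: power_add)

text \<open>The subgroups of a group fit into it, and the groups fit into the second half of the
  machines; the leftovers of the two divisions are what makes these inequalities rather than
  equalities.\<close>

lemma senders_subset:
  assumes "j < j_max S n b" "k < 2 ^ j"
  shows "senders S n m b j k \<subseteq> {1..m}"
proof (cases "j < j_B n b")
  case True
  then show ?thesis by (auto simp: senders_def first_half_def)
next
  case False
  define t where "t = j - j_B n b"
  define c where "c = k div 2 ^ j_B n b"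
  define gs where "gs = group_size S n m b"
  define ss where "ss = subgroup_size S n m b t"
  have t: "t + 1 \<le> n_groups S n b" using assms False by (simp add: t_def n_groups_def)
  have "c + 1 \<le> 2 ^ t" using level_offset_less[of k j n b] assms False by (simp add: t_def c_def)
  then have "(c + 1) * ss \<le> 2 ^ t * ss" by (rule mult_le_mono1)
  also have "\<dots> \<le> gs" using subgroup_size_bound[of S n m b t] by (simp add: ss_def gs_def mult.commute)
  finally have 1: "c * ss + ss \<le> gs" by simp
  have "(t + 1) * gs \<le> n_groups S n b * gs" using t by (rule mult_le_mono1)
  also have "\<dots> \<le> (m + 1) div 2" using group_size_bound[of S n m b] by (simp add: gs_def mult.commute)
  finally have 2: "t * gs + gs \<le> (m + 1) div 2" by simp
  have "m div 2 + (m + 1) div 2 = m" by linarith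
  then have "m div 2 + t * gs + c * ss + ss \<le> m" using 1 2 by linarith
  then show ?thesis using False
    by (auto simp: senders_def machine_subgroup_def Let_def t_def[symmetric] c_def[symmetric] gs_def[symmetric] ss_def[symmetric])
qed

lemma card_senders:
  "card (senders S n m b j k) = (if j < j_B n b then m div 2 else subgroup_size S n m b (j - j_B n b))"
  by (simp add: senders_def first_half_def machine_subgroup_def Let_def)

lemma n_eff_eq_card: "n_eff S n m b j = real (card (senders S n m b j k)) * real n / real m"
  by (simp add: n_eff_def card_senders first_half_def)

definition tasks :: "ereal \<Rightarrow> nat \<Rightarrow> nat \<Rightarrow> real \<Rightarrow> nat \<Rightarrow> (nat \<times> nat) set" where
  "tasks S n m b i = {(j, k). j < j_max S n b \<and> k < 2 ^ j \<and> i \<in> senders S n m b j k}"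

lemma finite_tasks: "finite (tasks S n m b i)"
proof (rule finite_subset)
  show "tasks S n m b i \<subseteq> (SIGMA j:{..<j_max S n b}. {..<2 ^ j})" by (auto simp: tasks_def)
qed auto

lemma sum_powers_two: "(\<Sum>j<J. 2 ^ j :: nat) = 2 ^ J - 1"
  by (induction J) auto

text \<open>A machine of the first half sends all levels below \<open>j_B\<close>, which makes
  \<open>2 ^ j_B - 1\<close> coefficients. Any other machine belongs to at most one subgroup and
  sends at most one block of length \<open>2 ^ j_B\<close> of a single level.\<close>

lemma card_tasks: "card (tasks S n m b i) \<le> 2 ^ j_B n b"
proof (cases "i \<le> m div 2")
  case True
  have "tasks S n m b i \<subseteq> (SIGMA j:{..<j_B n b}. {..<2 ^ j})"
    using True by (auto simp: tasks_def senders_def machine_subgroup_def Let_def split: if_splits)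
  then have "card (tasks S n m b i) \<le> card (SIGMA j:{..<j_B n b}. {..<2 ^ j::nat})"
    by (intro card_mono) auto
  also have "\<dots> = 2 ^ j_B n b - 1" by (simp add: sum_powers_two)
  finally show ?thesis by simp
next
  case False
  define gs where "gs = group_size S n m b"
  \<comment> \<open>The position of machine i in the second half, counted from 0; division with
    remainder by the group size and then by the subgroup size recovers its group and subgroup. If a
    size is 0 the quotients are meaningless, but then the subgroup is empty and there is no task to
    locate.\<close>
  define r where "r = i - 1 - m div 2"
  define t where "t = r div gs"
  define ss where "ss = subgroup_size S n m b t"
  define c where "c = (r mod gs) div ss"
  have "tasks S n m b i \<subseteq> Pair (j_B n b + t) ` {c * 2 ^ j_B n b..<(c + 1) * 2 ^ j_B n b}"
  proof (rule subsetI)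
    fix p assume "p \<in> tasks S n m b i"
    then obtain j k where p: "p = (j, k)" "j < j_max S n b" "k < 2 ^ j" "i \<in> senders S n m b j k"
      by (auto simp: tasks_def)
    have j: "j_B n b \<le> j" using p(4) False by (auto simp: senders_def first_half_def split: if_splits)
    define t' where "t' = j - j_B n b"
    define c' where "c' = k div 2 ^ j_B n b"
    define ss' where "ss' = subgroup_size S n m b t'"
    have i: "m div 2 + t' * gs + c' * ss' + 1 \<le> i" "i \<le> m div 2 + t' * gs + c' * ss' + ss'"
      using p(4) j by (auto simp: senders_def machine_subgroup_def Let_def t'_def c'_def gs_def ss'_def)
    obtain u where u: "i = m div 2 + t' * gs + c' * ss' + 1 + u"
      using i(1) le_Suc_ex by blast
    have r: "r = t' * gs + (c' * ss' + u)" "u < ss'"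
      using i(2) unfolding r_def u by simp_all
    have "c' + 1 \<le> 2 ^ t'" using level_offset_less[OF p(3) j] by (simp add: t'_def c'_def)
    then have "(c' + 1) * ss' \<le> 2 ^ t' * ss'" by (rule mult_le_mono1)
    also have "\<dots> \<le> gs" using subgroup_size_bound[of S n m b t'] by (simp add: ss'_def gs_def mult.commute)
    finally have lt: "c' * ss' + u < gs" using r(2) by simp
    have tt: "t = t'" unfolding t_def r(1) using lt by simp
    have "r mod gs = c' * ss' + u" unfolding r(1) using lt by simp
    then have cc: "c = c'" using r(2) unfolding c_def ss_def tt ss'_def[symmetric] by simp
    have "k \<in> {c * 2 ^ j_B n b..<(c + 1) * 2 ^ j_B n b}"
      unfolding cc c'_def using div_times_less_eq_dividend[of k "2 ^ j_B n b"] dividend_less_div_times[of "2 ^ j_B n b" k]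
      by (simp add: algebra_simps)
    moreover have "j = j_B n b + t" using j by (simp add: tt t'_def)
    ultimately show "p \<in> Pair (j_B n b + t) ` {c * 2 ^ j_B n b..<(c + 1) * 2 ^ j_B n b}"
      unfolding p(1) by blast
  qed
  then have "card (tasks S n m b i) \<le> card (Pair (j_B n b + t) ` {c * 2 ^ j_B n b..<(c + 1) * 2 ^ j_B n b})"
    by (intro card_mono) auto
  also have "\<dots> \<le> card {c * 2 ^ j_B n b..<(c + 1) * 2 ^ j_B n b}" by (intro card_image_le) auto
  also have "\<dots> = 2 ^ j_B n b" by simp
  finally show ?thesis .
qed

lemma log_ge_one_pos: "1 \<le> log 2 (real n) \<Longrightarrow> 0 < n"
  by (cases n) (auto simp: log_def)

text \<open>Two integer parts are nested in the definition of \<open>j_B\<close>, and each loses at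
  most a factor 2; hence the 4.\<close>

lemma j_B_bounds:
  assumes "1 \<le> log 2 (real n)" "log 2 (real n) \<le> b"
  shows "2 ^ j_B n b \<le> b / log 2 (real n)" "b / log 2 (real n) \<le> 4 * 2 ^ j_B n b"
proof -
  define y where "y = b / log 2 (real n)"
  define q where "q = \<lfloor>y\<rfloor>"
  have y: "1 \<le> y" using assms by (simp add: y_def)
  then have q: "1 \<le> q" by (simp add: q_def)
  then have l0: "0 \<le> log 2 (of_int q)" by simp
  have J: "real (j_B n b) \<le> log 2 (of_int q)" "log 2 (of_int q) < real (j_B n b) + 1"
    using l0 unfolding j_B_def y_def[symmetric] q_def[symmetric] by linarith+
  have pw: "(2::real) powr (real (j_B n b)) = 2 ^ j_B n b" by (simp add: powr_realpow)
  have "2 ^ j_B n b \<le> real_of_int q"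
    using J(1) q by (simp add: pw[symmetric] le_log_iff)
  also have "\<dots> \<le> y" unfolding q_def by simp
  finally show "2 ^ j_B n b \<le> b / log 2 (real n)" by (simp add: y_def)
  have "of_int q < (2::real) powr (real (j_B n b) + 1)"
    using J(2) q by (simp add: log_less_iff)
  then have "of_int q < 2 * (2::real) ^ j_B n b" by (simp add: powr_add pw)
  moreover have "y \<le> 2 * of_int q" using q unfolding q_def by linarith
  ultimately show "b / log 2 (real n) \<le> 4 * 2 ^ j_B n b" by (simp add: y_def)
qed

section \<open>The estimator as a function of short messages\<close>

lemma local_coef_measurable:
  assumes "\<psi> j k \<in> borel_measurable borel"
  shows "(\<lambda>x. local_coef \<psi> n m x j k) \<in> borel_measurable (machine_space (n div m))"
proof -
  have "(\<lambda>z. snd z * \<psi> j k (fst z)) \<in> borel_measurable (borel \<Otimes>\<^sub>M borel)" using assms by measurable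
  from measurable_compose[OF measurable_machine_coord this]
  show ?thesis unfolding local_coef_def
    by (intro borel_measurable_times[OF borel_measurable_const] borel_measurable_sum)
qed

lemma local_coef_first_moment:
  assumes f: "f \<in> L2_01" "AE t in restrict_space lborel {0..1}. \<bar>f t\<bar> \<le> F"
    and \<psi>: "\<psi> j k \<in> L2_01" "inner_01 (\<psi> j k) (\<psi> j k) = 1"
    and nm: "0 < n" "m dvd n"
  shows "(\<integral>\<^sup>+ x. ennreal \<bar>local_coef \<psi> n m x j k\<bar> \<partial>(\<Pi>\<^sub>M l\<in>{1..n div m}. obs_law \<sigma> f)) \<le> ennreal (F\<^sup>2 + \<sigma>\<^sup>2 + 1 / 2)"
proof -
  let ?P = "\<Pi>\<^sub>M l\<in>{1..n div m}. obs_law \<sigma> f"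
  have [measurable]: "\<psi> j k \<in> borel_measurable borel" and fm: "f \<in> borel_measurable borel"
    using \<psi> f by (auto simp: L2_01_iff)
  have gm: "(\<lambda>z. ennreal \<bar>snd z * \<psi> j k (fst z)\<bar>) \<in> borel_measurable (borel \<Otimes>\<^sub>M borel)" by measurable
  have cm: "(\<lambda>x. ennreal \<bar>snd (x l) * \<psi> j k (fst (x l))\<bar>) \<in> borel_measurable ?P" if "l \<in> {1..n div m}" for l
    using measurable_compose[OF measurable_machine_coord[OF that] gm]
    by (simp only: measurable_cong_sets[OF sets_machine_law refl])
  have "m \<noteq> 0" using nm by auto
  have "(\<integral>\<^sup>+ x. ennreal \<bar>local_coef \<psi> n m x j k\<bar> \<partial>?P)
      \<le> (\<integral>\<^sup>+ x. ennreal (real m / real n) * (\<Sum>l = 1..n div m. ennreal \<bar>snd (x l) * \<psi> j k (fst (x l))\<bar>) \<partial>?P)"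
  proof (rule nn_integral_mono)
    fix x :: "nat \<Rightarrow> real \<times> real"
    have "\<bar>local_coef \<psi> n m x j k\<bar> \<le> real m / real n * (\<Sum>l = 1..n div m. \<bar>snd (x l) * \<psi> j k (fst (x l))\<bar>)"
      unfolding local_coef_def by (subst abs_mult) (rule mult_mono[OF _ sum_abs]; simp)
    then show "ennreal \<bar>local_coef \<psi> n m x j k\<bar>
      \<le> ennreal (real m / real n) * (\<Sum>l = 1..n div m. ennreal \<bar>snd (x l) * \<psi> j k (fst (x l))\<bar>)"
      by (simp add: sum_ennreal ennreal_mult[symmetric] sum_nonneg ennreal_leI)
  qed
  also have "\<dots> = ennreal (real m / real n) *
      (\<Sum>l = 1..n div m. \<integral>\<^sup>+ x. ennreal \<bar>snd (x l) * \<psi> j k (fst (x l))\<bar> \<partial>?P)"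
  proof -
    have "(\<lambda>x. \<Sum>l = 1..n div m. ennreal \<bar>snd (x l) * \<psi> j k (fst (x l))\<bar>) \<in> borel_measurable ?P"
      by (intro borel_measurable_sum cm)
    then show ?thesis by (simp only: nn_integral_cmult nn_integral_sum[OF cm])
  qed
  also have "\<dots> \<le> ennreal (real m / real n) * (\<Sum>l = 1..n div m. ennreal (F\<^sup>2 + \<sigma>\<^sup>2 + 1 / 2))"
  proof (intro mult_left_mono sum_mono)
    fix l assume l: "l \<in> {1..n div m}"
    show "(\<integral>\<^sup>+ x. ennreal \<bar>snd (x l) * \<psi> j k (fst (x l))\<bar> \<partial>?P) \<le> ennreal (F\<^sup>2 + \<sigma>\<^sup>2 + 1 / 2)"
      using obs_law_first_moment[OF f \<psi>]
      by (simp only: nn_integral_machine_law_coord[OF fm l gm])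
  qed simp
  also have "\<dots> = ennreal (real m / real n * real (n div m)) * ennreal (F\<^sup>2 + \<sigma>\<^sup>2 + 1 / 2)"
    by (subst ennreal_mult) (simp_all add: ennreal_of_nat_eq_real_of_nat mult.assoc)
  also have "real m / real n * real (n div m) = 1"
    using nm \<open>m \<noteq> 0\<close> by (simp add: real_of_nat_div)
  finally show ?thesis by simp
qed

lemma f_tilde_cong:
  assumes "\<And>l k. l < j \<Longrightarrow> k < 2 ^ l \<Longrightarrow> agg_coef \<psi> S n m b d l k = agg_coef \<psi> S n m b d' l k"
  shows "f_tilde \<psi> S n m b d j = f_tilde \<psi> S n m b d' j"
  unfolding f_tilde_def[abs_def] using assms by (intro ext sum.cong refl) auto

lemma j_hat_cong:
  assumes "\<And>j. j \<le> j_max S n b \<Longrightarrow> f_tilde \<psi> S n m b d j = f_tilde \<psi> S n m b d' j"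
  shows "j_hat \<psi> S n m b \<tau> d = j_hat \<psi> S n m b \<tau> d'"
proof -
  have "{j \<in> {0..j_max S n b}. \<forall>l \<in> {0..j_max S n b}. j < l \<longrightarrow>
            sup_norm_01 (\<lambda>x. f_tilde \<psi> S n m b d j x - f_tilde \<psi> S n m b d l x)
              \<le> threshold S n m b \<tau> l}
      = {j \<in> {0..j_max S n b}. \<forall>l \<in> {0..j_max S n b}. j < l \<longrightarrow>
            sup_norm_01 (\<lambda>x. f_tilde \<psi> S n m b d' j x - f_tilde \<psi> S n m b d' l x)
              \<le> threshold S n m b \<tau> l}"
    using assms by auto
  then show ?thesis unfolding j_hat_def by simp
qed

text \<open>The minimum is over a nonempty set: level \<open>j_max\<close> has no higher level to be
  compared with.\<close>

lemma j_hat_in_set: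
  "j_hat \<psi> S n m b \<tau> d \<in> {j \<in> {0..j_max S n b}. \<forall>l \<in> {0..j_max S n b}. j < l \<longrightarrow>
            sup_norm_01 (\<lambda>x. f_tilde \<psi> S n m b d j x - f_tilde \<psi> S n m b d l x)
              \<le> threshold S n m b \<tau> l}"
  unfolding j_hat_def by (rule Min_in) (auto intro!: exI[of _ "j_max S n b"])

lemma j_hat_le_j_max: "j_hat \<psi> S n m b \<tau> d \<le> j_max S n b"
  using j_hat_in_set[of \<psi> S n m b \<tau> d] by simp

text \<open>The selection rule reads nothing but the aggregated coefficients below
  \<open>j_max\<close>. Hence the central machine can compute the estimator, selected level
  included, from what it receives.\<close>

lemma f_hat_cong:
  assumes "\<And>l k. l < j_max S n b \<Longrightarrow> k < 2 ^ l \<Longrightarrow> agg_coef \<psi> S n m b d l k = agg_coef \<psi> S n m b d' l k"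
  shows "f_hat \<psi> S n m b \<tau> d = f_hat \<psi> S n m b \<tau> d'"
proof -
  have ft: "f_tilde \<psi> S n m b d j = f_tilde \<psi> S n m b d' j" if "j \<le> j_max S n b" for j
    using assms that by (intro f_tilde_cong) auto
  have "j_hat \<psi> S n m b \<tau> d = j_hat \<psi> S n m b \<tau> d'" by (rule j_hat_cong[OF ft])
  then show ?thesis unfolding f_hat_def using ft[OF j_hat_le_j_max] by simp
qed

lemma f_tilde_eq_wavelet_sum: "f_tilde \<psi> S n m b d j = wavelet_sum \<psi> (agg_coef \<psi> S n m b d) {..<j}"
  by (simp add: f_tilde_def[abs_def] wavelet_sum_def[abs_def])

lemma f_hat_L2_01:
  assumes "orthonormal_basis_01 \<psi>" shows "f_hat \<psi> S n m b \<tau> d \<in> L2_01"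
  unfolding f_hat_def f_tilde_eq_wavelet_sum by (rule wavelet_sum_L2[OF assms])

text \<open>An arbitrary order, fixed independently of the data, so that the central machine knows
  to which coefficient each code word belongs.\<close>

definition task_list :: "ereal \<Rightarrow> nat \<Rightarrow> nat \<Rightarrow> real \<Rightarrow> nat \<Rightarrow> (nat \<times> nat) list" where
  "task_list S n m b i = (SOME xs. set xs = tasks S n m b i \<and> distinct xs)"

lemma task_list: "set (task_list S n m b i) = tasks S n m b i" "distinct (task_list S n m b i)"
  using someI_ex[OF finite_distinct_list[OF finite_tasks[of S n m b i]]]
  unfolding task_list_def by auto

definition message ::
  "(nat \<Rightarrow> nat \<Rightarrow> real \<Rightarrow> real) \<Rightarrow> ereal \<Rightarrow> nat \<Rightarrow> nat \<Rightarrow> real \<Rightarrow> nat \<Rightarrow> (nat \<Rightarrow> real \<times> real) \<Rightarrow> bool list" where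
  "message \<psi> S n m b i x =
     concat (map (\<lambda>p. approx_code (digits n) (local_coef \<psi> n m x (fst p) (snd p))) (task_list S n m b i))"

lemma agg_coef_cong_message:
  assumes n: "1 \<le> n" and jk: "j < j_max S n b" "k < 2 ^ j"
    and eq: "\<And>i. i \<in> {1..m} \<Longrightarrow> message \<psi> S n m b i (d i) = message \<psi> S n m b i (d' i)"
  shows "agg_coef \<psi> S n m b d j k = agg_coef \<psi> S n m b d' j k"
proof -
  have "trans_approx n (local_coef \<psi> n m (d i) j k) = trans_approx n (local_coef \<psi> n m (d' i) j k)"
    if i: "i \<in> senders S n m b j k" for i
  proof -
    have "i \<in> {1..m}" using i senders_subset[OF jk] by blast
    moreover have "(j, k) \<in> set (task_list S n m b i)" using i jk by (simp add: task_list tasks_def)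
    ultimately show ?thesis
      using concat_codes_eq[OF n eq[unfolded message_def]] by fastforce
  qed
  then show ?thesis unfolding agg_coef_def by simp
qed

lemma message_measurable:
  assumes "orthonormal_basis_01 \<psi>"
  shows "message \<psi> S n m b i \<in> machine_space (n div m) \<rightarrow>\<^sub>M count_space UNIV"
  unfolding message_def[abs_def]
proof (rule concat_measurable)
  fix p assume "p \<in> set (task_list S n m b i)"
  then have "snd p < 2 ^ fst p" by (auto simp: task_list tasks_def)
  then have "\<psi> (fst p) (snd p) \<in> borel_measurable borel" using basis_L2[OF assms] by (simp add: L2_01_iff)
  then show "(\<lambda>x. approx_code (digits n) (local_coef \<psi> n m x (fst p) (snd p)))
      \<in> machine_space (n div m) \<rightarrow>\<^sub>M count_space UNIV"
    by (rule measurable_compose[OF local_coef_measurable approx_code_measurable])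
qed

text \<open>Linearity of expectation over at most \<open>2 ^ j_B\<close> code words. Only the unary
  part of a code is random, and its mean is controlled by the first absolute moment of a local
  coefficient.\<close>

lemma message_length:
  assumes "orthonormal_basis_01 \<psi>"
    and f: "f \<in> L2_01" "AE t in restrict_space lborel {0..1}. \<bar>f t\<bar> \<le> F" and G: "F\<^sup>2 + \<sigma>\<^sup>2 + 1 / 2 \<le> G"
    and nm: "0 < n" "m dvd n" and i: "i \<in> {1..m}"
  shows "(\<integral>\<^sup>+ d. of_nat (length (message \<psi> S n m b i (d i))) \<partial>data_law \<sigma> m (n div m) f)
     \<le> ennreal (2 ^ j_B n b * (2 + real (digits n) + G))"
proof -
  let ?P = "\<Pi>\<^sub>M l\<in>{1..n div m}. obs_law \<sigma> f"
  let ?T = "tasks S n m b i"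
  have G0: "0 \<le> G" by (rule order_trans[OF _ G]) simp
  have fm: "f \<in> borel_measurable borel" using f by (simp add: L2_01_iff)
  interpret P: prob_space ?P by (rule prob_space_machine_law[OF fm])
  have T: "\<psi> (fst p) (snd p) \<in> L2_01" "inner_01 (\<psi> (fst p) (snd p)) (\<psi> (fst p) (snd p)) = 1" if "p \<in> ?T" for p
    using that basis_L2[OF assms(1)] basis_orth[OF assms(1)] by (auto simp: tasks_def)
  define h where "h p x = ennreal (2 + real (digits n)) + ennreal \<bar>local_coef \<psi> n m x (fst p) (snd p)\<bar>" for p x
  have lm: "(\<lambda>x. ennreal \<bar>local_coef \<psi> n m x (fst p) (snd p)\<bar>) \<in> borel_measurable (machine_space (n div m))" if "p \<in> ?T" for p
    using local_coef_measurable[of \<psi> "fst p" "snd p" n m] T(1)[OF that] by (simp add: L2_01_iff)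
  have hm: "h p \<in> borel_measurable (machine_space (n div m))" if "p \<in> ?T" for p
    unfolding h_def by (intro borel_measurable_add borel_measurable_const lm that)
  have len: "of_nat (length (message \<psi> S n m b i x)) \<le> (\<Sum>p\<in>?T. h p x)" for x
  proof -
    have "real (length (message \<psi> S n m b i x))
        = (\<Sum>p\<in>?T. real (length (approx_code (digits n) (local_coef \<psi> n m x (fst p) (snd p)))))"
      unfolding message_def length_concat
      by (simp add: comp_def sum_list_distinct_conv_sum_set task_list)
    also have "\<dots> \<le> (\<Sum>p\<in>?T. 2 + real (digits n) + \<bar>local_coef \<psi> n m x (fst p) (snd p)\<bar>)"
      by (intro sum_mono length_approx_code)
    finally have "ennreal (real (length (message \<psi> S n m b i x)))
        \<le> ennreal (\<Sum>p\<in>?T. 2 + real (digits n) + \<bar>local_coef \<psi> n m x (fst p) (snd p)\<bar>)"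
      by (rule ennreal_leI)
    also have "\<dots> = (\<Sum>p\<in>?T. h p x)"
      unfolding h_def by (subst sum_ennreal[symmetric]) (auto simp flip: ennreal_plus)
    finally show ?thesis by (simp add: ennreal_of_nat_eq_real_of_nat)
  qed
  have "(\<integral>\<^sup>+ d. of_nat (length (message \<psi> S n m b i (d i))) \<partial>data_law \<sigma> m (n div m) f)
      \<le> (\<integral>\<^sup>+ d. (\<Sum>p\<in>?T. h p (d i)) \<partial>data_law \<sigma> m (n div m) f)"
    by (intro nn_integral_mono len)
  also have "\<dots> = (\<integral>\<^sup>+ x. (\<Sum>p\<in>?T. h p x) \<partial>?P)"
    by (rule nn_integral_data_law_machine[OF fm i]) (intro borel_measurable_sum hm)
  also have "\<dots> = (\<Sum>p\<in>?T. \<integral>\<^sup>+ x. h p x \<partial>?P)"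
    using hm by (intro nn_integral_sum) (simp only: measurable_cong_sets[OF sets_machine_law refl])
  also have "\<dots> \<le> (\<Sum>p\<in>?T. ennreal (2 + real (digits n) + G))"
  proof (rule sum_mono)
    fix p assume p: "p \<in> ?T"
    have "(\<integral>\<^sup>+ x. h p x \<partial>?P) = ennreal (2 + real (digits n)) + (\<integral>\<^sup>+ x. ennreal \<bar>local_coef \<psi> n m x (fst p) (snd p)\<bar> \<partial>?P)"
      unfolding h_def using lm[OF p] P.emeasure_space_1
      by (subst nn_integral_add) (auto simp: measurable_cong_sets[OF sets_machine_law refl] simp del: One_nat_def)
    also have "\<dots> \<le> ennreal (2 + real (digits n)) + ennreal G"
      by (intro add_left_mono order_trans[OF local_coef_first_moment ennreal_leI[OF G]] f T p nm)
    also have "\<dots> = ennreal (2 + real (digits n) + G)"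
      using G0 by (simp flip: ennreal_plus)
    finally show "(\<integral>\<^sup>+ x. h p x \<partial>?P) \<le> ennreal (2 + real (digits n) + G)" .
  qed
  also have "\<dots> = ennreal (real (card ?T) * (2 + real (digits n) + G))"
    using G0 by (simp add: ennreal_of_nat_eq_real_of_nat ennreal_mult del: ennreal_plus)
  also have "\<dots> \<le> ennreal (2 ^ j_B n b * (2 + real (digits n) + G))"
  proof -
    have "real (card ?T) \<le> real (2 ^ j_B n b)" using card_tasks[of S n m b i] by (rule of_nat_mono)
    then show ?thesis using G0 by (intro ennreal_leI mult_right_mono) auto
  qed
  finally show ?thesis .
qed

text \<open>At most \<open>b / log 2 n\<close> coefficients are sent, and for large n a code has
  mean length at most \<open>log 2 n / 2 + 2 + G\<close>, which is at most
  \<open>log 2 n\<close>.\<close>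

lemma f_hat_in_F_dist:
  assumes basis: "orthonormal_basis_01 \<psi>"
    and \<F>: "\<And>f. f \<in> \<F> \<Longrightarrow> f \<in> L2_01"
      "\<And>f. f \<in> \<F> \<Longrightarrow> AE t in restrict_space lborel {0..1}. \<bar>f t\<bar> \<le> F"
    and nm: "0 < n" "m dvd n"
    and G: "F\<^sup>2 + \<sigma>\<^sup>2 + 1 / 2 \<le> G" and n: "2 * (2 + G) \<le> log 2 (real n)" and b: "log 2 (real n) \<le> b"
  shows "f_hat \<psi> S n m b \<tau> \<in> F_dist \<sigma> m (n div m) (\<lambda>_. b) \<F>"
proof -
  let ?\<Omega> = "space (\<Pi>\<^sub>M i\<in>{1..m}. machine_space (n div m))"
  define Y where "Y d = (\<lambda>i\<in>{1..m}. message \<psi> S n m b i (d i))" for d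
  \<comment> \<open>The decoder evaluates the estimator at any data set producing the received
    strings; by \<open>det\<close> the choice is immaterial. Strings that no data set produces are
    decoded as 0, which keeps the decoder inside the function space.\<close>
  define g where "g y = (if \<exists>d\<in>?\<Omega>. y = Y d then f_hat \<psi> S n m b \<tau> (SOME d. d \<in> ?\<Omega> \<and> y = Y d) else (\<lambda>_. 0))" for y
  have det: "f_hat \<psi> S n m b \<tau> d = f_hat \<psi> S n m b \<tau> d'" if "Y d = Y d'" for d d'
  proof (rule f_hat_cong, rule agg_coef_cong_message)
    fix i assume "i \<in> {1..m}"
    then show "message \<psi> S n m b i (d i) = message \<psi> S n m b i (d' i)"
      using fun_cong[OF that, of i] by (simp add: Y_def)
  qed (use nm in auto)
  have "g (Y d) = f_hat \<psi> S n m b \<tau> d" if "d \<in> ?\<Omega>" for d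
  proof -
    have ex: "\<exists>d'. d' \<in> ?\<Omega> \<and> Y d = Y d'" using that by blast
    then have "g (Y d) = f_hat \<psi> S n m b \<tau> (SOME d'. d' \<in> ?\<Omega> \<and> Y d = Y d')" unfolding g_def by auto
    also have "\<dots> = f_hat \<psi> S n m b \<tau> d" using someI_ex[OF ex] by (intro det) simp
    finally show ?thesis .
  qed
  moreover have "g y \<in> L2_01" for y
    unfolding g_def using f_hat_L2_01[OF basis] by (auto simp: L2_01_iff[of "\<lambda>_. 0"])
  moreover have "(\<integral>\<^sup>+ d. of_nat (length (message \<psi> S n m b i (d i))) \<partial>data_law \<sigma> m (n div m) f) \<le> ennreal b"
    if "f \<in> \<F>" "i \<in> {1..m}" for f i
  proof -
    define l where "l = log 2 (real n)"
    have l: "1 \<le> l" using n order_trans[OF _ G, of 0] by (simp add: l_def)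
    have "real (digits n) \<le> l / 2" using l unfolding digits_def l_def[symmetric] by linarith
    then have "2 ^ j_B n b * (2 + real (digits n) + G) \<le> b / l * l"
      using l j_B_bounds(1)[of n b, folded l_def] b n order_trans[OF _ G, of 0] by (intro mult_mono) (auto simp: l_def[symmetric])
    also have "\<dots> = b" using l by simp
    finally show ?thesis
      by (intro order_trans[OF message_length[OF basis \<F>[OF that(1)] G nm that(2)]] ennreal_leI)
  qed
  ultimately show ?thesis
    unfolding F_dist_def using message_measurable[OF basis, of S n m b]
    by (intro CollectI exI[of _ "message \<psi> S n m b"] exI[of _ g]) (auto simp: Y_def)
qed

section \<open>Effective sample sizes and the rate\<close>

text \<open>Discarding leftovers costs at most a factor 2 as soon as the quotient is positive,
  because the remainder is then no larger than the part that is kept.\<close>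

lemma le_double_div_mult:
  fixes x y :: nat
  assumes "1 \<le> y div x"
  shows "y \<le> 2 * (x * (y div x))"
proof -
  have "0 < x" using assms by (cases x) auto
  then have "y mod x \<le> x" by simp
  also have "\<dots> \<le> x * (y div x)" using assms by (metis mult_le_mono2 mult.right_neutral)
  finally show ?thesis using mult_div_mod_eq[of x y] by linarith
qed

lemma powr_log_mult: "0 < y \<Longrightarrow> 2 powr (a * log 2 y) = y powr a"
  by (subst mult.commute, subst powr_powr[symmetric]) simp

text \<open>\<open>j_max\<close> is a minimum of two ceilings: both upper bounds hold, each with a
  factor 2 for the ceiling, while the lower bound is available only for the smaller of the two,
  hence the disjunction.\<close>

lemma j_max_bounds:
  assumes r: "0 < r" and n: "1 \<le> log 2 (real n)" and b: "1 \<le> b"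
  shows "1 \<le> j_max (ereal r) n b"
    and "real (j_max (ereal r) n b) \<le> log 2 (real n) + 1"
    and "2 ^ j_max (ereal r) n b \<le> 2 * (real n * b) powr (1 / (2 + 2 * r))"
    and "2 ^ j_max (ereal r) n b \<le> 2 * real n powr (1 / (1 + 2 * r))"
    and "real n * b \<le> 2 powr (real (j_max (ereal r) n b) * (2 + 2 * r)) \<or>
         real n \<le> 2 powr (real (j_max (ereal r) n b) * (1 + 2 * r))"
proof -
  define l where "l = log 2 (real n)"
  have n0: "0 < real n" using log_ge_one_pos n by auto
  define p where "p = 1 / (2 + 2 * r) * log 2 (real n * b)"
  define q where "q = 1 / (1 + 2 * r) * l"
  have l1: "l \<le> log 2 (real n * b)" using n0 b by (simp add: l_def log_mult)
  have p0: "0 < p" using r l1 n unfolding p_def l_def by (intro mult_pos_pos) auto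
  have q0: "0 < q" "q \<le> l" using r n unfolding q_def l_def by (auto simp: divide_simps)
  have two: "(2::ereal) = ereal 2" by simp
  have e1: "real_of_ereal (1 / (2 + 2 * ereal r)) = 1 / (2 + 2 * r)"
    using r by (simp only: two one_ereal_def times_ereal.simps plus_ereal.simps ereal_divide) simp
  have e2: "real_of_ereal (1 / (1 + 2 * ereal r)) = 1 / (1 + 2 * r)"
    using r by (simp only: two one_ereal_def times_ereal.simps plus_ereal.simps ereal_divide) simp
  have J: "j_max (ereal r) n b = nat (min \<lceil>p\<rceil> \<lceil>q\<rceil>)"
    unfolding j_max_def e1 e2 p_def q_def l_def ..
  have pos: "1 \<le> \<lceil>p\<rceil>" "1 \<le> \<lceil>q\<rceil>" using p0 q0 by linarith+
  then have Ji: "int (j_max (ereal r) n b) = min \<lceil>p\<rceil> \<lceil>q\<rceil>" unfolding J by simp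
  define j where "j = j_max (ereal r) n b"
  have j: "real j = real_of_int (min \<lceil>p\<rceil> \<lceil>q\<rceil>)" using Ji unfolding j_def by (metis of_int_of_nat_eq)
  have jp: "real j \<le> p + 1" "real j \<le> q + 1" and jl: "p \<le> real j \<or> q \<le> real j"
    unfolding j by linarith+
  show "1 \<le> j_max (ereal r) n b" using Ji pos by linarith
  show "real (j_max (ereal r) n b) \<le> log 2 (real n) + 1" using jp q0 by (simp add: j_def l_def)
  have pw: "(2::real) ^ j = 2 powr real j" by (simp add: powr_realpow)
  have pp: "2 powr p = (real n * b) powr (1 / (2 + 2 * r))" "2 powr q = real n powr (1 / (1 + 2 * r))"
    using n0 b unfolding p_def q_def l_def by (auto simp only: intro!: powr_log_mult mult_pos_pos)
  have "(2::real) powr real j \<le> 2 powr (p + 1)" using jp by (intro powr_mono) auto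
  then show "2 ^ j_max (ereal r) n b \<le> 2 * (real n * b) powr (1 / (2 + 2 * r))"
    by (simp add: j_def[symmetric] pw powr_add pp)
  have "(2::real) powr real j \<le> 2 powr (q + 1)" using jp by (intro powr_mono) auto
  then show "2 ^ j_max (ereal r) n b \<le> 2 * real n powr (1 / (1 + 2 * r))"
    by (simp add: j_def[symmetric] pw powr_add pp)
  have "log 2 (real n * b) = p * (2 + 2 * r)" "log 2 (real n) = q * (1 + 2 * r)"
    using r unfolding p_def q_def l_def by auto
  then have "log 2 (real n * b) \<le> real j * (2 + 2 * r) \<or> log 2 (real n) \<le> real j * (1 + 2 * r)"
    using jl r by (auto intro!: mult_right_mono)
  then show "real n * b \<le> 2 powr (real (j_max (ereal r) n b) * (2 + 2 * r)) \<or>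
         real n \<le> 2 powr (real (j_max (ereal r) n b) * (1 + 2 * r))"
    using n0 b by (simp add: j_def[symmetric] log_le_iff)
qed

lemma first_half_nonempty: "first_half m \<noteq> {} \<Longrightarrow> 2 \<le> m"
  by (cases "2 \<le> m") (auto simp: first_half_def)

lemma n_eff_nonneg: "0 \<le> n_eff S n m b j"
  by (simp add: n_eff_def)

lemma n_eff_pos:
  assumes "0 < n" "first_half m \<noteq> {}" "\<forall>t < n_groups S n b. 1 \<le> subgroup_size S n m b t" "j < j_max S n b"
  shows "0 < n_eff S n m b j"
proof -
  have m: "2 \<le> m" using assms(2) by (rule first_half_nonempty)
  have "1 \<le> subgroup_size S n m b (j - j_B n b)" if "\<not> j < j_B n b"
    using assms(3,4) that by (auto simp: n_groups_def)
  moreover have "0 < m div 2" using m by simp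
  ultimately show ?thesis using assms(1) m by (auto simp: n_eff_def first_half_def)
qed

lemma subgroup_size_le: "subgroup_size S n m b t \<le> (m + 1) div 2"
  unfolding subgroup_size_def group_size_def by (meson div_le_dividend le_trans)

text \<open>Exact monotonicity can fail at the passage to the groups: for odd m the second half has
  one machine more than the first, and a subgroup may be as large as the second half. The factor 2
  absorbs this.\<close>

lemma n_eff_almost_antimono:
  assumes "first_half m \<noteq> {}" "i \<le> l"
  shows "n_eff S n m b l \<le> 2 * n_eff S n m b i"
proof -
  have m: "2 \<le> m" using assms(1) by (rule first_half_nonempty)
  define c where "c j = (if j < j_B n b then m div 2 else subgroup_size S n m b (j - j_B n b))" for j
  have N: "n_eff S n m b j = real (c j) * (real n / real m)" for j
    by (simp add: n_eff_def c_def first_half_def)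
  have "c l \<le> 2 * c i"
  proof (cases "i < j_B n b")
    case True
    have "(m + 1) div 2 \<le> 2 * (m div 2)" using m by linarith
    then show ?thesis using True subgroup_size_le[of S n m b "l - j_B n b"] by (simp add: c_def)
  next
    case False
    have "(2::nat) ^ (i - j_B n b) \<le> 2 ^ (l - j_B n b)" using assms(2) by (intro power_increasing) auto
    then have "subgroup_size S n m b (l - j_B n b) \<le> subgroup_size S n m b (i - j_B n b)"
      unfolding subgroup_size_def by (intro div_le_mono2) auto
    then show ?thesis using False assms(2) by (simp add: c_def)
  qed
  then have "real (c l) \<le> real (2 * c i)" by (rule of_nat_mono)
  then have "real (c l) * (real n / real m) \<le> real (2 * c i) * (real n / real m)" by (rule mult_right_mono) simp
  then show ?thesis unfolding N by simp
qed

lemma n_eff_le: "n_eff S n m b j \<le> real n"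
proof (cases "m = 0")
  case False
  have "(m + 1) div 2 \<le> m" using False by linarith
  then have "(if j < j_B n b then m div 2 else subgroup_size S n m b (j - j_B n b)) \<le> m"
    using subgroup_size_le[of S n m b "j - j_B n b"] by simp
  then have "real (if j < j_B n b then m div 2 else subgroup_size S n m b (j - j_B n b)) * real n \<le> real m * real n"
    by (intro mult_right_mono of_nat_mono) auto
  then show ?thesis using False by (auto simp: n_eff_def first_half_def divide_le_eq mult.commute split: if_splits)
qed (simp add: n_eff_def)

text \<open>The constant 3 is attained at m = 3, where the first half is a single machine.\<close>

lemma n_eff_low_levels:
  assumes "first_half m \<noteq> {}" "j < j_B n b"
  shows "real n / 3 \<le> n_eff S n m b j"
proof -
  have m: "2 \<le> m" using assms(1) by (rule first_half_nonempty)
  then have "m \<le> 3 * (m div 2)" by linarith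
  then have "real m * real n \<le> real (3 * (m div 2)) * real n" by (intro mult_right_mono of_nat_mono) auto
  then show ?thesis using m assms(2) by (simp add: n_eff_def first_half_def field_simps)
qed

lemma n_eff_high_levels_upper:
  assumes "j_B n b \<le> j" "0 < m"
  shows "n_eff S n m b j \<le> real n * 2 ^ j_B n b / 2 ^ j"
proof -
  define t where "t = j - j_B n b"
  have "subgroup_size S n m b t * 2 ^ t \<le> group_size S n m b" by (rule subgroup_size_bound)
  also have "\<dots> \<le> (m + 1) div 2" unfolding group_size_def by simp
  also have "\<dots> \<le> m" using assms(2) by linarith
  finally have "real (subgroup_size S n m b t * 2 ^ t) \<le> real m" by (rule of_nat_mono)
  then have "real (subgroup_size S n m b t) * 2 ^ t * real n \<le> real m * real n"
    by (intro mult_right_mono) auto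
  then have "real (subgroup_size S n m b t) * real n / real m \<le> real n / 2 ^ t"
    using assms(2) by (simp add: field_simps)
  moreover have "(2::real) ^ j = 2 ^ t * 2 ^ j_B n b" using assms(1) by (simp add: t_def flip: power_add)
  ultimately show ?thesis using assms by (simp add: n_eff_def t_def[symmetric])
qed

text \<open>The 64 collects a factor 2 for each of the leftovers inside a group, the leftovers of
  the groups and the halving of the machines, a further 2 from bounding the number of groups by
  \<open>2 * log 2 n\<close>, and the 4 of \<open>j_B_bounds\<close>. One logarithm comes from the
  number of groups, the other from \<open>2 ^ j_B\<close> being of order
  \<open>b / log 2 n\<close>.\<close>

lemma n_eff_high_levels_lower:
  assumes "first_half m \<noteq> {}" "\<forall>t < n_groups S n b. 1 \<le> subgroup_size S n m b t"
    and j: "j_B n b \<le> j" "j < j_max S n b"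
    and l: "1 \<le> log 2 (real n)" "log 2 (real n) \<le> b" and J: "real (j_max S n b) \<le> log 2 (real n) + 1"
  shows "real n * b / (64 * (log 2 (real n))\<^sup>2 * 2 ^ j) \<le> n_eff S n m b j"
proof -
  define L where "L = log 2 (real n)"
  define t where "t = j - j_B n b"
  define \<eta> where "\<eta> = n_groups S n b"
  define ss where "ss = subgroup_size S n m b t"
  define gs where "gs = group_size S n m b"
  have m: "2 \<le> m" using assms(1) by (rule first_half_nonempty)
  have ss1: "1 \<le> ss" using assms(2) j by (simp add: ss_def t_def n_groups_def)
  then have "gs \<le> 2 * (2 ^ t * ss)"
    unfolding ss_def subgroup_size_def gs_def by (rule le_double_div_mult)
  moreover have "1 \<le> gs" using ss1 unfolding ss_def subgroup_size_def gs_def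
    by (metis div_le_dividend le_trans)
  then have "(m + 1) div 2 \<le> 2 * (\<eta> * gs)"
    unfolding gs_def group_size_def \<eta>_def by (rule le_double_div_mult)
  ultimately have "(m + 1) div 2 \<le> 2 * (\<eta> * (2 * (2 ^ t * ss)))"
    by (meson le_trans mult_le_mono2)
  moreover have "m \<le> 2 * ((m + 1) div 2)" by linarith
  ultimately have "m \<le> 8 * \<eta> * 2 ^ t * ss" by (simp add: mult_ac)
  then have "real m \<le> real (8 * \<eta> * 2 ^ t * ss)" by (rule of_nat_mono)
  also have "\<dots> = 8 * real \<eta> * 2 ^ t * real ss" by simp
  also have "\<dots> \<le> 8 * (2 * L) * 2 ^ t * real ss"
  proof -
    have "real \<eta> \<le> real (j_max S n b)" by (simp add: \<eta>_def n_groups_def)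
    then have "real \<eta> \<le> 2 * L" using J l by (simp add: L_def)
    then show ?thesis by (intro mult_right_mono mult_left_mono) auto
  qed
  finally have mss: "real m \<le> 16 * L * 2 ^ t * real ss" by simp
  have bL: "b \<le> 4 * L * 2 ^ j_B n b"
    using j_B_bounds(2)[OF l] l by (simp add: L_def divide_le_eq mult_ac)
  have p2: "(2::real) ^ j = 2 ^ t * 2 ^ j_B n b" using j(1) by (simp add: t_def flip: power_add)
  have L0: "1 \<le> L" using l by (simp add: L_def)
  have "real n * b * real m \<le> real n * (4 * L * 2 ^ j_B n b) * (16 * L * 2 ^ t * real ss)"
    using mss bL l by (intro mult_mono mult_left_mono) auto
  also have "\<dots> = real ss * real n * (64 * L\<^sup>2 * 2 ^ j)"
    by (simp add: p2 power2_eq_square)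
  finally show ?thesis using j(1) m L0
    by (simp add: n_eff_def t_def[symmetric] ss_def[symmetric] L_def[symmetric] field_simps)
qed

text \<open>The oracle level is \<open>balance_level - 1\<close>: at it the bias dominates the stochastic error, and
  from the next level on it is the other way round.\<close>

definition balanced :: "ereal \<Rightarrow> nat \<Rightarrow> nat \<Rightarrow> real \<Rightarrow> real \<Rightarrow> nat \<Rightarrow> bool" where
  "balanced S n m b s l \<longleftrightarrow> n_eff S n m b l \<le> log 2 (real n) * 2 powr (real l * (1 + 2 * s))"

definition balance_level :: "ereal \<Rightarrow> nat \<Rightarrow> nat \<Rightarrow> real \<Rightarrow> real \<Rightarrow> nat" where
  "balance_level S n m b s = (LEAST l. balanced S n m b s l)"

lemma j_max_alternative:
  assumes "0 < r" "r \<le> s" "1 \<le> log 2 (real n)" "1 \<le> b"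
  shows "real n * b \<le> 2 powr (real (j_max (ereal r) n b) * (2 + 2 * s)) \<or>
         real n \<le> 2 powr (real (j_max (ereal r) n b) * (1 + 2 * s))"
proof -
  have "(2::real) powr (real (j_max (ereal r) n b) * (2 + 2 * r)) \<le> 2 powr (real (j_max (ereal r) n b) * (2 + 2 * s))"
    "(2::real) powr (real (j_max (ereal r) n b) * (1 + 2 * r)) \<le> 2 powr (real (j_max (ereal r) n b) * (1 + 2 * s))"
    using assms by (auto intro!: mult_left_mono)
  then show ?thesis using j_max_bounds(5)[OF assms(1,3,4)] by linarith
qed

text \<open>Ensures that the least balanced level exists and is among the candidates. Whichever
  ceiling defines \<open>j_max\<close>, either n itself or \<open>n * b / 2 ^ j\<close>, which
  bounds the sample size of a group level, is small enough.\<close>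

lemma balanced_j_max:
  assumes r: "0 < r" "r \<le> s" and l: "1 \<le> log 2 (real n)" "log 2 (real n) \<le> b" and "0 < m"
  shows "balanced (ereal r) n m b s (j_max (ereal r) n b)"
proof -
  define j where "j = j_max (ereal r) n b"
  define x where "x = (2::real) powr (real j * (1 + 2 * s))"
  have x2: "2 powr (real j * (2 + 2 * s)) = 2 ^ j * x"
    unfolding x_def by (simp add: powr_realpow[symmetric] powr_add[symmetric] algebra_simps)
  have x0: "0 < x" by (simp add: x_def)
  have "n_eff (ereal r) n m b j \<le> x"
    using j_max_alternative[OF r l(1) order_trans[OF l]]
  proof (elim disjE)
    assume "real n \<le> 2 powr (real (j_max (ereal r) n b) * (1 + 2 * s))"
    then show ?thesis using n_eff_le[of "ereal r" n m b j] by (simp add: x_def j_def)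
  next
    assume "real n * b \<le> 2 powr (real (j_max (ereal r) n b) * (2 + 2 * s))"
    then have nb: "real n * b \<le> 2 ^ j * x" unfolding j_def[symmetric] x2 .
    have "2 ^ j_B n b \<le> b / log 2 (real n)" by (rule j_B_bounds[OF l])
    also have "\<dots> \<le> b" using l by (simp add: divide_le_eq)
    finally have jb: "2 ^ j_B n b \<le> b" .
    show ?thesis
    proof (cases "j < j_B n b")
      case True
      have "real n * 2 ^ j \<le> real n * 2 ^ j_B n b" using True by (intro mult_left_mono power_increasing) auto
      also have "\<dots> \<le> real n * b" using jb by (intro mult_left_mono) auto
      finally have "real n * 2 ^ j \<le> 2 ^ j * x" using nb by linarith
      then have "real n \<le> x" by (simp add: mult.commute)
      then show ?thesis using n_eff_le[of "ereal r" n m b j] by simp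
    next
      case False
      have "n_eff (ereal r) n m b j \<le> real n * 2 ^ j_B n b / 2 ^ j"
        using False assms(5) by (intro n_eff_high_levels_upper) auto
      also have "\<dots> \<le> real n * b / 2 ^ j" using jb by (intro divide_right_mono mult_left_mono) auto
      also have "\<dots> \<le> x" using nb by (simp add: divide_le_eq mult.commute)
      finally show ?thesis .
    qed
  qed
  also have "x \<le> log 2 (real n) * x" using l x0 by simp
  finally show ?thesis unfolding balanced_def x_def j_def .
qed

lemma balance_level_props:
  assumes "0 < r" "r \<le> s" "1 \<le> log 2 (real n)" "log 2 (real n) \<le> b" "0 < m"
  shows "balanced (ereal r) n m b s (balance_level (ereal r) n m b s)"
    and "balance_level (ereal r) n m b s \<le> j_max (ereal r) n b"
    and "l < balance_level (ereal r) n m b s \<Longrightarrow> \<not> balanced (ereal r) n m b s l"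
  using balanced_j_max[OF assms] unfolding balance_level_def
  by (auto intro: LeastI Least_le dest: not_less_Least)

text \<open>Turns balance, an upper bound on the sample size at p, into a lower bound on p by
  inserting lower bounds on that sample size. The additional \<open>j_B n b \<le> p\<close> in the
  second alternative serves the case of a budget above the cutoff.\<close>

lemma balance_level_lower:
  assumes r: "0 < r" "r \<le> s" and l: "1 \<le> log 2 (real n)" "log 2 (real n) \<le> b"
    and m: "first_half m \<noteq> {}" "\<forall>t < n_groups (ereal r) n b. 1 \<le> subgroup_size (ereal r) n m b t"
  defines "p \<equiv> balance_level (ereal r) n m b s"
  shows "real n / 3 \<le> log 2 (real n) * 2 powr (real p * (1 + 2 * s)) \<or>
     real n * b / 64 \<le> (log 2 (real n)) ^ 3 * 2 powr (real p * (2 + 2 * s)) \<and> j_B n b \<le> p"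
proof -
  have m0: "0 < m" using first_half_nonempty[OF m(1)] by simp
  define L where "L = log 2 (real n)"
  have L: "1 \<le> L" using l by (simp add: L_def)
  define x where "x = (2::real) powr (real p * (1 + 2 * s))"
  have x2: "2 powr (real p * (2 + 2 * s)) = 2 ^ p * x"
    unfolding x_def by (simp add: powr_realpow[symmetric] powr_add[symmetric] algebra_simps)
  have x0: "0 < x" by (simp add: x_def)
  have bal: "n_eff (ereal r) n m b p \<le> L * x" and pj: "p \<le> j_max (ereal r) n b"
    using balance_level_props[OF r l m0] unfolding p_def[symmetric] balanced_def x_def L_def by auto
  show ?thesis
  proof (cases "p < j_B n b")
    case True
    then show ?thesis using n_eff_low_levels[OF m(1) True, of "ereal r"] bal by (simp add: L_def x_def)
  next
    case jB: False
    have L3: "x \<le> L * x" "2 ^ p * x \<le> L ^ 3 * (2 ^ p * x)"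
      using L x0 by (auto simp: one_le_power)
    show ?thesis
    proof (cases "p = j_max (ereal r) n b")
      \<comment> \<open>No machine transmits level \<open>j_max\<close>, and the effective sample
        size may vanish there, so no lower bound on it is available; the definition of
        \<open>j_max\<close> gives the alternative directly.\<close>
      case True
      from j_max_alternative[OF r l(1) order_trans[OF l]]
      have "real n * b \<le> 2 ^ p * x \<or> real n \<le> x" unfolding True[symmetric] x2 x_def[symmetric] .
      moreover have "0 \<le> real n * b" "0 \<le> real n" using l by auto
      then have "real n * b / 64 \<le> real n * b" "real n / 3 \<le> real n" by linarith+
      ultimately have "real n * b / 64 \<le> L ^ 3 * (2 ^ p * x) \<or> real n / 3 \<le> L * x"
        using L3 by linarith
      then show ?thesis using jB unfolding x2 L_def x_def[symmetric] by auto
    next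
      case False
      have "real n * b / (64 * L\<^sup>2 * 2 ^ p) \<le> L * x"
        using n_eff_high_levels_lower[OF m _ _ l j_max_bounds(2)[OF r(1) l(1)], of p] jB False pj bal l
        by (simp add: L_def[symmetric])
      then have "real n * b \<le> L * x * (64 * L\<^sup>2 * 2 ^ p)" using L by (simp add: divide_le_eq)
      then have "real n * b / 64 \<le> L ^ 3 * (2 ^ p * x)" by (simp add: power3_eq_cube power2_eq_square mult_ac)
      then show ?thesis using jB unfolding x2 L_def x_def[symmetric] by auto
    qed
  qed
qed

text \<open>Below the cutoff the rate is handled through its logarithm, an affine function of
  \<open>ln n\<close>, \<open>ln (log 2 n)\<close> and \<open>ln b\<close>.\<close>

lemma rate_below_cutoff:
  assumes "0 < s" "1 \<le> log 2 (real n)" "log 2 (real n) \<le> b" "b < t_cutoff L s n"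
  defines "D \<equiv> 1 / (1 + 2 * s)" and "h \<equiv> s / (2 + 2 * s)"
    and "\<nu> \<equiv> ln (real n)" and "\<Lambda> \<equiv> ln (log 2 (real n))" and "\<beta> \<equiv> ln b"
  shows "rate L s n b = exp (h * ((2 + 4 * s) * D * \<Lambda> + \<nu> * D - \<beta>) - s * D * (\<nu> - \<Lambda>))"
proof -
  have n0: "0 < real n" using log_ge_one_pos assms(2) by auto
  have l0: "0 < log 2 (real n)" using assms(2) by linarith
  then have l0': "log 2 (real n) \<noteq> 0" by linarith
  have b0: "0 < b" using assms(2,3) by linarith
  have E: "(5 + 8 * s) * s / ((1 + 2 * s) * (2 + 2 * s)) = h * (5 + 8 * s) * D"
    "(3 + 4 * s) / (1 + 2 * s) = (3 + 4 * s) * D" "s / (1 + 2 * s) = s * D"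
    using assms(1) by (auto simp: h_def D_def field_simps)
  have M: "M_log s n = exp (h * (5 + 8 * s) * D * \<Lambda>)"
    using l0' unfolding M_log_def E by (simp add: powr_def \<Lambda>_def)
  have X: "(real n / log 2 (real n)) powr (- (s / (1 + 2 * s))) = exp (- (s * D) * (\<nu> - \<Lambda>))"
    using n0 l0' unfolding E by (simp add: powr_def \<Lambda>_def \<nu>_def ln_div)
  have q: "real n powr (1 / (1 + 2 * s)) = exp (D * \<nu>)" "log 2 (real n) powr ((3 + 4 * s) / (1 + 2 * s)) = exp ((3 + 4 * s) * D * \<Lambda>)"
    using n0 l0' unfolding E by (auto simp: powr_def D_def \<nu>_def \<Lambda>_def)
  have "real n powr (1 / (1 + 2 * s)) / (b * log 2 (real n) powr ((3 + 4 * s) / (1 + 2 * s)))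
      = exp (D * \<nu> - (\<beta> + (3 + 4 * s) * D * \<Lambda>))"
    unfolding q using b0 by (simp add: exp_diff exp_add \<beta>_def)
  then have P: "(real n powr (1 / (1 + 2 * s)) / (b * log 2 (real n) powr ((3 + 4 * s) / (1 + 2 * s)))) powr (s / (2 + 2 * s))
      = exp (h * (D * \<nu> - (\<beta> + (3 + 4 * s) * D * \<Lambda>)))"
    by (simp add: powr_def h_def)
  show ?thesis
    unfolding rate_def using assms(4)
    by (simp only: if_not_P[OF leD] M X P exp_add[symmetric] not_le[symmetric] if_False refl)
       (simp add: algebra_simps)
qed

text \<open>Below the cutoff, b < t_n bounds the factor multiplying the minimax rate from below by a
  constant. Thus every term of minimax order is absorbed, whichever case of the rate
  applies.\<close>

lemma minimax_rate_le_rate: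
  assumes L: "0 < L" and s: "0 < s" and l: "1 \<le> log 2 (real n)" "log 2 (real n) \<le> b"
  shows "(real n / log 2 (real n)) powr (- (s / (1 + 2 * s)))
     \<le> (1 + (12 * L powr (2 / (1 + 2 * s))) powr (s / (2 + 2 * s))) * rate L s n b"
proof (cases "t_cutoff L s n \<le> b")
  case True
  have "1 * (real n / log 2 (real n)) powr (- (s / (1 + 2 * s)))
     \<le> (1 + (12 * L powr (2 / (1 + 2 * s))) powr (s / (2 + 2 * s))) * (real n / log 2 (real n)) powr (- (s / (1 + 2 * s)))"
    by (intro mult_right_mono) auto
  then show ?thesis using True by (simp add: rate_def)
next
  case False
  define D where "D = 1 / (1 + 2 * s)"
  define h where "h = s / (2 + 2 * s)"
  define \<nu> where "\<nu> = ln (real n)"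
  define \<Lambda> where "\<Lambda> = ln (log 2 (real n))"
  define \<beta> where "\<beta> = ln b"
  define K where "K = 12 * L powr (2 / (1 + 2 * s))"
  have n0: "0 < real n" using log_ge_one_pos l by auto
  have l0: "0 < log 2 (real n)" using l by linarith
    then have l0': "log 2 (real n) \<noteq> 0" by linarith
  have b0: "0 < b" using l by linarith
  have K0: "0 < K" using L by (simp add: K_def)
  have h0: "0 \<le> h" using s by (simp add: h_def)
  have \<Lambda>0: "0 \<le> \<Lambda>" using l by (simp add: \<Lambda>_def)
  have "b \<le> K * (real n / log 2 (real n)) powr D * log 2 (real n)"
    using False by (simp add: t_cutoff_def K_def D_def)
  then have "\<beta> \<le> ln (K * (real n / log 2 (real n)) powr D * log 2 (real n))"
    using b0 unfolding \<beta>_def by simp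
  also have "\<dots> = ln K + D * (\<nu> - \<Lambda>) + \<Lambda>"
    using K0 n0 l0' by (simp add: ln_mult ln_powr ln_div \<nu>_def \<Lambda>_def)
  finally have beta: "\<beta> \<le> ln K + D * (\<nu> - \<Lambda>) + \<Lambda>" .
  have D: "(1 + 2 * s) * D = 1" "0 < D" using s by (auto simp: D_def)
  \<comment> \<open>The powers of the logarithm in \<open>rate\<close> exceed what the cutoff
    demands: inserting the bound on \<beta> leaves \<Lambda> + D \<Lambda>.\<close>
  have "0 \<le> ln K + (2 + 4 * s) * D * \<Lambda> + \<nu> * D - \<beta>"
  proof -
    have "(2 + 4 * s) * D = 2" using D(1) by (simp add: algebra_simps)
    then have "(2 + 4 * s) * D * \<Lambda> = 2 * \<Lambda>" by simp
    moreover have "D * (\<nu> - \<Lambda>) = \<nu> * D - D * \<Lambda>" by (simp add: algebra_simps)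
    moreover have "0 \<le> D * \<Lambda>" using D(2) \<Lambda>0 by simp
    ultimately show ?thesis using beta \<Lambda>0 by linarith
  qed
  then have "0 \<le> h * (ln K + (2 + 4 * s) * D * \<Lambda> + \<nu> * D - \<beta>)" using h0 by simp
  then have main: "- (s * D) * (\<nu> - \<Lambda>) \<le> h * ln K + (h * ((2 + 4 * s) * D * \<Lambda> + \<nu> * D - \<beta>) - s * D * (\<nu> - \<Lambda>))"
    by (simp add: algebra_simps)
  have R: "rate L s n b = exp (h * ((2 + 4 * s) * D * \<Lambda> + \<nu> * D - \<beta>) - s * D * (\<nu> - \<Lambda>))"
    using rate_below_cutoff[OF s l, of L] False by (simp add: D_def h_def \<nu>_def \<Lambda>_def \<beta>_def)
  have "(real n / log 2 (real n)) powr (- (s / (1 + 2 * s))) = exp (- (s * D) * (\<nu> - \<Lambda>))"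
    using n0 l0' by (simp add: powr_def D_def \<nu>_def \<Lambda>_def ln_div)
  also have "\<dots> \<le> exp (h * ln K) * rate L s n b" unfolding R exp_add[symmetric] using main by simp
  also have "exp (h * ln K) = K powr h" using K0 by (simp add: powr_def)
  also have "K powr h * rate L s n b \<le> (1 + K powr h) * rate L s n b"
    by (intro mult_right_mono) (auto simp: R)
  finally show ?thesis unfolding K_def h_def .
qed

text \<open>There are three cases. If p is at least the level that is optimal without communication
  constraint, the bias has minimax order. If the budget exceeds the cutoff, already
  \<open>j_B\<close> is such a level up to constants, and p is not below it. Otherwise the
  inequality for \<open>n * b\<close> is solved for p, and its three logarithms are paid for by the
  logarithmic factors of the rate.\<close>

lemma level_rate_bound:
  assumes L: "0 < L" and s: "0 < s"
  shows "\<exists>C\<ge>1. \<forall>n b p. 1 \<le> log 2 (real n) \<longrightarrow> log 2 (real n) \<le> b \<longrightarrow>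
    (real n / 3 \<le> log 2 (real n) * 2 powr (real p * (1 + 2 * s)) \<or>
     real n * b / 64 \<le> (log 2 (real n)) ^ 3 * 2 powr (real p * (2 + 2 * s)) \<and> j_B n b \<le> p) \<longrightarrow>
    2 powr (- (real p * s)) \<le> C * rate L s n b"
proof -
  define D where "D = 1 / (1 + 2 * s)"
  define h where "h = s / (2 + 2 * s)"
  define C0 where "C0 = 1 + (12 * L powr (2 / (1 + 2 * s))) powr (s / (2 + 2 * s))"
  \<comment> \<open>A quarter of the constant 12 L^(2/(1+2s)) of the cutoff; the 4 is lost in
    passing from \<open>b / log 2 n\<close> to \<open>2 ^ j_B\<close>.\<close>
  define K where "K = 3 * L powr (2 / (1 + 2 * s))"
  have D: "(1 + 2 * s) * D = 1" "0 < D" "s * D < 1" using s by (auto simp: D_def divide_less_eq)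
  have h: "(2 + 2 * s) * h = s" "0 < h" "h < 1" using s by (auto simp: h_def divide_less_eq)
  have K0: "0 < K" using L by (simp add: K_def)
  have C00: "1 \<le> C0" by (simp add: C0_def)
  have "2 powr (- (real p * s)) \<le> (3 * C0 + 64 + K powr (- s)) * rate L s n b"
    if l: "1 \<le> log 2 (real n)" "log 2 (real n) \<le> b" and
      p: "real n / 3 \<le> log 2 (real n) * 2 powr (real p * (1 + 2 * s)) \<or>
     real n * b / 64 \<le> (log 2 (real n)) ^ 3 * 2 powr (real p * (2 + 2 * s)) \<and> j_B n b \<le> p" for n b p
  proof -
    define \<nu> where "\<nu> = ln (real n)"
    define \<Lambda> where "\<Lambda> = ln (log 2 (real n))"
    define \<beta> where "\<beta> = ln b"
    define X where "X = (real n / log 2 (real n)) powr (- (s / (1 + 2 * s)))"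
    define P where "P = real p * ln 2"
    have n0: "0 < real n" using log_ge_one_pos l by auto
    have l0: "0 < log 2 (real n)" using l by linarith
    then have l0': "log 2 (real n) \<noteq> 0" by linarith
    have b0: "0 < b" using l by linarith
    have \<Lambda>0: "0 \<le> \<Lambda>" using l by (simp add: \<Lambda>_def)
    have X: "X = exp (- (s * D) * (\<nu> - \<Lambda>))"
      using n0 l0' by (simp add: X_def powr_def D_def \<nu>_def \<Lambda>_def ln_div)
    have XR: "X \<le> C0 * rate L s n b" unfolding X_def C0_def by (rule minimax_rate_le_rate[OF L s l])
    have R0: "0 \<le> rate L s n b" using XR C00 X by (smt (verit) exp_gt_zero mult_less_0_iff)
    have lhs: "2 powr (- (real p * s)) = exp (- (s * P))" by (simp add: powr_def P_def mult_ac)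
    have weaken: "2 powr (- (real p * s)) \<le> (3 * C0 + 64 + K powr (- s)) * rate L s n b"
      if "2 powr (- (real p * s)) \<le> c * rate L s n b" "c \<le> 3 * C0 + 64 + K powr (- s)" for c
      using that R0 by (meson mult_right_mono order_trans)
    from p show ?thesis
    proof (elim disjE conjE)
      assume "real n / 3 \<le> log 2 (real n) * 2 powr (real p * (1 + 2 * s))"
      then have "ln (real n / 3) \<le> ln (log 2 (real n) * 2 powr (real p * (1 + 2 * s)))"
        using n0 l0 by (subst ln_le_cancel_iff) auto
      then have "\<nu> - ln 3 \<le> \<Lambda> + P * (1 + 2 * s)"
        using n0 l0 by (simp add: ln_div ln_mult ln_powr \<nu>_def \<Lambda>_def P_def mult_ac)
      then have "(s * D) * (\<nu> - ln 3 - \<Lambda>) \<le> (s * D) * (P * (1 + 2 * s))"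
        using s D by (intro mult_left_mono) auto
      also have "\<dots> = s * P * ((1 + 2 * s) * D)" by (simp add: mult_ac)
      also have "\<dots> = s * P" by (simp only: D(1) mult_1_right)
      finally have "- (s * P) \<le> (s * D) * ln 3 + - (s * D) * (\<nu> - \<Lambda>)" by (simp add: algebra_simps)
      then have "exp (- (s * P)) \<le> exp ((s * D) * ln 3) * X" unfolding X by (simp add: exp_add[symmetric])
      also have "\<dots> \<le> 3 * X"
      proof (rule mult_right_mono)
        have "(s * D) * ln 3 \<le> 1 * ln (3::real)" using D by (intro mult_right_mono) auto
        then have "exp ((s * D) * ln 3) \<le> exp (ln (3::real))" by (subst exp_le_cancel_iff) simp
        then show "exp ((s * D) * ln 3) \<le> (3::real)" by simp
      qed (simp add: X)
      also have "\<dots> \<le> 3 * (C0 * rate L s n b)" using XR by simp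
      finally show ?thesis unfolding lhs[symmetric] using C00
        by (intro weaken[of "3 * C0"]) (auto simp: mult.assoc)
    next
      assume nb: "real n * b / 64 \<le> (log 2 (real n)) ^ 3 * 2 powr (real p * (2 + 2 * s))" and jB: "j_B n b \<le> p"
      show ?thesis
      proof (cases "t_cutoff L s n \<le> b")
        case True
        have "K * (real n / log 2 (real n)) powr D = t_cutoff L s n / (4 * log 2 (real n))"
          using l0 by (simp add: t_cutoff_def K_def D_def)
        also have "\<dots> \<le> b / (4 * log 2 (real n))" using True l0 by (intro divide_right_mono) auto
        also have "\<dots> \<le> 2 ^ j_B n b" using j_B_bounds(2)[OF l] by simp
        also have "\<dots> \<le> 2 ^ p" using jB by (intro power_increasing) auto
        finally have "K * (real n / log 2 (real n)) powr D \<le> 2 ^ p" .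
        moreover have "0 < K * (real n / log 2 (real n)) powr D"
          using divide_pos_pos[OF n0 l0] by (intro mult_pos_pos K0) (simp only: powr_gt_zero)
        ultimately have "ln (K * (real n / log 2 (real n)) powr D) \<le> ln (2 ^ p)"
          by (rule ln_mono)
        then have "ln K + D * (\<nu> - \<Lambda>) \<le> P"
          using K0 n0 l0' by (simp add: ln_mult ln_powr ln_div ln_realpow \<nu>_def \<Lambda>_def P_def)
        then have "s * (ln K + D * (\<nu> - \<Lambda>)) \<le> s * P" using s by (intro mult_left_mono) auto
        then have "- (s * P) \<le> - s * ln K + - (s * D) * (\<nu> - \<Lambda>)" by (simp add: algebra_simps)
        then have "exp (- (s * P)) \<le> exp (- s * ln K) * X" unfolding X by (simp add: exp_add[symmetric])
        also have "exp (- s * ln K) = K powr (- s)" using K0 by (simp add: powr_def)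
        also have "X = rate L s n b" using True by (simp add: X_def rate_def)
        finally show ?thesis unfolding lhs[symmetric] using C00 by (intro weaken[of "K powr (- s)"]) auto
      next
        case False
        have R: "rate L s n b = exp (h * ((2 + 4 * s) * D * \<Lambda> + \<nu> * D - \<beta>) - s * D * (\<nu> - \<Lambda>))"
          using rate_below_cutoff[OF s l, of L] False by (simp add: D_def h_def \<nu>_def \<Lambda>_def \<beta>_def)
        have "ln (real n * b / 64) \<le> ln ((log 2 (real n)) ^ 3 * 2 powr (real p * (2 + 2 * s)))"
          using n0 l0 b0 nb by (subst ln_le_cancel_iff) auto
        then have "\<nu> + \<beta> - ln 64 \<le> 3 * \<Lambda> + P * (2 + 2 * s)"
          using n0 l0 b0 by (simp add: ln_div ln_mult ln_powr ln_realpow \<nu>_def \<Lambda>_def \<beta>_def P_def mult_ac)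
        then have "h * (\<nu> + \<beta> - ln 64 - 3 * \<Lambda>) \<le> h * (P * (2 + 2 * s))"
          using h by (intro mult_left_mono) auto
        also have "\<dots> = ((2 + 2 * s) * h) * P" by (simp add: mult_ac)
        also have "\<dots> = s * P" by (simp only: h(1))
        finally have 1: "- (s * P) \<le> h * (ln 64 + 3 * \<Lambda> - \<nu> - \<beta>)" by (simp add: algebra_simps)
        \<comment> \<open>The exponent comparison behind the factor M_n: after using
          \<open>(1 + 2 * s) * D = 1\<close> the right-hand side exceeds the left by D
          \<Lambda>.\<close>
        have "3 * \<Lambda> - \<nu> \<le> ((2 + 4 * s) * D * \<Lambda> + \<nu> * D) - (2 + 2 * s) * D * (\<nu> - \<Lambda>)"
        proof -
          have "((2 + 4 * s) * D * \<Lambda> + \<nu> * D) - (2 + 2 * s) * D * (\<nu> - \<Lambda>)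
              = 3 * ((1 + 2 * s) * D) * \<Lambda> + D * \<Lambda> - ((1 + 2 * s) * D) * \<nu>"
            by (simp add: algebra_simps)
          also have "\<dots> = 3 * \<Lambda> + D * \<Lambda> - \<nu>" by (simp only: D(1) mult_1_right mult_1_left)
          finally show ?thesis using D(2) \<Lambda>0 by simp
        qed
        then have "h * (3 * \<Lambda> - \<nu>) \<le> h * (((2 + 4 * s) * D * \<Lambda> + \<nu> * D) - (2 + 2 * s) * D * (\<nu> - \<Lambda>))"
          using h by (intro mult_left_mono) auto
        also have "\<dots> = h * ((2 + 4 * s) * D * \<Lambda> + \<nu> * D) - ((2 + 2 * s) * h) * D * (\<nu> - \<Lambda>)"
          by (simp add: algebra_simps)
        also have "\<dots> = h * ((2 + 4 * s) * D * \<Lambda> + \<nu> * D) - s * D * (\<nu> - \<Lambda>)" by (simp only: h(1))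
        finally have "- (s * P) \<le> h * ln 64 + (h * ((2 + 4 * s) * D * \<Lambda> + \<nu> * D - \<beta>) - s * D * (\<nu> - \<Lambda>))"
          using 1 by (simp add: algebra_simps)
        then have "exp (- (s * P)) \<le> exp (h * ln 64) * rate L s n b" unfolding R by (simp add: exp_add[symmetric])
        also have "\<dots> \<le> 64 * rate L s n b"
        proof (rule mult_right_mono[OF _ R0])
          have "h * ln 64 \<le> 1 * ln (64::real)" using h by (intro mult_right_mono) auto
          then have "exp (h * ln 64) \<le> exp (ln (64::real))" by (subst exp_le_cancel_iff) simp
          then show "exp (h * ln 64) \<le> (64::real)" by simp
        qed
        finally show ?thesis unfolding lhs[symmetric] using C00 by (intro weaken[of 64]) auto
      qed
    qed
  qed
  moreover have "1 \<le> 3 * C0 + 64 + K powr (- s)" using C00 powr_ge_zero[of K "- s"] by linarith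
  ultimately show ?thesis by (intro exI[of _ "3 * C0 + 64 + K powr (- s)"]) blast
qed

lemma inverse_sqrt_le_minimax_rate:
  assumes "0 < s" "1 \<le> log 2 (real n)"
  shows "1 / sqrt (real n) \<le> (real n / log 2 (real n)) powr (- (s / (1 + 2 * s)))"
proof -
  define a where "a = s / (1 + 2 * s)"
  have a: "0 < a" "a \<le> 1 / 2" using assms(1) by (auto simp: a_def divide_simps)
  have n0: "0 < real n" using log_ge_one_pos assms(2) by auto
  have n1: "1 \<le> real n" using n0 by simp
  have "1 / sqrt (real n) = real n powr (- (1 / 2))"
    by (subst powr_minus, subst powr_half_sqrt) (simp_all add: inverse_eq_divide)
  also have "\<dots> \<le> real n powr (- a)" using a n1 by (intro powr_mono) auto
  also have "\<dots> \<le> (real n / log 2 (real n)) powr (- a)"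
    using a n0 assms(2) by (intro powr_mono2') (auto simp: divide_le_eq)
  finally show ?thesis unfolding a_def .
qed

text \<open>The noise grows like the powers of sqrt 2, so its sum is dominated by the top level.
  With q = sqrt 2 the series contributes q + 1 = 1 / (q - 1) and the almost monotone sample sizes
  contribute q; the product 2 + sqrt 2 is below 4.\<close>

lemma geometric_noise_sum:
  fixes N :: "nat \<Rightarrow> real"
  assumes "0 \<le> \<Lambda>" "0 < N l" and N: "\<And>i. i < l \<Longrightarrow> N l \<le> 2 * N i" and I: "I \<subseteq> {..<l}"
  shows "(\<Sum>i\<in>I. 2 powr (real i / 2) * sqrt (\<Lambda> / N i)) \<le> 4 * sqrt (\<Lambda> * 2 ^ l / N l)"
proof -
  define q where "q = sqrt (2::real)"
  have q: "1 < q" "q * q = 2" by (auto simp: q_def)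
  have pq: "2 powr (real i / 2) = q ^ i" for i
    unfolding q_def by (simp add: powr_half_sqrt[symmetric] powr_realpow[symmetric] powr_powr)
  have "(\<Sum>i\<in>I. 2 powr (real i / 2) * sqrt (\<Lambda> / N i)) \<le> (\<Sum>i<l. 2 powr (real i / 2) * sqrt (\<Lambda> / N i))"
  proof (rule sum_mono2)
    fix i assume "i \<in> {..<l} - I"
    then have "0 < N i" using N[of i] assms(2) by simp
    then show "0 \<le> 2 powr (real i / 2) * sqrt (\<Lambda> / N i)" using assms(1) by simp
  qed (use I in auto)
  also have "\<dots> \<le> (\<Sum>i<l. q ^ i * (q * sqrt (\<Lambda> / N l)))"
    unfolding pq
  proof (intro sum_mono mult_left_mono)
    fix i assume "i \<in> {..<l}"
    then have "N l \<le> 2 * N i" "0 < N i" using N[of i] assms(2) by auto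
    then have "\<Lambda> / N i \<le> 2 * (\<Lambda> / N l)"
      using assms(1,2) by (simp add: field_simps mult_left_mono)
    then show "sqrt (\<Lambda> / N i) \<le> q * sqrt (\<Lambda> / N l)"
      unfolding q_def by (simp flip: real_sqrt_mult)
  qed (use q in auto)
  also have "\<dots> = (\<Sum>i<l. q ^ i) * (q * sqrt (\<Lambda> / N l))" by (simp add: sum_distrib_right)
  also have "\<dots> \<le> (q ^ l * (q + 1)) * (q * sqrt (\<Lambda> / N l))"
  proof (rule mult_right_mono)
    have "(\<Sum>i<l. q ^ i) = (q ^ l - 1) / (q - 1)" using q by (simp add: geometric_sum)
    also have "1 / (q - 1) = q + 1" using q by (simp add: field_simps)
    then have "(q ^ l - 1) / (q - 1) = (q ^ l - 1) * (q + 1)" by (metis divide_inverse inverse_eq_divide)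
    also have "\<dots> \<le> q ^ l * (q + 1)" using q by (intro mult_right_mono) auto
    finally show "(\<Sum>i<l. q ^ i) \<le> q ^ l * (q + 1)" .
  qed (use q assms in auto)
  also have "\<dots> = ((q + 1) * q) * (q ^ l * sqrt (\<Lambda> / N l))" by (simp add: mult_ac)
  also have "\<dots> \<le> 4 * (q ^ l * sqrt (\<Lambda> / N l))"
  proof (rule mult_right_mono)
    have "q \<le> 2" unfolding q_def by (rule real_le_lsqrt) auto
    then show "(q + 1) * q \<le> 4" using q(2) by (simp add: algebra_simps)
  qed (use q assms in auto)
  also have "q ^ l * sqrt (\<Lambda> / N l) = sqrt (\<Lambda> * 2 ^ l / N l)"
    unfolding q_def by (simp add: real_sqrt_power[symmetric] real_sqrt_mult[symmetric] mult.commute)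
  finally show ?thesis .
qed

section \<open>Selection of the level\<close>

lemma sup_norm_01_le:
  assumes "f \<in> borel_measurable borel" "AE x in restrict_space lborel {0..1}. \<bar>f x\<bar> \<le> c"
  shows "sup_norm_01 f \<le> ennreal c"
  unfolding sup_norm_01_def
proof (rule esssup_I)
  show "(\<lambda>x. ennreal \<bar>f x\<bar>) \<in> borel_measurable (restrict_space lborel {0..1})"
    using assms(1) by (intro measurable_compose[OF _ measurable_ennreal] borel_measurable_abs measurable_restrict_01)
  show "AE x in restrict_space lborel {0..1}. ennreal \<bar>f x\<bar> \<le> ennreal c"
    using assms(2) by eventually_elim (rule ennreal_leI)
qed

lemma sup_norm_01_AE:
  assumes "sup_norm_01 f \<le> ennreal c" "0 \<le> c"
  shows "AE x in restrict_space lborel {0..1}. \<bar>f x\<bar> \<le> c"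
  using esssup_AE[of "\<lambda>x. ennreal \<bar>f x\<bar>" "restrict_space lborel {0..1}"]
proof eventually_elim
  case (elim x)
  then have "ennreal \<bar>f x\<bar> \<le> ennreal c" using assms(1) unfolding sup_norm_01_def by (rule order_trans)
  then show ?case using assms(2) by simp
qed

lemma powr_square: "(2 powr (- x))\<^sup>2 = 2 powr (- (2 * x))" for x :: real
  by (simp add: power2_eq_square powr_add[symmetric])

definition coef_event ::
  "(nat \<Rightarrow> nat \<Rightarrow> real \<Rightarrow> real) \<Rightarrow> ereal \<Rightarrow> nat \<Rightarrow> nat \<Rightarrow> real \<Rightarrow> (real \<Rightarrow> real) \<Rightarrow> real
    \<Rightarrow> (nat \<Rightarrow> nat \<Rightarrow> real \<times> real) \<Rightarrow> bool" where
  "coef_event \<psi> S n m b f \<kappa> d \<longleftrightarrow> (\<forall>j < j_max S n b. \<forall>k < 2 ^ j.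
     \<bar>agg_coef \<psi> S n m b d j k - inner_01 f (\<psi> j k)\<bar> \<le> \<kappa> * sqrt (log 2 (real n) / n_eff S n m b j))"

lemma wavelet_sum_diff:
  "wavelet_sum \<psi> a I x - wavelet_sum \<psi> c I x = wavelet_sum \<psi> (\<lambda>l k. a l k - c l k) I x"
  by (simp add: wavelet_sum_def left_diff_distrib sum_subtractf)

lemma wavelet_sum_split:
  assumes "j \<le> l"
  shows "wavelet_sum \<psi> a {..<l} x = wavelet_sum \<psi> a {..<j} x + wavelet_sum \<psi> a {j..<l} x"
proof -
  have "{..<l} = {..<j} \<union> {j..<l}" "{..<j} \<inter> {j..<l} = {}" using assms by auto
  then show ?thesis unfolding wavelet_sum_def by (simp add: sum.union_disjoint)
qed

lemma noise_bound:
  assumes \<psi>: "\<And>j x. (\<Sum>k<2 ^ j. \<bar>\<psi> j k x\<bar>) \<le> C * 2 powr (real j / 2)" "1 \<le> C"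
    and ev: "coef_event \<psi> S n m b f \<kappa> d" and "0 \<le> \<kappa>" and fh: "first_half m \<noteq> {}"
    and l: "l \<le> j_max S n b" "0 < n_eff S n m b l" and I: "I \<subseteq> {..<l}" and n: "0 \<le> log 2 (real n)"
  shows "\<bar>wavelet_sum \<psi> (\<lambda>i k. agg_coef \<psi> S n m b d i k - inner_01 f (\<psi> i k)) I x\<bar>
     \<le> 4 * C * \<kappa> * sqrt (log 2 (real n) * 2 ^ l / n_eff S n m b l)"
proof -
  let ?N = "n_eff S n m b"
  have "\<bar>wavelet_sum \<psi> (\<lambda>i k. agg_coef \<psi> S n m b d i k - inner_01 f (\<psi> i k)) I x\<bar>
      \<le> (\<Sum>i\<in>I. C * 2 powr (real i / 2) * (\<kappa> * sqrt (log 2 (real n) / ?N i)))"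
    using ev l(1) I by (intro wavelet_sum_bound \<psi>) (auto simp: coef_event_def)
  also have "\<dots> = (C * \<kappa>) * (\<Sum>i\<in>I. 2 powr (real i / 2) * sqrt (log 2 (real n) / ?N i))"
    unfolding sum_distrib_left by (intro sum.cong refl) (simp only: mult_ac)
  also have "\<dots> \<le> (C * \<kappa>) * (4 * sqrt (log 2 (real n) * 2 ^ l / ?N l))"
    using \<psi>(2) \<open>0 \<le> \<kappa>\<close> n_eff_almost_antimono[OF fh] I n l(2)
    by (intro mult_left_mono geometric_noise_sum) auto
  finally show ?thesis by (simp only: mult_ac)
qed

text \<open>On the event, the level before the balance level passes all comparisons, so the selected level
  is not above it; if it is below, the comparison with this level bounds the distance.\<close>

lemma oracle_inequality:
  fixes L r s \<kappa> c0 \<tau> s1 :: real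
  assumes basis: "orthonormal_basis_01 \<psi>"
    and \<psi>: "\<And>j x. (\<Sum>k<2 ^ j. \<bar>\<psi> j k x\<bar>) \<le> C * 2 powr (real j / 2)" "1 \<le> C"
    and f: "f \<in> besov_ball \<psi> s L" "0 < L" and r: "0 < r" "r \<le> s" "s \<le> s1"
    and l: "1 \<le> log 2 (real n)" "log 2 (real n) \<le> b"
    and m: "first_half m \<noteq> {}" "\<forall>t < n_groups (ereal r) n b. 1 \<le> subgroup_size (ereal r) n m b t"
    and ev: "coef_event \<psi> (ereal r) n m b f \<kappa> d" "0 \<le> \<kappa>"
    and c0: "0 < c0" "c0 * log 2 (real n) \<le> real (balance_level (ereal r) n m b s) - 1"
    and \<tau>: "4 * C * \<kappa> + 2 * 2 powr s1 * tail_const C L r \<le> \<tau> * sqrt c0"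
  shows "sup_norm_01 (\<lambda>x. f_hat \<psi> (ereal r) n m b \<tau> d x - f x)
    \<le> ennreal ((2 * \<tau> + 4 * C * \<kappa> + tail_const C L r) * 2 powr s *
        2 powr (- (real (balance_level (ereal r) n m b s) * s)))"
proof -
  let ?S = "ereal r"
  let ?M = "restrict_space lborel {0..1::real}"
  define \<Lambda> where "\<Lambda> = log 2 (real n)"
  define J where "J = j_max ?S n b"
  define p where "p = balance_level ?S n m b s"
  define N where "N = n_eff ?S n m b"
  define A where "A = tail_const C L r"
  define a where "a l k = inner_01 f (\<psi> l k)" for l k
  define agg where "agg = agg_coef \<psi> ?S n m b d"
  define u where "u l = sqrt (\<Lambda> * 2 ^ l / N l)" for l
  define js where "js = p - 1"
  define W where "W = 2 powr (- (real js * s))"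
  define jh where "jh = j_hat \<psi> ?S n m b \<tau> d"
  have m0: "0 < m" using first_half_nonempty[OF m(1)] by simp
  have n0: "0 < n" using log_ge_one_pos l(1) by blast
  have s0: "0 < s" using r by simp
  have \<Lambda>1: "1 \<le> \<Lambda>" using l by (simp add: \<Lambda>_def)
  have c0\<Lambda>: "0 < c0 * \<Lambda>" using c0 \<Lambda>1 by simp
  \<comment> \<open>Hence the subtraction in \<open>js = p - 1\<close> is not truncated.\<close>
  then have p2: "1 < real p" using c0(2) by (simp add: p_def \<Lambda>_def)
  then have js: "real js = real p - 1" "js < p" by (auto simp: js_def)
  have js0: "c0 * \<Lambda> \<le> real js" using c0(2) js by (simp add: p_def \<Lambda>_def)
  have bal: "N p \<le> \<Lambda> * 2 powr (real p * (1 + 2 * s))" and pJ: "p \<le> J"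
    and nbal: "\<Lambda> * 2 powr (real js * (1 + 2 * s)) < N js"
    using balance_level_props[OF r(1,2) l m0] js(2)
    by (auto simp: N_def \<Lambda>_def p_def J_def balanced_def not_le)
  have JL: "real J \<le> \<Lambda> + 1" unfolding J_def \<Lambda>_def using l by (intro j_max_bounds r) auto
  have Npos: "0 < N i" if "i < J" for i
    using n_eff_pos[OF n0 m] that by (simp add: N_def J_def)
  have A0: "0 \<le> A" and CA: "tail_const C L s \<le> A"
    unfolding A_def using r \<psi>(2) f(2) by (auto intro: tail_const_nonneg tail_const_antimono)
  have W0: "0 \<le> W" by (simp add: W_def)
  have u0: "0 \<le> u i" for i unfolding u_def using \<Lambda>1 n_eff_nonneg[of ?S n m b i] by (simp add: N_def)
  have Wp: "W = 2 powr s * 2 powr (- (real p * s))"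
    unfolding W_def js(1) by (simp add: powr_add[symmetric] algebra_simps)
  have \<tau>0: "0 \<le> \<tau>"
  proof -
    have "0 \<le> 4 * C * \<kappa> + 2 * 2 powr s1 * A" using A0 \<psi>(2) ev(2) by simp
    then have "0 \<le> \<tau> * sqrt c0" using \<tau> by (simp add: A_def)
    then show ?thesis using c0(1) by (simp add: zero_le_mult_iff)
  qed
  have tail: "\<bar>wavelet_sum \<psi> a {js..<K} x\<bar> \<le> A * W" for K x
  proof -
    have "\<bar>wavelet_sum \<psi> a {js..<K} x\<bar> \<le> tail_const C L s * W"
      unfolding a_def W_def by (rule besov_tail_sum[OF \<psi> f(1) s0 f(2)])
    also have "\<dots> \<le> A * W" using CA W0 by (rule mult_right_mono)
    finally show ?thesis .
  qed
  have noise: "\<bar>wavelet_sum \<psi> (\<lambda>i k. agg i k - a i k) I x\<bar> \<le> 4 * C * \<kappa> * u l"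
    if "l \<le> J" "0 < N l" "I \<subseteq> {..<l}" for I l x
    unfolding agg_def a_def u_def N_def \<Lambda>_def
    using that \<Lambda>1 by (intro noise_bound[OF \<psi> ev m(1)]) (auto simp: J_def N_def \<Lambda>_def)
  have ft: "f_tilde \<psi> ?S n m b d j = wavelet_sum \<psi> agg {..<j}" for j
    by (simp add: f_tilde_eq_wavelet_sum agg_def)
  have meas: "wavelet_sum \<psi> c I \<in> borel_measurable borel" for c I
    using wavelet_sum_L2[OF basis, of c I] by (simp add: L2_01_iff)
  \<comment> \<open>From the balance level on, noise dominates bias. Balance is known at p only; it
    passes to higher l through the almost monotone sample sizes, whose factor 2 is enlarged to 4 to
    have a rational square root.\<close>
  have Wu: "2 powr (- (real p * s)) \<le> 2 * u l" if "p \<le> l" "0 < N l" for l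
  proof -
    have "N l \<le> 2 * N p" using n_eff_almost_antimono[OF m(1) that(1)] by (simp add: N_def)
    also have "\<dots> \<le> 2 * (\<Lambda> * (2 ^ p * 2 powr (2 * (real p * s))))"
      using bal by (simp add: powr_realpow[symmetric] powr_add[symmetric] algebra_simps)
    also have "\<dots> \<le> 2 * (\<Lambda> * (2 ^ l * 2 powr (2 * (real p * s))))"
      using \<Lambda>1 that(1) by (intro mult_left_mono mult_right_mono power_increasing) auto
    finally have "N l * 2 powr (- (2 * (real p * s))) \<le> 2 * (\<Lambda> * (2 ^ l * 2 powr (2 * (real p * s)))) * 2 powr (- (2 * (real p * s)))"
      by (rule mult_right_mono) simp
    also have "\<dots> = 2 * (\<Lambda> * 2 ^ l) * (2 powr (2 * (real p * s)) * 2 powr (- (2 * (real p * s))))"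
      by (simp only: mult_ac)
    also have "\<dots> = 2 * (\<Lambda> * 2 ^ l)" by (simp add: powr_add[symmetric])
    finally have "2 powr (- (2 * (real p * s))) \<le> 2 * (\<Lambda> * 2 ^ l / N l)"
      using that(2) by (simp add: field_simps)
    also have "\<dots> \<le> 4 * (\<Lambda> * 2 ^ l / N l)" using that(2) \<Lambda>1 by (intro mult_right_mono) auto
    finally have "(2 powr (- (real p * s)))\<^sup>2 \<le> 4 * (\<Lambda> * 2 ^ l / N l)"
      unfolding powr_square .
    then have "2 powr (- (real p * s)) \<le> sqrt (4 * (\<Lambda> * 2 ^ l / N l))" by (rule real_le_rsqrt)
    then show ?thesis unfolding u_def by (simp only: real_sqrt_mult real_sqrt_four)
  qed
  have jsJ: "js \<le> J" "js < J" using js(2) pJ by auto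
  have selected: "sup_norm_01 (\<lambda>x. f_tilde \<psi> ?S n m b d js x - f_tilde \<psi> ?S n m b d l x) \<le> threshold ?S n m b \<tau> l"
    if "l \<le> J" "js < l" for l
  proof (cases "N l = 0")
    \<comment> \<open>Only possible at the untransmitted level \<open>j_max\<close>; the threshold
      is infinite there and the comparison is passed.\<close>
    case True
    then show ?thesis by (simp add: threshold_def N_def)
  next
    case False
    then have Nl: "0 < N l" using n_eff_nonneg[of ?S n m b l] by (simp add: N_def)
    have pl: "p \<le> l" using that(2) by (simp add: js_def)
    have "\<bar>f_tilde \<psi> ?S n m b d js x - f_tilde \<psi> ?S n m b d l x\<bar> \<le> \<tau> * sqrt (real l * 2 ^ l / N l)" for x
    proof -
      have nz: "\<bar>wavelet_sum \<psi> (\<lambda>i k. agg i k - a i k) {js..<l} x\<bar> \<le> 4 * C * \<kappa> * u l"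
        by (rule noise[OF that(1) Nl]) auto
      have "\<bar>f_tilde \<psi> ?S n m b d js x - f_tilde \<psi> ?S n m b d l x\<bar> = \<bar>wavelet_sum \<psi> agg {js..<l} x\<bar>"
        using wavelet_sum_split[of js l \<psi> agg x] that(2) by (simp add: ft)
      also have "wavelet_sum \<psi> agg {js..<l} x = wavelet_sum \<psi> (\<lambda>i k. agg i k - a i k) {js..<l} x + wavelet_sum \<psi> a {js..<l} x"
        by (simp flip: wavelet_sum_diff)
      also have "\<bar>\<dots>\<bar> \<le> 4 * C * \<kappa> * u l + A * W"
        using nz tail[of l x] by linarith
      also have "A * W \<le> A * (2 powr s1 * (2 * u l))"
        unfolding Wp using Wu[OF pl Nl] r(3) A0 by (intro mult_left_mono mult_mono) auto
      also have "4 * C * \<kappa> * u l + A * (2 powr s1 * (2 * u l)) = (4 * C * \<kappa> + 2 * 2 powr s1 * A) * u l"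
        by (simp add: algebra_simps)
      also have "\<dots> \<le> (\<tau> * sqrt c0) * u l" using \<tau> u0 by (intro mult_right_mono) (auto simp: A_def)
      also have "\<dots> = \<tau> * sqrt (c0 * \<Lambda> * 2 ^ l / N l)" unfolding u_def by (simp add: real_sqrt_mult[symmetric] mult.assoc)
      \<comment> \<open>The threshold contains the level number where the noise bound contains
        \<open>log 2 n\<close>; the oracle level being at least \<open>c0 * log 2 n\<close> closes
        this gap.\<close>
      also have "\<dots> \<le> \<tau> * sqrt (real l * 2 ^ l / N l)"
      proof -
        have "c0 * \<Lambda> \<le> real l" using js0 that(2) by simp
        then show ?thesis using \<tau>0 Nl
          by (intro mult_left_mono real_sqrt_le_mono divide_right_mono mult_right_mono) auto
      qed
      finally show ?thesis by simp
    qed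
    then have "sup_norm_01 (\<lambda>x. f_tilde \<psi> ?S n m b d js x - f_tilde \<psi> ?S n m b d l x) \<le> ennreal (\<tau> * sqrt (real l * 2 ^ l / N l))"
      unfolding ft by (intro sup_norm_01_le AE_I2 borel_measurable_diff meas)
    then show ?thesis using False by (simp add: threshold_def N_def)
  qed
  have jh_le: "jh \<le> js"
    unfolding jh_def j_hat_def using selected jsJ by (intro Min_le) (auto simp: J_def)
  \<comment> \<open>The level below the balance level is not balanced, so there the bias dominates
    the noise.\<close>
  have ujs: "u js \<le> W"
  proof -
    have "\<Lambda> * 2 ^ js * 2 powr (2 * (real js * s)) \<le> N js"
      using nbal by (simp add: powr_realpow[symmetric] powr_add[symmetric] mult.assoc algebra_simps)
    then have "\<Lambda> * 2 ^ js * 2 powr (2 * (real js * s)) * 2 powr (- (2 * (real js * s))) \<le> N js * 2 powr (- (2 * (real js * s)))"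
      by (rule mult_right_mono) simp
    then have "\<Lambda> * 2 ^ js \<le> N js * 2 powr (- (2 * (real js * s)))"
      by (simp add: mult.assoc powr_add[symmetric])
    then have "\<Lambda> * 2 ^ js / N js \<le> 2 powr (- (2 * (real js * s)))"
      using Npos[OF jsJ(2)] by (simp add: divide_le_eq mult.commute)
    also have "\<dots> = W\<^sup>2" unfolding W_def powr_square ..
    finally show ?thesis unfolding u_def using W0 by (simp add: real_le_lsqrt)
  qed
  \<comment> \<open>Converse exchange of the level number for \<open>log 2 n\<close>: no level
    exceeds \<open>log 2 n + 1\<close>, and the generous factor 4 has square root 2.\<close>
  have th: "\<tau> * sqrt (real js * 2 ^ js / N js) \<le> 2 * \<tau> * W"
  proof -
    have "real js \<le> real J" using jsJ by simp
    then have "real js \<le> 4 * \<Lambda>" using JL \<Lambda>1 by linarith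
    then have "sqrt (real js * 2 ^ js / N js) \<le> sqrt (4 * \<Lambda> * 2 ^ js / N js)"
      using Npos[OF jsJ(2)] by (intro real_sqrt_le_mono divide_right_mono mult_right_mono) auto
    also have "\<dots> = 2 * u js" unfolding u_def by (simp add: real_sqrt_mult real_sqrt_divide)
    also have "\<dots> \<le> 2 * W" using ujs by simp
    finally have "\<tau> * sqrt (real js * 2 ^ js / N js) \<le> \<tau> * (2 * W)" using \<tau>0 by (rule mult_left_mono)
    then show ?thesis by simp
  qed
  \<comment> \<open>A selected level below the oracle level has itself passed the comparison with
    the oracle level.\<close>
  have first: "AE x in ?M. \<bar>f_tilde \<psi> ?S n m b d jh x - f_tilde \<psi> ?S n m b d js x\<bar> \<le> 2 * \<tau> * W"
  proof (cases "jh = js")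
    case True
    then show ?thesis using \<tau>0 W0 by simp
  next
    case False
    have "sup_norm_01 (\<lambda>x. f_tilde \<psi> ?S n m b d jh x - f_tilde \<psi> ?S n m b d js x) \<le> threshold ?S n m b \<tau> js"
      using j_hat_in_set[of \<psi> ?S n m b \<tau> d] False jh_le jsJ by (auto simp: jh_def J_def)
    also have "\<dots> = ennreal (\<tau> * sqrt (real js * 2 ^ js / N js))"
      using Npos[OF jsJ(2)] by (simp add: threshold_def N_def)
    also have "\<dots> \<le> ennreal (2 * \<tau> * W)" using th by (rule ennreal_leI)
    finally show ?thesis using \<tau>0 W0 by (intro sup_norm_01_AE) auto
  qed
  have second: "AE x in ?M. \<bar>f x - wavelet_sum \<psi> a {..<js} x\<bar> \<le> A * W"
    using besov_approximation[OF basis \<psi> f(1) s0 f(2), of js]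
  proof eventually_elim
    case (elim x)
    also have "tail_const C L s * 2 powr (- (real js * s)) \<le> A * W"
      unfolding W_def[symmetric] using CA W0 by (rule mult_right_mono)
    finally show ?case unfolding a_def .
  qed
  have "AE x in ?M. \<bar>f_hat \<psi> ?S n m b \<tau> d x - f x\<bar> \<le> (2 * \<tau> + 4 * C * \<kappa> + A) * W"
    using first second
  proof eventually_elim
    case (elim x)
    have "\<bar>f_tilde \<psi> ?S n m b d js x - wavelet_sum \<psi> a {..<js} x\<bar> \<le> 4 * C * \<kappa> * u js"
      unfolding ft wavelet_sum_diff by (rule noise[OF jsJ(1) Npos[OF jsJ(2)]]) simp
    also have "\<dots> \<le> 4 * C * \<kappa> * W" using ujs \<psi>(2) ev(2) by (intro mult_left_mono) auto
    finally have "\<bar>f_tilde \<psi> ?S n m b d js x - wavelet_sum \<psi> a {..<js} x\<bar> \<le> 4 * C * \<kappa> * W" .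
    then have "\<bar>f_hat \<psi> ?S n m b \<tau> d x - f x\<bar> \<le> 2 * \<tau> * W + 4 * C * \<kappa> * W + A * W"
      using elim unfolding f_hat_def jh_def[symmetric] by linarith
    then show ?case by (simp add: algebra_simps)
  qed
  moreover have "(\<lambda>x. f_hat \<psi> ?S n m b \<tau> d x - f x) \<in> borel_measurable borel"
    using f_hat_L2_01[OF basis, of ?S n m b \<tau> d] f(1) by (intro borel_measurable_diff) (auto simp: L2_01_iff besov_ball_def)
  ultimately have "sup_norm_01 (\<lambda>x. f_hat \<psi> ?S n m b \<tau> d x - f x) \<le> ennreal ((2 * \<tau> + 4 * C * \<kappa> + A) * W)"
    by (intro sup_norm_01_le)
  then show ?thesis unfolding Wp A_def p_def by (simp add: mult.assoc)
qed

section \<open>The risk of the estimator\<close>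

lemma centered_sum_measurable:
  assumes "\<psi> \<in> borel_measurable borel" "I \<subseteq> {1..m}"
  shows "(\<lambda>d. \<Sum>i\<in>I. \<Sum>l\<in>{1..q}. snd (d i l) * \<psi> (fst (d i l)) - \<mu>) \<in> borel_measurable (data_law \<sigma> m q f)"
proof -
  have "(\<lambda>z. snd z * \<psi> (fst z) - \<mu>) \<in> borel_measurable (borel \<Otimes>\<^sub>M borel)" using assms(1) by measurable
  from measurable_compose[OF measurable_data_coord this]
  show ?thesis using assms(2) by (intro borel_measurable_sum) blast
qed

text \<open>Averaging over the senders does not increase the rounding error of the individual
  transmissions; the rest is the centred sum of all their observations divided by the effective
  sample size.\<close>

lemma agg_coef_error:
  assumes n: "0 < n" "m dvd n" and I: "senders S n m b j k \<noteq> {}" "finite (senders S n m b j k)"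
    and x: "\<bar>\<Sum>i\<in>senders S n m b j k. \<Sum>l\<in>{1..n div m}. snd (d i l) * \<psi> j k (fst (d i l)) - \<mu>\<bar>
       < n_eff S n m b j * x"
  shows "\<bar>agg_coef \<psi> S n m b d j k - \<mu>\<bar> \<le> x + 2 / sqrt (real n)"
proof -
  define T where "T = senders S n m b j k"
  define c where "c = real (card T)"
  define loc where "loc i = local_coef \<psi> n m (d i) j k" for i
  have m0: "0 < m" using n by (cases m) auto
  have c0: "0 < c" using I by (simp add: c_def T_def card_gt_0_iff)
  have N: "n_eff S n m b j = c * (real n / real m)" by (simp add: n_eff_eq_card[of S n m b j k] c_def T_def)
  have N0: "0 < n_eff S n m b j" using c0 n m0 by (simp add: N)
  have q: "real (n div m) = real n / real m" using n by (simp add: real_of_nat_div)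
  have "(\<Sum>l\<in>{1..n div m}. snd (d i l) * \<psi> j k (fst (d i l)) - \<mu>) = real n / real m * (loc i - \<mu>)" for i
    using n m0 by (simp add: sum_subtractf loc_def local_coef_def q right_diff_distrib)
  then have "(\<Sum>i\<in>T. \<Sum>l\<in>{1..n div m}. snd (d i l) * \<psi> j k (fst (d i l)) - \<mu>)
      = real n / real m * ((\<Sum>i\<in>T. loc i) - c * \<mu>)"
    by (simp only: sum_distrib_left[symmetric] sum_subtractf sum_constant c_def)
  also have "\<dots> = n_eff S n m b j * ((\<Sum>i\<in>T. loc i) / c - \<mu>)"
  proof -
    have "(\<Sum>i\<in>T. loc i) - c * \<mu> = c * ((\<Sum>i\<in>T. loc i) / c - \<mu>)" using c0 by (simp add: right_diff_distrib)
    then show ?thesis by (simp only: N mult_ac)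
  qed
  finally have "n_eff S n m b j * \<bar>(\<Sum>i\<in>T. loc i) / c - \<mu>\<bar> < n_eff S n m b j * x"
    using x N0 by (simp add: T_def abs_mult)
  then have 1: "\<bar>(\<Sum>i\<in>T. loc i) / c - \<mu>\<bar> < x" using N0 by simp
  have "\<bar>(\<Sum>i\<in>T. trans_approx n (loc i) - loc i)\<bar> \<le> (\<Sum>i\<in>T. 2 / sqrt (real n))"
    using n by (intro order_trans[OF sum_abs] sum_mono trans_approx_error) auto
  also have "\<dots> = c * (2 / sqrt (real n))" by (simp add: c_def)
  finally have "\<bar>(\<Sum>i\<in>T. trans_approx n (loc i) - loc i) / c\<bar> \<le> 2 / sqrt (real n)"
    using c0 by (simp add: abs_divide divide_le_eq mult.commute)
  moreover have "agg_coef \<psi> S n m b d j k = (\<Sum>i\<in>T. trans_approx n (loc i) - loc i) / c + (\<Sum>i\<in>T. loc i) / c"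
    by (simp add: agg_coef_def T_def c_def loc_def sum_subtractf diff_divide_distrib)
  ultimately show ?thesis using 1 by linarith
qed

text \<open>A union bound over fewer than \<open>2 ^ j_max\<close> coefficients. The deviation at
  level j is chosen so that its square times the sample size is
  \<open>\<kappa>\<^sup>2 * log 2 n\<close> at every level, which makes all tail bounds equal. The
  last hypothesis keeps these deviations in the range of the exponential inequality.\<close>

lemma coef_event_prob:
  assumes basis: "orthonormal_basis_01 \<psi>"
    and \<psi>: "\<And>j x. (\<Sum>k<2 ^ j. \<bar>\<psi> j k x\<bar>) \<le> C * 2 powr (real j / 2)"
    and f: "f \<in> L2_01" "AE t in restrict_space lborel {0..1}. \<bar>f t\<bar> \<le> F"
    and n: "m dvd n" "1 \<le> log 2 (real n)"
    and m: "first_half m \<noteq> {}" "\<forall>t < n_groups S n b. 1 \<le> subgroup_size S n m b t"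
    and \<kappa>: "0 < \<kappa>" and small: "\<And>j. j < j_max S n b \<Longrightarrow>
        \<kappa> * C * sqrt (log 2 (real n) * 2 ^ j / n_eff S n m b j) \<le> 2 * mgf_const \<sigma> F"
  shows "\<exists>E\<in>sets (data_law \<sigma> m (n div m) f).
     emeasure (data_law \<sigma> m (n div m) f) E
       \<le> ennreal (2 ^ j_max S n b * (2 * exp (- (\<kappa>\<^sup>2 * log 2 (real n) / (4 * mgf_const \<sigma> F))))) \<and>
     (\<forall>d\<in>space (data_law \<sigma> m (n div m) f) - E. coef_event \<psi> S n m b f (\<kappa> + 2) d)"
proof -
  let ?D = "data_law \<sigma> m (n div m) f"
  define \<Lambda> where "\<Lambda> = log 2 (real n)"
  define V where "V = mgf_const \<sigma> F"
  define N where "N = n_eff S n m b"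
  define J where "J = j_max S n b"
  define T where "T = senders S n m b"
  define x where "x j = \<kappa> * sqrt (\<Lambda> / N j)" for j
  define Z where "Z j k d = (\<Sum>i\<in>T j k. \<Sum>l\<in>{1..n div m}. snd (d i l) * \<psi> j k (fst (d i l)) - inner_01 f (\<psi> j k))"
    for j k and d :: "nat \<Rightarrow> nat \<Rightarrow> real \<times> real"
  define B where "B p = {d \<in> space ?D. N (fst p) * x (fst p) \<le> \<bar>Z (fst p) (snd p) d\<bar>}" for p :: "nat \<times> nat"
  define P where "P = (SIGMA j:{..<J}. {..<2 ^ j::nat})"
  define e where "e = 2 * exp (- (\<kappa>\<^sup>2 * \<Lambda> / (4 * V)))"
  have n0: "0 < n" using log_ge_one_pos n(2) by blast
  have m0: "0 < m" using first_half_nonempty[OF m(1)] by simp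
  have \<Lambda>: "1 \<le> \<Lambda>" using n(2) by (simp add: \<Lambda>_def)
  have V: "1 \<le> V" by (simp add: V_def mgf_const_def)
  have Npos: "0 < N j" if "j < J" for j using n_eff_pos[OF n0 m] that by (simp add: N_def J_def)
  have Tsub: "T j k \<subseteq> {1..m}" if "j < J" "k < 2 ^ j" for j k
    using senders_subset[of j S n b k m] that by (simp add: T_def J_def)
  have Ncard: "N j = real (card (T j k) * (n div m))" for j k
    using n(1) by (simp add: N_def T_def n_eff_eq_card[of S n m b j k] real_of_nat_div)
  have Bsets: "B p \<in> sets ?D" if "p \<in> P" for p
  proof -
    have "\<psi> (fst p) (snd p) \<in> borel_measurable borel"
      using basis_L2[OF basis, of "snd p" "fst p"] that by (auto simp: P_def L2_01_iff)
    then have "(\<lambda>d. \<bar>Z (fst p) (snd p) d\<bar>) \<in> borel_measurable ?D"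
      unfolding Z_def using that by (intro borel_measurable_abs centered_sum_measurable Tsub) (auto simp: P_def)
    then show ?thesis unfolding B_def by (rule borel_measurable_le[OF borel_measurable_const])
  qed
  have Bprob: "emeasure ?D (B p) \<le> ennreal e" if "p \<in> P" for p
  proof -
    obtain j k where p: "p = (j, k)" "j < J" "k < 2 ^ j"
      using \<open>p \<in> P\<close> by (auto simp: P_def)
    have xN: "N j * (x j)\<^sup>2 = \<kappa>\<^sup>2 * \<Lambda>"
      using Npos[OF p(2)] \<Lambda> by (simp add: x_def power_mult_distrib)
    have bound: "\<bar>\<psi> j k t\<bar> \<le> C * 2 powr (real j / 2)" for t by (rule level_sum_imp_single[where \<psi> = \<psi>, OF \<psi> p(3)])
    have "x j * (C * 2 powr (real j / 2)) = \<kappa> * C * sqrt (\<Lambda> * 2 ^ j / N j)"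
    proof -
      have "2 powr (real j / 2) = sqrt (2 ^ j)"
        by (simp add: powr_half_sqrt[symmetric] powr_realpow[symmetric] powr_powr)
      then show ?thesis by (simp add: x_def real_sqrt_mult real_sqrt_divide)
    qed
    also have "\<dots> \<le> 2 * mgf_const \<sigma> F"
      using small[of j] p(2) by (simp add: \<Lambda>_def N_def J_def)
    finally have xc: "x j * (C * 2 powr (real j / 2)) \<le> 2 * mgf_const \<sigma> F" .
    have "emeasure ?D (B p)
        \<le> ennreal (2 * exp (- (real (card (T j k) * (n div m)) * (x j)\<^sup>2 / (4 * mgf_const \<sigma> F))))"
      unfolding B_def p fst_conv snd_conv Z_def Ncard[of j k]
    proof (rule data_law_average_tail[OF f _ _ bound _ xc Tsub[OF p(2,3)]])
      show "\<psi> j k \<in> L2_01" "inner_01 (\<psi> j k) (\<psi> j k) = 1"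
        using p(3) by (auto simp: basis_L2[OF basis] basis_orth[OF basis])
      show "0 < x j" using \<kappa> \<Lambda> Npos[OF p(2)] by (simp add: x_def)
    qed
    then show ?thesis unfolding Ncard[symmetric] xN e_def V_def .
  qed
  define E where "E = (\<Union>p\<in>P. B p)"
  have finP: "finite P" by (simp add: P_def)
  have Es: "E \<in> sets ?D" unfolding E_def using finP Bsets by (intro sets.finite_UN) auto
  have "emeasure ?D E \<le> (\<Sum>p\<in>P. emeasure ?D (B p))"
    unfolding E_def using finP Bsets by (intro emeasure_subadditive_finite) auto
  also have "\<dots> \<le> (\<Sum>p\<in>P. ennreal e)" by (intro sum_mono Bprob)
  also have "\<dots> = ennreal (real (card P) * e)"
    by (simp add: ennreal_of_nat_eq_real_of_nat ennreal_mult' e_def)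
  also have "\<dots> \<le> ennreal (2 ^ J * e)"
  proof (intro ennreal_leI mult_right_mono)
    have "card P \<le> 2 ^ J" by (simp add: P_def sum_powers_two)
    then have "real (card P) \<le> real (2 ^ J)" by (rule of_nat_mono)
    then show "real (card P) \<le> 2 ^ J" by simp
  qed (simp add: e_def)
  finally have Ee: "emeasure ?D E \<le> ennreal (2 ^ J * e)" .
  have "coef_event \<psi> S n m b f (\<kappa> + 2) d" if d: "d \<in> space ?D - E" for d
    unfolding coef_event_def
  proof (intro allI impI)
    fix j k :: nat assume "j < j_max S n b" and k: "k < 2 ^ j"
    then have j: "j < J" by (simp add: J_def)
    have "d \<notin> B (j, k)" using d j k by (auto simp: E_def P_def)
    then have "\<bar>Z j k d\<bar> < N j * x j" using d by (auto simp: B_def)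
    moreover have "T j k \<noteq> {}" using Npos[OF j] Ncard[of j k] by auto
    moreover have "finite (T j k)" using Tsub[OF j k] finite_subset by blast
    ultimately have "\<bar>agg_coef \<psi> S n m b d j k - inner_01 f (\<psi> j k)\<bar> \<le> x j + 2 / sqrt (real n)"
      using n0 n(1) unfolding Z_def T_def N_def by (intro agg_coef_error) auto
    \<comment> \<open>The rounding error is of parametric order and so never exceeds the noise
      scale; it is the 2 in \<open>\<kappa> + 2\<close>.\<close>
    also have "2 / sqrt (real n) \<le> 2 * sqrt (\<Lambda> / N j)"
    proof -
      have "1 / real n \<le> \<Lambda> / N j"
        using \<Lambda> Npos[OF j] n_eff_le[of S n m b j] n0 by (intro frac_le) (auto simp: N_def)
      then have "sqrt (1 / real n) \<le> sqrt (\<Lambda> / N j)" by (rule real_sqrt_le_mono)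
      then show ?thesis by (simp add: real_sqrt_divide)
    qed
    also have "x j + 2 * sqrt (\<Lambda> / N j) = (\<kappa> + 2) * sqrt (\<Lambda> / N j)" by (simp add: x_def algebra_simps)
    finally show "\<bar>agg_coef \<psi> S n m b d j k - inner_01 f (\<psi> j k)\<bar> \<le> (\<kappa> + 2) * sqrt (log 2 (real n) / n_eff S n m b j)"
      by (simp add: \<Lambda>_def N_def)
  qed
  then show ?thesis using Es Ee by (intro bexI[of _ E]) (auto simp: J_def e_def \<Lambda>_def V_def)
qed

text \<open>Holds for every data set, whatever level is selected. One factor
  \<open>2 powr (j / 2)\<close> comes from the local coefficients and one from the wavelets, which
  gives \<open>2 ^ j_max\<close> after summation.\<close>

lemma crude_bound:
  assumes basis: "orthonormal_basis_01 \<psi>"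
    and \<psi>: "\<And>j x. (\<Sum>k<2 ^ j. \<bar>\<psi> j k x\<bar>) \<le> C * 2 powr (real j / 2)" and "1 \<le> C"
    and f: "f \<in> L2_01" "AE t in restrict_space lborel {0..1}. \<bar>f t\<bar> \<le> F"
    and n: "0 < n" "m dvd n"
  shows "sup_norm_01 (\<lambda>x. f_hat \<psi> S n m b \<tau> d x - f x)
     \<le> ennreal (F + C\<^sup>2 * 2 ^ j_max S n b * (\<Sum>i\<in>{1..m}. \<Sum>l\<in>{1..n div m}. \<bar>snd (d i l)\<bar>))"
proof -
  define R where "R = (\<Sum>i\<in>{1..m}. \<Sum>l\<in>{1..n div m}. \<bar>snd (d i l)\<bar>)"
  define J where "J = j_max S n b"
  define jh where "jh = j_hat \<psi> S n m b \<tau> d"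
  have jh: "jh \<le> J" unfolding jh_def J_def by (rule j_hat_le_j_max)
  have R0: "0 \<le> R" unfolding R_def by (intro sum_nonneg) auto
  have mn: "real m / real n \<le> 1" using n by (simp add: dvd_imp_le)
  have agg: "\<bar>agg_coef \<psi> S n m b d j k\<bar> \<le> C * 2 powr (real j / 2) * R" if jk: "j < J" "k < 2 ^ j" for j k
  proof -
    let ?T = "senders S n m b j k"
    have T: "?T \<subseteq> {1..m}" using senders_subset[of j S n b k m] jk by (simp add: J_def)
    have b: "\<bar>\<psi> j k t\<bar> \<le> C * 2 powr (real j / 2)" for t by (rule level_sum_imp_single[where \<psi> = \<psi>, OF \<psi> jk(2)])
    have loc: "\<bar>local_coef \<psi> n m (d i) j k\<bar> \<le> C * 2 powr (real j / 2) * (\<Sum>l\<in>{1..n div m}. \<bar>snd (d i l)\<bar>)" for i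
    proof -
      have "\<bar>local_coef \<psi> n m (d i) j k\<bar> \<le> real m / real n * \<bar>\<Sum>l = 1..n div m. snd (d i l) * \<psi> j k (fst (d i l))\<bar>"
        unfolding local_coef_def by (subst abs_mult) simp
      also have "\<dots> \<le> 1 * (\<Sum>l = 1..n div m. \<bar>snd (d i l) * \<psi> j k (fst (d i l))\<bar>)"
        by (intro mult_mono mn sum_abs) auto
      also have "\<dots> \<le> 1 * (\<Sum>l = 1..n div m. C * 2 powr (real j / 2) * \<bar>snd (d i l)\<bar>)"
        using b by (intro mult_left_mono sum_mono) (auto simp: abs_mult mult.commute intro!: mult_left_mono)
      finally show ?thesis by (simp add: sum_distrib_left)
    qed
    have "\<bar>agg_coef \<psi> S n m b d j k\<bar> \<le> (\<Sum>i\<in>?T. \<bar>trans_approx n (local_coef \<psi> n m (d i) j k)\<bar>)"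
    proof -
      have "\<bar>agg_coef \<psi> S n m b d j k\<bar> \<le> \<bar>\<Sum>i\<in>?T. trans_approx n (local_coef \<psi> n m (d i) j k)\<bar>"
        unfolding agg_coef_def abs_divide
        by (cases "card ?T = 0") (auto simp: divide_le_eq mult_le_cancel_left1)
      also have "\<dots> \<le> (\<Sum>i\<in>?T. \<bar>trans_approx n (local_coef \<psi> n m (d i) j k)\<bar>)" by (rule sum_abs)
      finally show ?thesis .
    qed
    also have "\<dots> \<le> (\<Sum>i\<in>?T. C * 2 powr (real j / 2) * (\<Sum>l\<in>{1..n div m}. \<bar>snd (d i l)\<bar>))"
      using n by (intro sum_mono order_trans[OF abs_trans_approx_le loc]) auto
    also have "\<dots> \<le> (\<Sum>i\<in>{1..m}. C * 2 powr (real j / 2) * (\<Sum>l\<in>{1..n div m}. \<bar>snd (d i l)\<bar>))"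
      using T \<open>1 \<le> C\<close> by (intro sum_mono2) (auto intro!: mult_nonneg_nonneg sum_nonneg)
    finally show ?thesis by (simp add: R_def sum_distrib_left)
  qed
  have fh: "\<bar>f_hat \<psi> S n m b \<tau> d x\<bar> \<le> C\<^sup>2 * 2 ^ J * R" for x
  proof -
    have "\<bar>f_hat \<psi> S n m b \<tau> d x\<bar> \<le> (\<Sum>j<jh. C * 2 powr (real j / 2) * (C * 2 powr (real j / 2) * R))"
      unfolding f_hat_def f_tilde_eq_wavelet_sum jh_def[symmetric]
      using jh by (intro wavelet_sum_bound \<psi> agg) auto
    also have "\<dots> = (\<Sum>j<jh. C\<^sup>2 * R * 2 ^ j)"
    proof (intro sum.cong refl)
      fix j
      have "2 powr (real j / 2) * 2 powr (real j / 2) = (2::real) ^ j"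
        by (simp add: powr_add[symmetric] powr_realpow)
      then show "C * 2 powr (real j / 2) * (C * 2 powr (real j / 2) * R) = C\<^sup>2 * R * 2 ^ j"
        by (metis (no_types, opaque_lifting) mult.assoc mult.left_commute power2_eq_square mult.commute)
    qed
    also have "\<dots> = C\<^sup>2 * R * (\<Sum>j<jh. 2 ^ j)" by (simp add: sum_distrib_left)
    also have "(\<Sum>j<jh. (2::real) ^ j) \<le> 2 ^ J"
    proof -
      have "(\<Sum>j<jh. (2::real) ^ j) = 2 ^ jh - 1" by (induction jh) auto
      moreover have "(2::real) ^ jh \<le> 2 ^ J" using jh by (intro power_increasing) auto
      ultimately show ?thesis by linarith
    qed
    then have "C\<^sup>2 * R * (\<Sum>j<jh. 2 ^ j) \<le> C\<^sup>2 * R * 2 ^ J" using R0 by (intro mult_left_mono) auto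
    finally show ?thesis by (simp only: mult_ac)
  qed
  have "AE x in restrict_space lborel {0..1}. \<bar>f_hat \<psi> S n m b \<tau> d x - f x\<bar> \<le> F + C\<^sup>2 * 2 ^ J * R"
    using f(2)
  proof eventually_elim
    case (elim x)
    then show ?case using fh[of x] by linarith
  qed
  moreover have "(\<lambda>x. f_hat \<psi> S n m b \<tau> d x - f x) \<in> borel_measurable borel"
    using f_hat_L2_01[OF basis, of S n m b \<tau> d] f(1) by (intro borel_measurable_diff) (auto simp: L2_01_iff)
  ultimately show ?thesis unfolding R_def J_def by (intro sup_norm_01_le)
qed

section \<open>Growth conditions that hold for large sample sizes\<close>

lemma eventually_log_ge: "\<forall>\<^sub>F n in sequentially. K \<le> log 2 (real n)"
  by real_asymp

lemma eventually_log_cube_le: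
  fixes a K \<epsilon> :: real
  assumes "0 < a" "0 < \<epsilon>"
  shows "\<forall>\<^sub>F n in sequentially. K * (log 2 (real n)) ^ 3 * real n powr (- a) \<le> \<epsilon>"
proof -
  have "(\<lambda>n. K * (log 2 (real n)) ^ 3 * real n powr (- a)) \<longlonglongrightarrow> 0"
    using assms(1) by real_asymp
  from order_tendstoD(2)[OF this assms(2)] show ?thesis by eventually_elim simp
qed

lemma eventually_loglog_le:
  fixes K :: real
  shows "\<forall>\<^sub>F n in sequentially. 3 * log 2 (log 2 (real n)) + K \<le> log 2 (real n) / 2"
  by real_asymp


text \<open>On the group levels the sample size itself decays like 2^(-j), so the ratio grows like
  4^j, and it is the first ceiling in \<open>j_max\<close> that keeps 4^j below 4 (n b)^(1/(1+r)).
  On the low levels the second ceiling gives an even smaller power of n.\<close>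

lemma level_noise_ratio:
  assumes r: "0 < r" and l: "1 \<le> log 2 (real n)" "log 2 (real n) \<le> b"
    and m: "first_half m \<noteq> {}" "\<forall>t < n_groups (ereal r) n b. 1 \<le> subgroup_size (ereal r) n m b t"
    and j: "j < j_max (ereal r) n b"
  shows "log 2 (real n) * 2 ^ j / n_eff (ereal r) n m b j
     \<le> 256 * (log 2 (real n)) ^ 3 * real n powr (- (r / (1 + r)))"
proof -
  define \<Lambda> where "\<Lambda> = log 2 (real n)"
  define J where "J = j_max (ereal r) n b"
  define N where "N = n_eff (ereal r) n m b j"
  have \<Lambda>: "1 \<le> \<Lambda>" and b1: "1 \<le> b" using l by (auto simp: \<Lambda>_def)
  have n0: "0 < n" using log_ge_one_pos l by blast
  have N0: "0 < N" using n_eff_pos[OF n0 m j] by (simp add: N_def)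
  have jJ: "(2::real) ^ j \<le> 2 ^ J" using j by (intro power_increasing) (auto simp: J_def)
  show ?thesis
  proof (cases "j < j_B n b")
    case True
    have "\<Lambda> * 2 ^ j / N \<le> \<Lambda> * (2 * real n powr (1 / (1 + 2 * r))) / (real n / 3)"
      using n_eff_low_levels[OF m(1) True, of "ereal r"] \<Lambda> n0
        order_trans[OF jJ[unfolded J_def] j_max_bounds(4)[OF r l(1) b1]]
      by (intro frac_le mult_left_mono mult_nonneg_nonneg) (auto simp: N_def)
    also have "\<dots> = 6 * \<Lambda> * real n powr (1 / (1 + 2 * r) - 1)"
      using n0 by (simp add: powr_diff)
    also have "\<dots> \<le> 6 * \<Lambda> * real n powr (- (r / (1 + r)))"
      using r n0 \<Lambda> by (intro mult_left_mono powr_mono) (auto simp: field_simps)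
    also have "\<dots> \<le> 256 * \<Lambda> ^ 3 * real n powr (- (r / (1 + r)))"
    proof (rule mult_right_mono)
      have "\<Lambda> ^ 1 \<le> \<Lambda> ^ 3" using \<Lambda> by (intro power_increasing) auto
      then show "6 * \<Lambda> \<le> 256 * \<Lambda> ^ 3" using \<Lambda> by simp
    qed simp
    finally show ?thesis by (simp add: \<Lambda>_def N_def)
  next
    case False
    define y where "y = real n * b"
    have y: "real n \<le> y" "0 < y" using b1 n0 by (auto simp: y_def)
    have pa: "y powr a * y powr a / y = y powr (a + a - 1)" for a
      unfolding powr_diff powr_add using y by simp
    have "y / (64 * \<Lambda>\<^sup>2 * 2 ^ j) \<le> N"
      using n_eff_high_levels_lower[OF m _ j l j_max_bounds(2)[OF r l(1) b1]] False
      by (simp add: \<Lambda>_def N_def y_def)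
    then have "\<Lambda> * 2 ^ j / N \<le> \<Lambda> * 2 ^ j / (y / (64 * \<Lambda>\<^sup>2 * 2 ^ j))"
      using \<Lambda> y N0 by (intro divide_left_mono mult_pos_pos divide_pos_pos) auto
    also have "\<dots> = 64 * \<Lambda> ^ 3 * (2 ^ j * 2 ^ j) / y"
      by (simp add: power2_eq_square power3_eq_cube)
    also have "\<dots> \<le> 64 * \<Lambda> ^ 3 * ((2 * y powr (1 / (2 + 2 * r))) * (2 * y powr (1 / (2 + 2 * r)))) / y"
    proof -
      have "(2::real) ^ j \<le> 2 * y powr (1 / (2 + 2 * r))"
        unfolding y_def by (rule order_trans[OF jJ[unfolded J_def] j_max_bounds(3)[OF r l(1) b1]])
      then show ?thesis using \<Lambda> y
        by (intro divide_right_mono mult_left_mono mult_mono) auto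
    qed
    also have "\<dots> = 256 * \<Lambda> ^ 3 * y powr (1 / (2 + 2 * r) + 1 / (2 + 2 * r) - 1)"
      unfolding pa[symmetric] by simp
    also have "1 / (2 + 2 * r) + 1 / (2 + 2 * r) - 1 = - (r / (1 + r))"
      using r by (simp add: field_simps)
    also have "256 * \<Lambda> ^ 3 * y powr (- (r / (1 + r))) \<le> 256 * \<Lambda> ^ 3 * real n powr (- (r / (1 + r)))"
      using \<Lambda> y r n0 by (intro mult_left_mono powr_mono2') auto
    finally show ?thesis by (simp add: \<Lambda>_def N_def)
  qed
qed

lemma total_measurable:
  "(\<lambda>d. \<Sum>i\<in>{1..m}. \<Sum>l\<in>{1..q}. \<bar>snd (d i l)\<bar>) \<in> borel_measurable (data_law \<sigma> m q f)"
proof -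
  have "(\<lambda>z. \<bar>snd z\<bar>) \<in> borel_measurable (borel \<Otimes>\<^sub>M (borel :: real measure))" by measurable
  from measurable_compose[OF measurable_data_coord this]
  show ?thesis by (intro borel_measurable_sum) blast
qed

text \<open>Chosen so that \<open>exp (- (\<kappa>\<^sup>2 * log 2 n / (4 * V)))\<close> with
  \<open>V = mgf_const \<sigma> A\<close> is exactly n^(-10): 40 = 4 * 10, and \<open>ln 2\<close>
  converts the binary logarithm.\<close>

definition risk_kappa :: "real \<Rightarrow> real \<Rightarrow> real" where
  "risk_kappa \<sigma> A = sqrt (40 * mgf_const \<sigma> A * ln 2)"

text \<open>Outside the event the loss is polynomially bounded in \<open>n\<close> in mean square, while the event
  fails with probability of order \<open>n ^ (-9)\<close>; the product is split by the inequality
  \<open>U \<le> w U\<^sup>2 / 2 + 1 / (2 w)\<close> with \<open>w = n ^ (-5)\<close>.\<close>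

lemma risk_split:
  fixes C L r s s1 \<sigma> c0 \<tau> :: real
  defines "A \<equiv> tail_const C L r"
  defines "\<kappa> \<equiv> risk_kappa \<sigma> A"
  assumes basis: "orthonormal_basis_01 \<psi>"
    and \<psi>: "\<And>j x. (\<Sum>k<2 ^ j. \<bar>\<psi> j k x\<bar>) \<le> C * 2 powr (real j / 2)" "1 \<le> C"
    and f: "f \<in> besov_ball \<psi> s L" "0 < L" and r: "0 < r" "r \<le> s" "s \<le> s1"
    and n: "m dvd n" and l: "1 \<le> log 2 (real n)" "log 2 (real n) \<le> b"
    and m: "first_half m \<noteq> {}" "\<forall>t < n_groups (ereal r) n b. 1 \<le> subgroup_size (ereal r) n m b t"
    and small: "(\<kappa> * C)\<^sup>2 * 256 * (log 2 (real n)) ^ 3 * real n powr (- (r / (1 + r))) \<le> 4"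
    and c0: "0 < c0" "c0 * log 2 (real n) \<le> real (balance_level (ereal r) n m b s) - 1"
    and \<tau>: "4 * C * (\<kappa> + 2) + 2 * 2 powr s1 * A \<le> \<tau> * sqrt c0"
  shows "(\<integral>\<^sup>+ d. sup_norm_01 (\<lambda>x. f_hat \<psi> (ereal r) n m b \<tau> d x - f x) \<partial>data_law \<sigma> m (n div m) f)
    \<le> ennreal ((2 * \<tau> + 4 * C * (\<kappa> + 2) + A) * 2 powr s * 2 powr (- (real (balance_level (ereal r) n m b s) * s)))
      + ennreal ((A\<^sup>2 + 4 * C ^ 4 * (2 * A\<^sup>2 + 2 * \<sigma>\<^sup>2) + 2) / sqrt (real n))"
proof -
  let ?D = "data_law \<sigma> m (n div m) f"
  let ?S = "ereal r"
  define V where "V = mgf_const \<sigma> A"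
  define J where "J = j_max ?S n b"
  define q1 where "q1 = (2 * \<tau> + 4 * C * (\<kappa> + 2) + A) * 2 powr s * 2 powr (- (real (balance_level ?S n m b s) * s))"
  define G where "G = 2 * A\<^sup>2 + 2 * \<sigma>\<^sup>2"
  define x where "x = real n"
  define R where "R d = (\<Sum>i\<in>{1..m}. \<Sum>l\<in>{1..n div m}. \<bar>snd (d i l)\<bar>)" for d :: "nat \<Rightarrow> nat \<Rightarrow> real \<times> real"
  have n0: "0 < n" using log_ge_one_pos l by blast
  then have x1: "1 \<le> x" by (simp add: x_def)
  have b1: "1 \<le> b" using l by simp
  have V1: "1 \<le> V" by (simp add: V_def mgf_const_def)
  have \<kappa>sq: "\<kappa>\<^sup>2 = 40 * V * ln 2" and \<kappa>0: "0 < \<kappa>"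
    using V1 by (auto simp: \<kappa>_def risk_kappa_def V_def)
  have fL: "f \<in> L2_01" using f(1) by (simp add: besov_ball_def)
  have fm: "f \<in> borel_measurable borel" using fL by (simp add: L2_01_iff)
  interpret D: prob_space ?D by (rule prob_space_data_law[OF fm])
  have A0: "0 \<le> A" and CA: "tail_const C L s \<le> A"
    unfolding A_def using r \<psi>(2) f(2) by (auto intro: tail_const_nonneg tail_const_antimono)
  have fA: "AE t in restrict_space lborel {0..1}. \<bar>f t\<bar> \<le> A"
    using besov_ball_bounded[OF basis \<psi> f(1) less_le_trans[OF r(1,2)] f(2)]
    by eventually_elim (use CA in linarith)
  \<comment> \<open>The hypothesis yields only the bound 2, which suffices because \<open>V\<close>
    is at least 1.\<close>
  have smallj: "\<kappa> * C * sqrt (log 2 (real n) * 2 ^ j / n_eff ?S n m b j) \<le> 2 * mgf_const \<sigma> A"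
    if "j < j_max ?S n b" for j
  proof -
    define y where "y = log 2 (real n) * 2 ^ j / n_eff ?S n m b j"
    have "(\<kappa> * C)\<^sup>2 * y \<le> (\<kappa> * C)\<^sup>2 * (256 * (log 2 (real n)) ^ 3 * real n powr (- (r / (1 + r))))"
      unfolding y_def by (intro mult_left_mono level_noise_ratio[OF r(1) l m that]) auto
    also have "\<dots> \<le> 4" using small by (simp add: mult.assoc)
    finally have "sqrt ((\<kappa> * C)\<^sup>2 * y) \<le> sqrt 4" by (rule real_sqrt_le_mono)
    then have "\<kappa> * C * sqrt y \<le> 2" using \<kappa>0 \<psi>(2) by (simp add: real_sqrt_mult)
    then show ?thesis using V1 unfolding y_def V_def by linarith
  qed
  obtain E where E: "E \<in> sets ?D"
      "emeasure ?D E \<le> ennreal (2 ^ J * (2 * exp (- (\<kappa>\<^sup>2 * log 2 (real n) / (4 * V)))))"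
      "\<forall>d\<in>space ?D - E. coef_event \<psi> ?S n m b f (\<kappa> + 2) d"
    using coef_event_prob[OF basis \<psi>(1) fL fA n l(1) m \<kappa>0 smallj] unfolding J_def V_def by blast
  have J2: "2 ^ J \<le> 2 * x"
  proof -
    have "2 ^ J \<le> 2 * x powr (1 / (1 + 2 * r))"
      using j_max_bounds(4)[OF r(1) l(1) b1] by (simp add: J_def x_def)
    also have "x powr (1 / (1 + 2 * r)) \<le> x powr 1" using r x1 by (intro powr_mono) auto
    finally show ?thesis using x1 by simp
  qed
  have EP: "emeasure ?D E \<le> ennreal (4 * x / x ^ 10)"
  proof -
    have "\<kappa>\<^sup>2 * log 2 (real n) / (4 * V) = 10 * ln x"
      using V1 by (simp add: \<kappa>sq log_def x_def)
    moreover have "exp (10 * ln x) = x ^ 10" using exp_of_nat_mult[of 10 "ln x"] x1 by simp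
    ultimately have "exp (- (\<kappa>\<^sup>2 * log 2 (real n) / (4 * V))) = 1 / x ^ 10"
      by (simp only: exp_minus inverse_eq_divide)
    then have "2 ^ J * (2 * exp (- (\<kappa>\<^sup>2 * log 2 (real n) / (4 * V)))) \<le> 2 * x * (2 * (1 / x ^ 10))"
      using J2 x1 by (intro mult_mono) auto
    then show ?thesis using order_trans[OF E(2) ennreal_leI] by simp
  qed
  have q10: "0 \<le> q1"
  proof -
    have "0 \<le> 4 * C * (\<kappa> + 2) + 2 * 2 powr s1 * A" using A0 \<psi>(2) \<kappa>0 by simp
    then have "0 \<le> \<tau> * sqrt c0" using \<tau> by linarith
    then have "0 \<le> \<tau>" using c0(1) by (simp add: zero_le_mult_iff)
    then show ?thesis unfolding q1_def using A0 \<psi>(2) \<kappa>0 by (intro mult_nonneg_nonneg) auto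
  qed
  \<comment> \<open>The right-hand side is measurable in d, so its integral can be split into terms
    without measurability of the loss. The second moment term is kept on all data sets, and only the
    constant is restricted to \<open>E\<close>.\<close>
  have pt: "sup_norm_01 (\<lambda>t. f_hat \<psi> ?S n m b \<tau> d t - f t)
      \<le> (ennreal (q1 + A\<^sup>2 / x ^ 5) + ennreal (4 * C ^ 4 / x ^ 3) * ennreal ((R d)\<^sup>2)) + ennreal (x ^ 5 / 2) * indicator E d"
    if d: "d \<in> space ?D" for d
  proof (cases "d \<in> E")
    case False
    then have "sup_norm_01 (\<lambda>t. f_hat \<psi> ?S n m b \<tau> d t - f t) \<le> ennreal q1"
      unfolding q1_def A_def
      using \<kappa>0 E(3) d \<tau> by (intro oracle_inequality[OF basis \<psi> f r l m _ _ c0, of _ d]) (auto simp: A_def)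
    also have "\<dots> \<le> ennreal (q1 + A\<^sup>2 / x ^ 5)" using x1 by (intro ennreal_leI) auto
    also have "\<dots> \<le> (ennreal (q1 + A\<^sup>2 / x ^ 5) + ennreal (4 * C ^ 4 / x ^ 3) * ennreal ((R d)\<^sup>2)) + ennreal (x ^ 5 / 2) * indicator E d"
      by (simp add: add.assoc)
    finally show ?thesis .
  next
    case True
    define U where "U = A + C\<^sup>2 * 2 ^ J * R d"
    have R0: "0 \<le> R d" unfolding R_def by (intro sum_nonneg) auto
    have amgm: "U \<le> U\<^sup>2 / v / 2 + v / 2" if "0 < v" for v
    proof -
      have "2 * U * v \<le> U\<^sup>2 + v * v" using sum_squares_bound[of U v] by (simp add: power2_eq_square)
      then show ?thesis using that by (simp add: field_simps)
    qed
    have "U\<^sup>2 \<le> 2 * A\<^sup>2 + 2 * (C\<^sup>2 * 2 ^ J * R d)\<^sup>2"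
      unfolding U_def using sum_squares_bound[of A "C\<^sup>2 * 2 ^ J * R d"] by (simp add: power2_sum)
    also have "(C\<^sup>2 * 2 ^ J * R d)\<^sup>2 \<le> (C\<^sup>2 * (2 * x) * R d)\<^sup>2"
      using J2 R0 by (intro power_mono mult_right_mono mult_left_mono) auto
    also have "\<dots> = 4 * C ^ 4 * x\<^sup>2 * (R d)\<^sup>2" by (simp add: power2_eq_square power4_eq_xxxx)
    finally have U2: "U\<^sup>2 \<le> 2 * A\<^sup>2 + 8 * C ^ 4 * x\<^sup>2 * (R d)\<^sup>2" by simp
    have "U\<^sup>2 / x ^ 5 / 2 \<le> (2 * A\<^sup>2 + 8 * C ^ 4 * x\<^sup>2 * (R d)\<^sup>2) / x ^ 5 / 2"
      using U2 x1 by (intro divide_right_mono) auto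
    also have "\<dots> = A\<^sup>2 / x ^ 5 + 4 * C ^ 4 / x ^ 3 * (R d)\<^sup>2"
      using x1 by (simp add: field_simps power2_eq_square power3_eq_cube eval_nat_numeral)
    finally have "U \<le> (q1 + A\<^sup>2 / x ^ 5) + 4 * C ^ 4 / x ^ 3 * (R d)\<^sup>2 + x ^ 5 / 2"
      using amgm[of "x ^ 5"] q10 x1 by simp
    then have "ennreal U \<le> ennreal ((q1 + A\<^sup>2 / x ^ 5) + 4 * C ^ 4 / x ^ 3 * (R d)\<^sup>2 + x ^ 5 / 2)" by (rule ennreal_leI)
    also have "\<dots> = (ennreal (q1 + A\<^sup>2 / x ^ 5) + ennreal (4 * C ^ 4 / x ^ 3) * ennreal ((R d)\<^sup>2)) + ennreal (x ^ 5 / 2) * indicator E d"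
      using q10 x1 \<psi>(2) True by (simp add: ennreal_mult[symmetric] ennreal_plus[symmetric] del: ennreal_plus)
    finally show ?thesis
      using crude_bound[OF basis \<psi> fL fA n0 n, of ?S b \<tau> d] unfolding U_def R_def J_def by (rule order_trans[rotated])
  qed
  have Rm0: "R \<in> borel_measurable ?D" unfolding R_def[abs_def] by (rule total_measurable)
  have Rm: "(\<lambda>d. ennreal (4 * C ^ 4 / x ^ 3) * ennreal ((R d)\<^sup>2)) \<in> borel_measurable ?D"
    using Rm0 by measurable
  have "(\<integral>\<^sup>+ d. sup_norm_01 (\<lambda>t. f_hat \<psi> ?S n m b \<tau> d t - f t) \<partial>?D)
     \<le> (\<integral>\<^sup>+ d. (ennreal (q1 + A\<^sup>2 / x ^ 5) + ennreal (4 * C ^ 4 / x ^ 3) * ennreal ((R d)\<^sup>2)) + ennreal (x ^ 5 / 2) * indicator E d \<partial>?D)"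
    by (intro nn_integral_mono pt)
  also have "\<dots> = (\<integral>\<^sup>+ d. ennreal (q1 + A\<^sup>2 / x ^ 5) + ennreal (4 * C ^ 4 / x ^ 3) * ennreal ((R d)\<^sup>2) \<partial>?D)
      + (\<integral>\<^sup>+ d. ennreal (x ^ 5 / 2) * indicator E d \<partial>?D)"
    using E(1) Rm by (intro nn_integral_add borel_measurable_add borel_measurable_const) auto
  also have "(\<integral>\<^sup>+ d. ennreal (q1 + A\<^sup>2 / x ^ 5) + ennreal (4 * C ^ 4 / x ^ 3) * ennreal ((R d)\<^sup>2) \<partial>?D)
      = (\<integral>\<^sup>+ d. ennreal (q1 + A\<^sup>2 / x ^ 5) \<partial>?D) + (\<integral>\<^sup>+ d. ennreal (4 * C ^ 4 / x ^ 3) * ennreal ((R d)\<^sup>2) \<partial>?D)"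
    by (intro nn_integral_add borel_measurable_const Rm)
  also have "(\<integral>\<^sup>+ d. ennreal (q1 + A\<^sup>2 / x ^ 5) \<partial>?D) = ennreal (q1 + A\<^sup>2 / x ^ 5)"
    using D.emeasure_space_1 by simp
  also have "(\<integral>\<^sup>+ d. ennreal (4 * C ^ 4 / x ^ 3) * ennreal ((R d)\<^sup>2) \<partial>?D) = ennreal (4 * C ^ 4 / x ^ 3) * (\<integral>\<^sup>+ d. ennreal ((R d)\<^sup>2) \<partial>?D)"
    by (intro nn_integral_cmult measurable_compose[OF _ measurable_ennreal] borel_measurable_power Rm0)
  also have "\<dots> \<le> ennreal (4 * C ^ 4 / x ^ 3) * ennreal (x\<^sup>2 * G)"
  proof (rule mult_left_mono)
    have "m * (n div m) = n" using n by simp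
    then show "(\<integral>\<^sup>+ d. ennreal ((R d)\<^sup>2) \<partial>?D) \<le> ennreal (x\<^sup>2 * G)"
      using data_law_total_second_moment[OF fL fA, where m = m and q = "n div m" and \<sigma> = \<sigma>] by (simp add: R_def G_def x_def)
  qed simp
  also have "\<dots> = ennreal (4 * C ^ 4 * G / x)"
    using x1 \<psi>(2) by (subst ennreal_mult[symmetric]) (auto simp: G_def power2_eq_square power3_eq_cube)
  also have "(\<integral>\<^sup>+ d. ennreal (x ^ 5 / 2) * indicator E d \<partial>?D) = ennreal (x ^ 5 / 2) * emeasure ?D E"
    by (rule nn_integral_cmult_indicator[OF E(1)])
  also have "\<dots> \<le> ennreal (x ^ 5 / 2) * ennreal (4 * x / x ^ 10)"
    by (intro mult_left_mono EP) auto
  also have "\<dots> = ennreal (2 / x ^ 4)"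
    using x1 by (subst ennreal_mult[symmetric]) (auto simp: field_simps power_add[symmetric] eval_nat_numeral)
  also have "ennreal (q1 + A\<^sup>2 / x ^ 5) + ennreal (4 * C ^ 4 * G / x) + ennreal (2 / x ^ 4)
      = ennreal (q1 + (A\<^sup>2 / x ^ 5 + 4 * C ^ 4 * G / x + 2 / x ^ 4))"
    using x1 q10 \<psi>(2) by (simp add: ennreal_plus[symmetric] G_def add.assoc del: ennreal_plus)
  also have "\<dots> \<le> ennreal (q1 + (A\<^sup>2 + 4 * C ^ 4 * G + 2) / sqrt x)"
  proof (intro ennreal_leI add_left_mono)
    have sx: "0 < sqrt x" "sqrt x \<le> x" using x1 by (auto simp: sqrt_le_D real_le_lsqrt power2_eq_square)
    have "x ^ 1 \<le> x ^ 5" "x ^ 1 \<le> x ^ 4" using x1 by (intro power_increasing; simp)+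
    then have "sqrt x \<le> x ^ 5" "sqrt x \<le> x ^ 4" using sx by auto
    then have "A\<^sup>2 / x ^ 5 + 4 * C ^ 4 * G / x + 2 / x ^ 4 \<le> A\<^sup>2 / sqrt x + 4 * C ^ 4 * G / sqrt x + 2 / sqrt x"
      using sx by (intro add_mono divide_left_mono mult_pos_pos) (auto simp: G_def)
    then show "A\<^sup>2 / x ^ 5 + 4 * C ^ 4 * G / x + 2 / x ^ 4 \<le> (A\<^sup>2 + 4 * C ^ 4 * G + 2) / sqrt x"
      by (simp add: add_divide_distrib)
  qed
  also have "\<dots> = ennreal q1 + ennreal ((A\<^sup>2 + 4 * C ^ 4 * G + 2) / sqrt x)"
    using x1 q10 \<psi>(2) by (intro ennreal_plus) (auto simp: G_def)
  finally show ?thesis by (simp add: q1_def G_def x_def add_mono)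
qed

text \<open>Both alternatives of the lower bound imply that n is at most
  \<open>64 * \<Lambda> ^ 3 * 2 powr (p * (2 + 2 * s))\<close>; taking logarithms, p is at least a
  multiple of \<open>log 2 n\<close> up to an iterated logarithm. In \<open>8 + 2 * s\<close> the 6
  is the logarithm of 64, and \<open>2 + 2 * s\<close> pays for the step from p to p - 1. Half of
  \<open>log 2 n\<close> is sacrificed to these terms, which turns \<open>2 + 2 * s\<close> into
  \<open>4 + 4 * s\<close>.\<close>

lemma balance_level_growth:
  assumes r: "0 < r" "r \<le> s" "s \<le> s1" and l: "1 \<le> log 2 (real n)" "log 2 (real n) \<le> b"
    and m: "first_half m \<noteq> {}" "\<forall>t < n_groups (ereal r) n b. 1 \<le> subgroup_size (ereal r) n m b t"
    and large: "3 * log 2 (log 2 (real n)) + (8 + 2 * s) \<le> log 2 (real n) / 2"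
  shows "1 / (4 + 4 * s1) * log 2 (real n) \<le> real (balance_level (ereal r) n m b s) - 1"
proof -
  define \<Lambda> where "\<Lambda> = log 2 (real n)"
  define p where "p = balance_level (ereal r) n m b s"
  have \<Lambda>: "1 \<le> \<Lambda>" using l by (simp add: \<Lambda>_def)
  have n0: "0 < n" using log_ge_one_pos l by blast
  have "real n \<le> 64 * (\<Lambda> ^ 3 * 2 powr (real p * (2 + 2 * s)))"
    using balance_level_lower[OF r(1,2) l m]
  proof (elim disjE conjE)
    assume "real n / 3 \<le> log 2 (real n) * 2 powr (real (balance_level (ereal r) n m b s) * (1 + 2 * s))"
    then have "real n \<le> 3 * (\<Lambda> * 2 powr (real p * (1 + 2 * s)))" by (simp add: \<Lambda>_def p_def)
    also have "\<dots> \<le> 64 * (\<Lambda> ^ 3 * 2 powr (real p * (2 + 2 * s)))"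
    proof (intro mult_mono powr_mono)
      have "\<Lambda> ^ 1 \<le> \<Lambda> ^ 3" using \<Lambda> by (intro power_increasing) auto
      then show "\<Lambda> \<le> \<Lambda> ^ 3" by simp
    qed (use \<Lambda> r in \<open>auto intro!: mult_left_mono\<close>)
    finally show ?thesis .
  next
    assume "real n * b / 64 \<le> log 2 (real n) ^ 3 * 2 powr (real (balance_level (ereal r) n m b s) * (2 + 2 * s))"
    moreover have "real n * 1 \<le> real n * b" using l by (intro mult_left_mono) auto
    ultimately show ?thesis by (simp add: \<Lambda>_def p_def)
  qed
  then have "\<Lambda> \<le> log 2 (64 * (\<Lambda> ^ 3 * 2 powr (real p * (2 + 2 * s))))"
    using n0 unfolding \<Lambda>_def by (subst log_le_cancel_iff) auto
  also have "\<dots> = log 2 64 + (3 * log 2 \<Lambda> + real p * (2 + 2 * s))"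
    using \<Lambda> by (simp add: log_mult log_nat_power)
  also have "log 2 64 = (6::real)" using log_pow_cancel[of 2 6] by simp
  finally have "\<Lambda> / 2 \<le> (real p - 1) * (2 + 2 * s)"
    using large unfolding \<Lambda>_def[symmetric] by (simp add: algebra_simps)
  then have "\<Lambda> / (4 + 4 * s) \<le> real p - 1" using r by (simp add: field_simps)
  moreover have "\<Lambda> / (4 + 4 * s1) \<le> \<Lambda> / (4 + 4 * s)" using r \<Lambda> by (intro divide_left_mono) auto
  ultimately show ?thesis by (simp add: \<Lambda>_def p_def)
qed

theorem theorem2p12:
  fixes \<sigma> s_max :: real
    and \<psi> :: "nat \<Rightarrow> nat \<Rightarrow> real \<Rightarrow> real"
    and A :: "nat set"
    and m :: "nat \<Rightarrow> nat"
    and B :: "nat \<Rightarrow> real"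
  defines "S \<equiv> s_min A m B"
  assumes "0 < \<sigma>"
    and "0 < s_max" and "cdv_wavelet_basis s_max \<psi>"
    and "infinite A"
    and "\<forall>n\<in>A. 0 < m n \<and> m n dvd n"
    and "\<forall>n\<in>A. log 2 (real n) \<le> B n"
    and groups_nonempty: "\<forall>\<^sub>F n in sequentially. n \<in> A \<longrightarrow> first_half (m n) \<noteq> {} \<and>
           (\<forall>t < n_groups S n (B n). 1 \<le> subgroup_size S n (m n) (B n) t)"
  shows "(\<forall>L>0. \<forall>s>0. \<forall>\<tau>>1. \<forall>\<^sub>F n in sequentially. n \<in> A \<longrightarrow>
            f_hat \<psi> S n (m n) (B n) \<tau> \<in>
              F_dist \<sigma> (m n) (n div m n) (\<lambda>_. B n) (besov_ball \<psi> s L)) \<and>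
         (0 < S \<longrightarrow>
           (\<forall>L>0. \<exists>\<tau>\<^sub>0\<ge>1. \<forall>\<tau>>\<tau>\<^sub>0. \<forall>s>0. S \<le> ereal s \<and> s < s_max \<longrightarrow>
             (\<exists>C>0. \<forall>\<^sub>F n in sequentially. n \<in> A \<longrightarrow>
                sup_risk \<sigma> (m n) (n div m n) (besov_ball \<psi> s L) (f_hat \<psi> S n (m n) (B n) \<tau>)
                  \<le> ennreal (C * rate L s n (B n)))))"
proof -
  note mdvd = assms(6) and budget = assms(7)
  have basis: "orthonormal_basis_01 \<psi>" using assms(4) by (simp add: cdv_wavelet_basis_def)
  obtain C where C: "1 \<le> C" and \<psi>: "\<And>j x. (\<Sum>k<2 ^ j. \<bar>\<psi> j k x\<bar>) \<le> C * 2 powr (real j / 2)"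
    using cdv_level_sum_bound[OF assms(3,4)] by blast
  have member: "\<forall>\<^sub>F n in sequentially. n \<in> A \<longrightarrow>
      f_hat \<psi> S n (m n) (B n) \<tau> \<in> F_dist \<sigma> (m n) (n div m n) (\<lambda>_. B n) (besov_ball \<psi> s L)"
    if "0 < L" "0 < s" for L s \<tau>
  proof -
    \<comment> \<open>Membership is asserted for each s separately, so the bound on f may depend on
      s here.\<close>
    define F where "F = tail_const C L s"
    define G where "G = F\<^sup>2 + \<sigma>\<^sup>2 + 1 / 2"
    show ?thesis
      using eventually_log_ge[of "2 * (2 + G)"]
    proof eventually_elim
      case (elim n)
      show ?case
      proof
        assume n: "n \<in> A"
        have "0 \<le> G" by (simp add: G_def)
        then have "0 < n" using elim by (intro log_ge_one_pos) simp
        then show "f_hat \<psi> S n (m n) (B n) \<tau> \<in> F_dist \<sigma> (m n) (n div m n) (\<lambda>_. B n) (besov_ball \<psi> s L)"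
          using n mdvd budget elim besov_ball_bounded[OF basis \<psi> C _ that(2,1)]
          by (intro f_hat_in_F_dist[OF basis, where F = F and G = G]) (auto simp: besov_ball_def F_def G_def)
      qed
    qed
  qed
  have risk: "\<exists>\<tau>\<^sub>0\<ge>1. \<forall>\<tau>>\<tau>\<^sub>0. \<forall>s>0. S \<le> ereal s \<and> s < s_max \<longrightarrow>
             (\<exists>C>0. \<forall>\<^sub>F n in sequentially. n \<in> A \<longrightarrow>
                sup_risk \<sigma> (m n) (n div m n) (besov_ball \<psi> s L) (f_hat \<psi> S n (m n) (B n) \<tau>)
                  \<le> ennreal (C * rate L s n (B n)))"
    if "0 < S" and L: "0 < L" for L
  proof (cases S)
    case PInf
    \<comment> \<open>No real s lies above an infinite S, so the claim is vacuous.\<close>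
    then show ?thesis by (intro exI[of _ 1]) auto
  next
    case MInf
    then show ?thesis using \<open>0 < S\<close> by simp
  next
    case (real r)
    then have r: "0 < r" using \<open>0 < S\<close> by simp
    \<comment> \<open>\<open>Q\<close> and \<kappa> are taken at the lower end r of the smoothness
      range and \<open>c0\<close> at the upper end \<open>s_max\<close>, so that
      \<open>\<tau>\<^sub>0\<close> depends neither on s nor on n. The quotient in
      \<open>\<tau>\<^sub>0\<close> is what the oracle inequality requires for the noise constant
      \<open>\<kappa> + 2\<close>.\<close>
    define Q where "Q = tail_const C L r"
    define \<kappa> where "\<kappa> = risk_kappa \<sigma> Q"
    define c0 where "c0 = 1 / (4 + 4 * s_max)"
    define \<tau>\<^sub>0 where "\<tau>\<^sub>0 = max 1 ((4 * C * (\<kappa> + 2) + 2 * 2 powr s_max * Q) / sqrt c0)"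
    have c0: "0 < c0" using assms(3) by (simp add: c0_def)
    have Q0: "0 \<le> Q" unfolding Q_def by (rule tail_const_nonneg[OF r C L])
    have \<kappa>0: "0 \<le> \<kappa>" by (simp add: \<kappa>_def risk_kappa_def mgf_const_def)
    have "\<exists>K>0. \<forall>\<^sub>F n in sequentially. n \<in> A \<longrightarrow>
                sup_risk \<sigma> (m n) (n div m n) (besov_ball \<psi> s L) (f_hat \<psi> S n (m n) (B n) \<tau>)
                  \<le> ennreal (K * rate L s n (B n))"
      if \<tau>: "\<tau>\<^sub>0 < \<tau>" and s: "0 < s" "S \<le> ereal s" "s < s_max" for \<tau> s
    proof -
      have rs: "r \<le> s" using s(2) real by simp
      have \<tau>1: "1 < \<tau>" using \<tau> by (simp add: \<tau>\<^sub>0_def)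
      have "(4 * C * (\<kappa> + 2) + 2 * 2 powr s_max * Q) / sqrt c0 \<le> \<tau>" using \<tau> by (simp add: \<tau>\<^sub>0_def)
      then have \<tau>c: "4 * C * (\<kappa> + 2) + 2 * 2 powr s_max * Q \<le> \<tau> * sqrt c0"
        using c0 by (simp add: divide_le_eq)
      obtain C1 where C1: "1 \<le> C1" "\<And>n b p. 1 \<le> log 2 (real n) \<Longrightarrow> log 2 (real n) \<le> b \<Longrightarrow>
          real n / 3 \<le> log 2 (real n) * 2 powr (real p * (1 + 2 * s)) \<or>
          real n * b / 64 \<le> (log 2 (real n)) ^ 3 * 2 powr (real p * (2 + 2 * s)) \<and> j_B n b \<le> p \<Longrightarrow>
          2 powr (- (real p * s)) \<le> C1 * rate L s n b"
        using level_rate_bound[OF L s(1)] by blast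
      define C2 where "C2 = 1 + (12 * L powr (2 / (1 + 2 * s))) powr (s / (2 + 2 * s))"
      define K1 where "K1 = (2 * \<tau> + 4 * C * (\<kappa> + 2) + Q) * 2 powr s"
      define K2 where "K2 = Q\<^sup>2 + 4 * C ^ 4 * (2 * Q\<^sup>2 + 2 * \<sigma>\<^sup>2) + 2"
      have K1: "0 < K1" unfolding K1_def using \<tau>1 C \<kappa>0 Q0 by (intro mult_pos_pos add_pos_nonneg) auto
      have K2: "0 < K2" unfolding K2_def using C by (intro add_nonneg_pos) auto
      have C2: "1 \<le> C2" by (simp add: C2_def)
      have "0 < r / (1 + r)" using r by simp
      then have cube: "\<forall>\<^sub>F n in sequentially.
          (\<kappa> * C)\<^sup>2 * 256 * log 2 (real n) ^ 3 * real n powr - (r / (1 + r)) \<le> 4"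
        by (rule eventually_log_cube_le) simp
      have ev: "\<forall>\<^sub>F n in sequentially. n \<in> A \<longrightarrow>
         sup_risk \<sigma> (m n) (n div m n) (besov_ball \<psi> s L) (f_hat \<psi> S n (m n) (B n) \<tau>)
                  \<le> ennreal ((K1 * C1 + K2 * C2) * rate L s n (B n))"
        using groups_nonempty eventually_log_ge[of 1] eventually_loglog_le[of "8 + 2 * s"] cube
      proof eventually_elim
        case (elim n)
        show ?case
        proof
          assume n: "n \<in> A"
          let ?b = "B n" and ?m = "m n"
          have l: "1 \<le> log 2 (real n)" "log 2 (real n) \<le> ?b" using elim(2) budget n by auto
          have mg: "first_half ?m \<noteq> {}" "\<forall>t < n_groups (ereal r) n ?b. 1 \<le> subgroup_size (ereal r) n ?m ?b t"
            using elim(1) n real by auto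
          have md: "?m dvd n" using mdvd n by blast
          define p where "p = balance_level (ereal r) n ?m ?b s"
          have lev: "2 powr (- (real p * s)) \<le> C1 * rate L s n ?b"
            unfolding p_def by (rule C1(2)[OF l balance_level_lower[OF r rs l mg]])
          have n0: "0 < n" using log_ge_one_pos l by blast
          have mini: "1 / sqrt (real n) \<le> C2 * rate L s n ?b"
            using inverse_sqrt_le_minimax_rate[OF s(1) l(1)] minimax_rate_le_rate[OF L s(1) l]
            unfolding C2_def by (rule order_trans)
          have a1: "K1 * 2 powr (- (real p * s)) \<le> K1 * (C1 * rate L s n ?b)"
            using lev K1 by (intro mult_left_mono) auto
          have a2: "K2 / sqrt (real n) \<le> K2 * (C2 * rate L s n ?b)"
            using mult_left_mono[OF mini less_imp_le[OF K2]] by simp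
          have "(\<integral>\<^sup>+ d. sup_norm_01 (\<lambda>x. f_hat \<psi> S n ?m ?b \<tau> d x - f x) \<partial>data_law \<sigma> ?m (n div ?m) f)
              \<le> ennreal ((K1 * C1 + K2 * C2) * rate L s n ?b)" if f: "f \<in> besov_ball \<psi> s L" for f
          proof -
            have "(\<integral>\<^sup>+ d. sup_norm_01 (\<lambda>x. f_hat \<psi> S n ?m ?b \<tau> d x - f x) \<partial>data_law \<sigma> ?m (n div ?m) f)
                \<le> ennreal (K1 * 2 powr (- (real p * s))) + ennreal (K2 / sqrt (real n))"
              unfolding real K1_def K2_def p_def Q_def \<kappa>_def
            proof (rule risk_split[OF basis \<psi> C f L r rs less_imp_le[OF s(3)] md l mg _ c0 _ \<tau>c[unfolded \<kappa>_def Q_def]])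
              show "(risk_kappa \<sigma> (tail_const C L r) * C)\<^sup>2 * 256 * log 2 (real n) ^ 3 * real n powr - (r / (1 + r)) \<le> 4"
                using elim(4) by (simp add: \<kappa>_def Q_def)
              show "c0 * log 2 (real n) \<le> real (balance_level (ereal r) n ?m ?b s) - 1"
                unfolding c0_def by (rule balance_level_growth[OF r rs less_imp_le[OF s(3)] l mg elim(3)])
            qed
            also have "\<dots> \<le> ennreal (K1 * (C1 * rate L s n ?b)) + ennreal (K2 * (C2 * rate L s n ?b))"
              by (intro add_mono ennreal_leI a1 a2)
            also have "\<dots> = ennreal ((K1 * C1 + K2 * C2) * rate L s n ?b)"
            proof -
              have "0 \<le> rate L s n ?b"
              proof -
                have "0 \<le> C2 * rate L s n ?b" using mini by (rule order_trans[rotated]) simp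
                then show ?thesis using C2 by (simp add: zero_le_mult_iff)
              qed
              then show ?thesis using K1 K2 C1(1) C2
                by (simp add: ennreal_plus[symmetric] algebra_simps del: ennreal_plus)
            qed
            finally show ?thesis .
          qed
          then show "sup_risk \<sigma> ?m (n div ?m) (besov_ball \<psi> s L) (f_hat \<psi> S n ?m ?b \<tau>)
                  \<le> ennreal ((K1 * C1 + K2 * C2) * rate L s n ?b)"
            unfolding sup_risk_def by (intro SUP_least)
        qed
      qed
      moreover have "0 < K1 * C1 + K2 * C2" using K1 K2 C1(1) C2 by (intro add_pos_pos mult_pos_pos) auto
      ultimately show ?thesis by blast
    qed
    then show ?thesis by (intro exI[of _ \<tau>\<^sub>0]) (auto simp: \<tau>\<^sub>0_def)
  qed
  show ?thesis using member risk by blast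
qed

end
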